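(* Let $n\in\mathbb N$, let $G$ be an orthogonal easy quantum group of dimension $n$, and let $\mathcal C$ be its corresponding category of partitions. Then one of the following holds: (i) $\mathcal C$ is non-hyperoctahedral, and hence it is one of the following 13 categories: $\langle\emptyset\rangle$, $\langle\uparrow\rangle$, $\langle g\rangle$, $\langle\uparrow\otimes\uparrow\rangle$, $\langle c\rangle$, $\langle c,\uparrow\rangle$, $\langle c,\uparrow\otimes\uparrow\rangle$, $\langle h\rangle$, $\langle h,\uparrow\otimes\uparrow\rangle$, $\langle\uparrow,b_4\rangle$, $\langle\uparrow\otimes\uparrow,b_4\rangle$, $\langle c,\uparrow,b_4\rangle$, $\langle c,\uparrow\otimes\uparrow,b_4\rangle$; (ii) $\mathcal C$ is hyperoctahedral and contains the pair positioner partition $r$ (i.e. it is hyperoctahedral and group-theoretical); (iii) $\mathcal C=\langle\pi_l,\ l\le k\rangle$ for some $k\in\{1,2,\ldots,\infty\}$.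
   Context: $\mathbb N=\{1,2,\dots\}$, $\mathbb N_0=\mathbb N\cup\{0\}$. For $k,l\in\mathbb N_0$, a partition $p\in P(k,l)$ is a decomposition of a set of $k$ upper points $1,\dots,k$ and $l$ lower points $1',\dots,l'$ (each row ordered from left to right) into disjoint nonempty subsets, called blocks; $P=\bigsqcup_{k,l}P(k,l)$; $\emptyset\in P(0,0)$ is the empty partition. Category operations: the tensor product $p\otimes q\in P(k+k',l+l')$ of $p\in P(k,l)$, $q\in P(k',l')$ is horizontal concatenation; the composition $qp\in P(k,m)$ of $p\in P(k,l)$, $q\in P(l,m)$ is vertical concatenation ($p$ above $q$, identifying the lower points of $p$ with the upper points of $q$, taking the generated connections between the remaining points, and deleting the middle points and any closed components consisting only of middle points); the involution $p^*\in P(l,k)$ turns $p$ upside down; rotation moves the leftmost (resp. rightmost) point of one row to the leftmost (resp. rightmost) position of the other row, keeping it in its block. A category of partitions is a subset $\mathcal C\subseteq P$ closed under these operations and containing the identity partition $|\in P(1,1)$; $\mathcal C(k,l)=\mathcal C\cap P(k,l)$. $\langle p_1,p_2,\dots\rangle$ denotes the smallest category of partitions containing $p_1,p_2,\dots$. A partition in $P(0,n)$ is identified with a word of length $n$, positions carrying the same letter iff they lie in the same block. Special partitions: singleton $\uparrow\in P(0,1)$; double singleton $\uparrow\otimes\uparrow\in P(0,2)$; four block partition $b_4=aaaa\in P(0,4)$; $g\in P(0,4)$ with blocks $\{1'\},\{2',4'\},\{3'\}$; crossing partition $c\in P(2,2)$ with blocks $\{1,2'\},\{2,1'\}$; half-liberating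 partition $h\in P(3,3)$ with blocks $\{1,3'\},\{2,2'\},\{3,1'\}$; pair positioner partition $r\in P(3,3)$ with blocks $\{1,2,2',3'\},\{3,1'\}$. For $k\in\mathbb N$, $\pi_k\in P(0,4k)$ is the word $a_1a_2\ldots a_ka_k\ldots a_2a_1a_1a_2\ldots a_ka_k\ldots a_2a_1$ with mutually different letters $a_1,\dots,a_k$; $\langle\pi_l,\ l\le\infty\rangle:=\langle\pi_l,\ l\in\mathbb N\rangle$. A category is hyperoctahedral if it contains $b_4$ but not $\uparrow\otimes\uparrow$, and non-hyperoctahedral otherwise; it is group-theoretical if it contains $r$. Quantum groups: a compact matrix quantum group $G$ of dimension $n$ is given by a unital $C^*$-algebra $C(G)$ generated by elements $u_{ij}$ ($1\le i,j\le n$), with $u=(u_{ij})$ and $u^t=(u_{ji})$ invertible, and a $*$-homomorphism $\Delta:C(G)\to C(G)\otimes_{\min}C(G)$ with $\Delta(u_{ij})=\sum_k u_{ik}\otimes u_{kj}$. $S_n\subseteq G\subseteq O_n^+$ means that the $u_{ij}$ are self-adjoint, $u$ is orthogonal ($\sum_k u_{ik}u_{jk}=\sum_k u_{ki}u_{kj}=\delta_{ij}$), and the coordinate functions of the permutation matrix group $S_n\subseteq M_n(\mathbb C)$ are the image of the $u_{ij}$ under a $*$-homomorphism $C(G)\to C(S_n)$. Put $\mathrm{Hom}_G(k,l)=\{T:(\mathbb C^n)^{\otimes k}\to(\mathbb C^n)^{\otimes l}\text{ linear}\mid Tu^{\otimes k}=u^{\otimes l}T\}$. For $p\in P(k,l)$,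 with $e_1,\dots,e_n$ the standard basis of $\mathbb C^n$, $T_p(e_{i(1)}\otimes\cdots\otimes e_{i(k)})=\sum_{j(1),\dots,j(l)}\delta_p(i,j)\,e_{j(1)}\otimes\cdots\otimes e_{j(l)}$, where $\delta_p(i,j)=1$ if labelling the upper points of $p$ by $i$ and the lower points by $j$ gives equal labels within every block, and $0$ otherwise. $G$ with $S_n\subseteq G\subseteq O_n^+$ is an (orthogonal) easy quantum group with corresponding category of partitions $\mathcal C$ if $\mathrm{Hom}_G(k,l)=\mathrm{span}\{T_p\mid p\in\mathcal C(k,l)\}$ for all $k,l\in\mathbb N_0$. *)

theory Defs
  imports
    Complex_Main
    "HOL-Algebra.Algebraic_Closure_Type"
    "HOL-Combinatorics.Permutations"
    "HOL-Library.Disjoint_Sets"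
    "HOL-Library.Extended_Nat"
begin

section \<open>Partitions\<close>

text \<open>
  Points are numbered from 0: \<open>Inl i\<close> is the upper point \<open>i + 1\<close>, and \<open>Inr j\<close> is the lower
  point \<open>(j + 1)'\<close>. A partition is its set of blocks; since the union of the blocks is
  \<open>points k l\<close>, the numbers \<open>k\<close> and \<open>l\<close> can be recovered from it, so that the
  sets \<open>P k l\<close> are pairwise disjoint and \<open>all_partitions\<close> is their disjoint union.
\<close>

type_synonym point = "nat + nat"
type_synonym partition = "point set set"

definition points :: "nat \<Rightarrow> nat \<Rightarrow> point set" where
  "points k l = Sum_Type.Plus {..<k} {..<l}"

definition P :: "nat \<Rightarrow> nat \<Rightarrow> partition set" where
  "P k l = {p. partition_on (points k l) p}"

definition all_partitions :: "partition set" where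
  "all_partitions = (\<Union>k l. P k l)"

definition relabel :: "('a \<Rightarrow> 'b) \<Rightarrow> 'a set set \<Rightarrow> 'b set set" where
  "relabel f p = (\<lambda>b. f ` b) ` p"

definition tensor :: "nat \<Rightarrow> nat \<Rightarrow> partition \<Rightarrow> partition \<Rightarrow> partition" where
  "tensor k l p q = p \<union> relabel (map_sum (\<lambda>i. k + i) (\<lambda>j. l + j)) q"

text \<open>
  For the composition, the points of the vertical concatenation are \<open>Inl i\<close> (upper points of
  \<open>p\<close>), \<open>Inr (Inl j)\<close> (middle points) and \<open>Inr (Inr m)\<close> (lower points of \<open>q\<close>). The middle
  points disappear when the generated equivalence relation is pulled back to the outer points.
\<close>

definition connections :: "partition \<Rightarrow> partition \<Rightarrow> ((nat + nat + nat) \<times> (nat + nat + nat)) set" where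
  "connections p q =
    (\<Union>b \<in> relabel (map_sum id Inl) p \<union> relabel Inr q. b \<times> b)\<^sup>*"

definition composition :: "nat \<Rightarrow> nat \<Rightarrow> partition \<Rightarrow> partition \<Rightarrow> partition" where
  "composition k m q p = points k m //
    {(x, y). x \<in> points k m \<and> y \<in> points k m \<and>
      (map_sum id Inr x, map_sum id Inr y) \<in> connections p q}"

definition involution :: "partition \<Rightarrow> partition" where
  "involution = relabel (case_sum Inr Inl)"

text \<open>
  The four rotations: the first two are applied to a partition having at least one upper
  (resp. lower) point and move the leftmost one; the last two move the rightmost one of
  a partition in \<open>P (Suc k) l\<close> (resp. \<open>P k (Suc l)\<close>).
\<close>

fun rot_left_down :: "point \<Rightarrow> point" where
  "rot_left_down (Inl 0) = Inr 0"
| "rot_left_down (Inl (Suc i)) = Inl i"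
| "rot_left_down (Inr j) = Inr (Suc j)"

fun rot_left_up :: "point \<Rightarrow> point" where
  "rot_left_up (Inr 0) = Inl 0"
| "rot_left_up (Inr (Suc j)) = Inr j"
| "rot_left_up (Inl i) = Inl (Suc i)"

definition rot_right_down :: "nat \<Rightarrow> nat \<Rightarrow> point \<Rightarrow> point" where
  "rot_right_down k l = id(Inl k := Inr l)"

definition rot_right_up :: "nat \<Rightarrow> nat \<Rightarrow> point \<Rightarrow> point" where
  "rot_right_up k l = id(Inr l := Inl k)"

definition identity_partition :: partition where
  "identity_partition = {{Inl 0, Inr 0}}"

definition category :: "partition set \<Rightarrow> bool" where
  "category C \<longleftrightarrow>
     C \<subseteq> all_partitions \<and>
     identity_partition \<in> C \<and>
     (\<forall>k l k' l'. \<forall>p \<in> C \<inter> P k l. \<forall>q \<in> C \<inter> P k' l'. tensor k l p q \<in> C) \<and>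
     (\<forall>k l m. \<forall>p \<in> C \<inter> P k l. \<forall>q \<in> C \<inter> P l m. composition k m q p \<in> C) \<and>
     (\<forall>p \<in> C. involution p \<in> C) \<and>
     (\<forall>k l. \<forall>p \<in> C \<inter> P (Suc k) l. relabel rot_left_down p \<in> C) \<and>
     (\<forall>k l. \<forall>p \<in> C \<inter> P k (Suc l). relabel rot_left_up p \<in> C) \<and>
     (\<forall>k l. \<forall>p \<in> C \<inter> P (Suc k) l. relabel (rot_right_down k l) p \<in> C) \<and>
     (\<forall>k l. \<forall>p \<in> C \<inter> P k (Suc l). relabel (rot_right_up k l) p \<in> C)"

definition generated :: "partition set \<Rightarrow> partition set" where
  "generated S = \<Inter> {C. category C \<and> S \<subseteq> C}"

definition of_word :: "nat list \<Rightarrow> partition" where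
  "of_word w = (\<lambda>a. {Inr j | j. j < length w \<and> w ! j = a}) ` set w"

definition empty_partition :: partition where
  "empty_partition = {}"

definition singleton_partition :: partition where
  "singleton_partition = of_word [0]"

definition double_singleton :: partition where
  "double_singleton = tensor 0 1 singleton_partition singleton_partition"

definition four_block :: partition where
  "four_block = of_word [0, 0, 0, 0]"

definition g_partition :: partition where
  "g_partition = {{Inr 0}, {Inr 1, Inr 3}, {Inr 2}}"

definition crossing :: partition where
  "crossing = {{Inl 0, Inr 1}, {Inl 1, Inr 0}}"

definition half_liberating :: partition where
  "half_liberating = {{Inl 0, Inr 2}, {Inl 1, Inr 1}, {Inl 2, Inr 0}}"

definition pair_positioner :: partition where
  "pair_positioner = {{Inl 0, Inl 1, Inr 1, Inr 2}, {Inl 2, Inr 0}}"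

definition pi_partition :: "nat \<Rightarrow> partition" where
  "pi_partition k = of_word ([0..<k] @ rev [0..<k] @ [0..<k] @ rev [0..<k])"

definition hyperoctahedral :: "partition set \<Rightarrow> bool" where
  "hyperoctahedral C \<longleftrightarrow> four_block \<in> C \<and> double_singleton \<notin> C"

section \<open>Unital C*-algebras\<close>

record 'a star_alg = "(complex, 'a) module" +
  star :: "'a \<Rightarrow> 'a"

record 'a cstar_alg = "'a star_alg" +
  cnorm :: "'a \<Rightarrow> real"

locale star_algebra =
  ring A + module "ring_of_type_algebra :: complex ring" A
  for A :: "('a, 'm) star_alg_scheme" (structure) +
  assumes smult_mult_left: "\<lbrakk>x \<in> carrier A; y \<in> carrier A\<rbrakk> \<Longrightarrow> (c \<odot> x) \<otimes> y = c \<odot> (x \<otimes> y)"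
    and smult_mult_right: "\<lbrakk>x \<in> carrier A; y \<in> carrier A\<rbrakk> \<Longrightarrow> x \<otimes> (c \<odot> y) = c \<odot> (x \<otimes> y)"
    and star_closed: "x \<in> carrier A \<Longrightarrow> star A x \<in> carrier A"
    and star_star: "x \<in> carrier A \<Longrightarrow> star A (star A x) = x"
    and star_add: "\<lbrakk>x \<in> carrier A; y \<in> carrier A\<rbrakk> \<Longrightarrow> star A (x \<oplus> y) = star A x \<oplus> star A y"
    and star_smult: "x \<in> carrier A \<Longrightarrow> star A (c \<odot> x) = cnj c \<odot> star A x"
    and star_mult: "\<lbrakk>x \<in> carrier A; y \<in> carrier A\<rbrakk> \<Longrightarrow> star A (x \<otimes> y) = star A y \<otimes> star A x"

definition is_cstar_norm :: "('a, 'm) star_alg_scheme \<Rightarrow> ('a \<Rightarrow> real) \<Rightarrow> bool" where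
  "is_cstar_norm A N \<longleftrightarrow>
     (\<forall>x \<in> carrier A. 0 \<le> N x \<and> (N x = 0 \<longleftrightarrow> x = \<zero>\<^bsub>A\<^esub>) \<and>
        (\<forall>c. N (c \<odot>\<^bsub>A\<^esub> x) = cmod c * N x) \<and> N (star A x \<otimes>\<^bsub>A\<^esub> x) = (N x)\<^sup>2) \<and>
     (\<forall>x \<in> carrier A. \<forall>y \<in> carrier A.
        N (x \<oplus>\<^bsub>A\<^esub> y) \<le> N x + N y \<and> N (x \<otimes>\<^bsub>A\<^esub> y) \<le> N x * N y)"

definition cauchy_in :: "('a, 'm) star_alg_scheme \<Rightarrow> ('a \<Rightarrow> real) \<Rightarrow> (nat \<Rightarrow> 'a) \<Rightarrow> bool" where
  "cauchy_in A N f \<longleftrightarrow> range f \<subseteq> carrier A \<and>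
     (\<forall>e > 0. \<exists>M. \<forall>m \<ge> M. \<forall>k \<ge> M. N (f m \<ominus>\<^bsub>A\<^esub> f k) < e)"

definition tends_in :: "('a, 'm) star_alg_scheme \<Rightarrow> ('a \<Rightarrow> real) \<Rightarrow> (nat \<Rightarrow> 'a) \<Rightarrow> 'a \<Rightarrow> bool" where
  "tends_in A N f x \<longleftrightarrow> (\<lambda>m. N (f m \<ominus>\<^bsub>A\<^esub> x)) \<longlonglongrightarrow> 0"

locale unital_cstar_algebra = star_algebra A for A :: "('a, 'm) cstar_alg_scheme" (structure) +
  assumes cstar_norm: "is_cstar_norm A (cnorm A)"
    and complete: "cauchy_in A (cnorm A) f \<Longrightarrow> \<exists>x \<in> carrier A. tends_in A (cnorm A) f x"

definition star_hom :: "('a, 'm) star_alg_scheme \<Rightarrow> ('b, 'k) star_alg_scheme \<Rightarrow> ('a \<Rightarrow> 'b) set" where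
  "star_hom A B = {h \<in> ring_hom A B. \<forall>x \<in> carrier A.
     (\<forall>c. h (c \<odot>\<^bsub>A\<^esub> x) = c \<odot>\<^bsub>B\<^esub> h x) \<and> h (star A x) = star B (h x)}"

definition closed_star_subalgebra :: "'a set \<Rightarrow> ('a, 'm) cstar_alg_scheme \<Rightarrow> bool" where
  "closed_star_subalgebra S A \<longleftrightarrow> subring S A \<and>
     (\<forall>c. \<forall>x \<in> S. c \<odot>\<^bsub>A\<^esub> x \<in> S) \<and> (\<forall>x \<in> S. star A x \<in> S) \<and>
     (\<forall>f. \<forall>x \<in> carrier A. range f \<subseteq> S \<and> tends_in A (cnorm A) f x \<longrightarrow> x \<in> S)"

definition generates :: "'a set \<Rightarrow> ('a, 'm) cstar_alg_scheme \<Rightarrow> bool" where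
  "generates U A \<longleftrightarrow> U \<subseteq> carrier A \<and>
     (\<forall>S. closed_star_subalgebra S A \<and> U \<subseteq> S \<longrightarrow> S = carrier A)"

section \<open>Minimal tensor product\<close>

text \<open>
  Elements of the algebraic tensor product are represented by formal sums
  \<open>a\<^sub>1 \<otimes> b\<^sub>1 + \<dots> + a\<^sub>r \<otimes> b\<^sub>r\<close>, given as lists of pairs. Two of them are equal as tensors iff
  every complex bilinear form takes the same value on them.
\<close>

definition bilinear_form ::
  "('a, 'm) star_alg_scheme \<Rightarrow> ('b, 'k) star_alg_scheme \<Rightarrow> ('a \<Rightarrow> 'b \<Rightarrow> complex) \<Rightarrow> bool" where
  "bilinear_form A B \<beta> \<longleftrightarrow>
     (\<forall>a \<in> carrier A. \<forall>a' \<in> carrier A. \<forall>b \<in> carrier B. \<beta> (a \<oplus>\<^bsub>A\<^esub> a') b = \<beta> a b + \<beta> a' b) \<and>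
     (\<forall>a \<in> carrier A. \<forall>b \<in> carrier B. \<forall>b' \<in> carrier B. \<beta> a (b \<oplus>\<^bsub>B\<^esub> b') = \<beta> a b + \<beta> a b') \<and>
     (\<forall>c. \<forall>a \<in> carrier A. \<forall>b \<in> carrier B.
        \<beta> (c \<odot>\<^bsub>A\<^esub> a) b = c * \<beta> a b \<and> \<beta> a (c \<odot>\<^bsub>B\<^esub> b) = c * \<beta> a b)"

definition tensor_rel :: "('a, 'm) star_alg_scheme \<Rightarrow> ('b, 'k) star_alg_scheme \<Rightarrow>
    (('a \<times> 'b) list \<times> ('a \<times> 'b) list) set" where
  "tensor_rel A B = {(s, t).
     s \<in> lists (carrier A \<times> carrier B) \<and> t \<in> lists (carrier A \<times> carrier B) \<and>
     (\<forall>\<beta>. bilinear_form A B \<beta> \<longrightarrow> (\<Sum>(a, b)\<leftarrow>s. \<beta> a b) = (\<Sum>(a, b)\<leftarrow>t. \<beta> a b))}"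

definition tensor_class :: "('a, 'm) star_alg_scheme \<Rightarrow> ('b, 'k) star_alg_scheme \<Rightarrow>
    ('a \<times> 'b) list \<Rightarrow> ('a \<times> 'b) list set" where
  "tensor_class A B s = tensor_rel A B `` {s}"

definition algebraic_tensor :: "('a, 'm) star_alg_scheme \<Rightarrow> ('b, 'k) star_alg_scheme \<Rightarrow>
    ('a \<times> 'b) list set star_alg" where
  "algebraic_tensor A B =
    \<lparr>carrier = lists (carrier A \<times> carrier B) // tensor_rel A B,
     monoid.mult = (\<lambda>U V. \<Union>s \<in> U. \<Union>t \<in> V.
       tensor_class A B [(a \<otimes>\<^bsub>A\<^esub> a', b \<otimes>\<^bsub>B\<^esub> b'). (a, b) \<leftarrow> s, (a', b') \<leftarrow> t]),
     one = tensor_class A B [(\<one>\<^bsub>A\<^esub>, \<one>\<^bsub>B\<^esub>)],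
     ring.zero = tensor_class A B [],
     add = (\<lambda>U V. \<Union>s \<in> U. \<Union>t \<in> V. tensor_class A B (s @ t)),
     module.smult = (\<lambda>c U. \<Union>s \<in> U. tensor_class A B [(c \<odot>\<^bsub>A\<^esub> a, b). (a, b) \<leftarrow> s]),
     star = (\<lambda>U. \<Union>s \<in> U. tensor_class A B [(star A a, star B b). (a, b) \<leftarrow> s])\<rparr>"

text \<open>
  By Takesaki's theorem, the infimum below is attained: the spatial C*-norm is the least one.
\<close>

definition min_tensor_norm :: "('a, 'm) star_alg_scheme \<Rightarrow> ('b, 'k) star_alg_scheme \<Rightarrow>
    ('a \<times> 'b) list set \<Rightarrow> real" where
  "min_tensor_norm A B x = Inf {N x | N. is_cstar_norm (algebraic_tensor A B) N}"

text \<open>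
  The completion of a *-algebra \<open>T\<close> with respect to a norm \<open>N\<close>: Cauchy sequences modulo null
  sequences.
\<close>

definition null_rel :: "('a, 'm) star_alg_scheme \<Rightarrow> ('a \<Rightarrow> real) \<Rightarrow> ((nat \<Rightarrow> 'a) \<times> (nat \<Rightarrow> 'a)) set" where
  "null_rel T N = {(f, g). cauchy_in T N f \<and> cauchy_in T N g \<and>
     (\<lambda>m. N (f m \<ominus>\<^bsub>T\<^esub> g m)) \<longlonglongrightarrow> 0}"

definition seq_class :: "('a, 'm) star_alg_scheme \<Rightarrow> ('a \<Rightarrow> real) \<Rightarrow> (nat \<Rightarrow> 'a) \<Rightarrow> (nat \<Rightarrow> 'a) set" where
  "seq_class T N f = null_rel T N `` {f}"

definition completion :: "('a, 'm) star_alg_scheme \<Rightarrow> ('a \<Rightarrow> real) \<Rightarrow> (nat \<Rightarrow> 'a) set cstar_alg" where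
  "completion T N =
    \<lparr>carrier = {f. cauchy_in T N f} // null_rel T N,
     monoid.mult = (\<lambda>U V. \<Union>f \<in> U. \<Union>g \<in> V. seq_class T N (\<lambda>m. f m \<otimes>\<^bsub>T\<^esub> g m)),
     one = seq_class T N (\<lambda>_. \<one>\<^bsub>T\<^esub>),
     ring.zero = seq_class T N (\<lambda>_. \<zero>\<^bsub>T\<^esub>),
     add = (\<lambda>U V. \<Union>f \<in> U. \<Union>g \<in> V. seq_class T N (\<lambda>m. f m \<oplus>\<^bsub>T\<^esub> g m)),
     module.smult = (\<lambda>c U. \<Union>f \<in> U. seq_class T N (\<lambda>m. c \<odot>\<^bsub>T\<^esub> f m)),
     star = (\<lambda>U. \<Union>f \<in> U. seq_class T N (\<lambda>m. star T (f m))),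
     cnorm = (\<lambda>U. THE x. \<forall>f \<in> U. (\<lambda>m. N (f m)) \<longlonglongrightarrow> x)\<rparr>"

definition min_tensor :: "('a, 'm) star_alg_scheme \<Rightarrow> ('b, 'k) star_alg_scheme \<Rightarrow>
    (nat \<Rightarrow> ('a \<times> 'b) list set) set cstar_alg" where
  "min_tensor A B = completion (algebraic_tensor A B) (min_tensor_norm A B)"

definition pure_tensor :: "('a, 'm) star_alg_scheme \<Rightarrow> ('b, 'k) star_alg_scheme \<Rightarrow>
    'a \<Rightarrow> 'b \<Rightarrow> (nat \<Rightarrow> ('a \<times> 'b) list set) set" where
  "pure_tensor A B a b =
     seq_class (algebraic_tensor A B) (min_tensor_norm A B) (\<lambda>_. tensor_class A B [(a, b)])"

section \<open>Compact matrix quantum groups\<close>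

text \<open>
  A quantum group of dimension \<open>n\<close> is given by its algebra \<open>A\<close>, the generators \<open>u i j\<close> with
  \<open>i, j < n\<close>, and the comultiplication \<open>\<Delta>\<close>.
\<close>

definition kronecker :: "('a, 'm) star_alg_scheme \<Rightarrow> nat \<Rightarrow> nat \<Rightarrow> 'a" where
  "kronecker A i j = (if i = j then \<one>\<^bsub>A\<^esub> else \<zero>\<^bsub>A\<^esub>)"

definition invertible_matrix :: "('a, 'm) star_alg_scheme \<Rightarrow> nat \<Rightarrow> (nat \<Rightarrow> nat \<Rightarrow> 'a) \<Rightarrow> bool" where
  "invertible_matrix A n u \<longleftrightarrow> (\<exists>v. \<forall>i < n. \<forall>j < n. v i j \<in> carrier A \<and>
     (\<Oplus>\<^bsub>A\<^esub>k \<in> {..<n}. u i k \<otimes>\<^bsub>A\<^esub> v k j) = kronecker A i j \<and>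
     (\<Oplus>\<^bsub>A\<^esub>k \<in> {..<n}. v i k \<otimes>\<^bsub>A\<^esub> u k j) = kronecker A i j)"

definition compact_matrix_quantum_group :: "nat \<Rightarrow> 'a cstar_alg \<Rightarrow> (nat \<Rightarrow> nat \<Rightarrow> 'a) \<Rightarrow>
    ('a \<Rightarrow> (nat \<Rightarrow> ('a \<times> 'a) list set) set) \<Rightarrow> bool" where
  "compact_matrix_quantum_group n A u \<Delta> \<longleftrightarrow>
     unital_cstar_algebra A \<and>
     generates {u i j | i j. i < n \<and> j < n} A \<and>
     invertible_matrix A n u \<and> invertible_matrix A n (\<lambda>i j. u j i) \<and>
     \<Delta> \<in> star_hom A (min_tensor A A) \<and>
     (\<forall>i < n. \<forall>j < n. \<Delta> (u i j) =
        (\<Oplus>\<^bsub>min_tensor A A\<^esub>k \<in> {..<n}. pure_tensor A A (u i k) (u k j)))"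

definition permutation_matrices :: "nat \<Rightarrow> (nat \<Rightarrow> nat \<Rightarrow> complex) set" where
  "permutation_matrices n =
     {(\<lambda>i j. if i < n \<and> j < n \<and> i = \<sigma> j then 1 else 0) | \<sigma>. \<sigma> permutes {..<n}}"

text \<open>The algebra of all functions on the finite group of permutation matrices.\<close>

definition functions_Sn :: "nat \<Rightarrow> ((nat \<Rightarrow> nat \<Rightarrow> complex) \<Rightarrow> complex) cstar_alg" where
  "functions_Sn n = (let S = permutation_matrices n in
    \<lparr>carrier = S \<rightarrow>\<^sub>E UNIV,
     monoid.mult = (\<lambda>f g. \<lambda>x\<in>S. f x * g x),
     one = (\<lambda>x\<in>S. 1),
     ring.zero = (\<lambda>x\<in>S. 0),
     add = (\<lambda>f g. \<lambda>x\<in>S. f x + g x),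
     module.smult = (\<lambda>c f. \<lambda>x\<in>S. c * f x),
     star = (\<lambda>f. \<lambda>x\<in>S. cnj (f x)),
     cnorm = (\<lambda>f. SUP x\<in>S. cmod (f x))\<rparr>)"

definition contains_Sn :: "nat \<Rightarrow> 'a cstar_alg \<Rightarrow> (nat \<Rightarrow> nat \<Rightarrow> 'a) \<Rightarrow> bool" where
  "contains_Sn n A u \<longleftrightarrow> (\<exists>h \<in> star_hom A (functions_Sn n).
     \<forall>i < n. \<forall>j < n. h (u i j) = (\<lambda>x \<in> permutation_matrices n. x i j))"

definition contained_in_On_plus :: "nat \<Rightarrow> 'a cstar_alg \<Rightarrow> (nat \<Rightarrow> nat \<Rightarrow> 'a) \<Rightarrow> bool" where
  "contained_in_On_plus n A u \<longleftrightarrow> (\<forall>i < n. \<forall>j < n.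
     star A (u i j) = u i j \<and>
     (\<Oplus>\<^bsub>A\<^esub>k \<in> {..<n}. u i k \<otimes>\<^bsub>A\<^esub> u j k) = kronecker A i j \<and>
     (\<Oplus>\<^bsub>A\<^esub>k \<in> {..<n}. u k i \<otimes>\<^bsub>A\<^esub> u k j) = kronecker A i j)"

section \<open>Intertwiners and easiness\<close>

text \<open>
  The standard basis of the \<open>k\<close>-fold tensor power of \<open>\<complex>\<^sup>n\<close> is indexed by the multi-indices
  below. A linear map between two such tensor powers is identified with its matrix \<open>T\<close>:
  \<open>T j i\<close> is the coefficient of \<open>e\<^sub>j\<close> in the image of \<open>e\<^sub>i\<close>. Outside the index range, the
  entries are 0, so that the identification is one-to-one.
\<close>

definition multi_indices :: "nat \<Rightarrow> nat \<Rightarrow> nat list set" where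
  "multi_indices n k = {i. length i = k \<and> set i \<subseteq> {..<n}}"

definition tensor_power_entry ::
  "('a, 'm) star_alg_scheme \<Rightarrow> (nat \<Rightarrow> nat \<Rightarrow> 'a) \<Rightarrow> nat list \<Rightarrow> nat list \<Rightarrow> 'a" where
  "tensor_power_entry A u i j = foldr (\<otimes>\<^bsub>A\<^esub>) (map2 u i j) \<one>\<^bsub>A\<^esub>"

definition linear_maps :: "nat \<Rightarrow> nat \<Rightarrow> nat \<Rightarrow> (nat list \<Rightarrow> nat list \<Rightarrow> complex) set" where
  "linear_maps n k l =
     {T. \<forall>j i. j \<notin> multi_indices n l \<or> i \<notin> multi_indices n k \<longrightarrow> T j i = 0}"

definition Hom :: "nat \<Rightarrow> 'a cstar_alg \<Rightarrow> (nat \<Rightarrow> nat \<Rightarrow> 'a) \<Rightarrow> nat \<Rightarrow> nat \<Rightarrow>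
    (nat list \<Rightarrow> nat list \<Rightarrow> complex) set" where
  "Hom n A u k l = {T \<in> linear_maps n k l.
     \<forall>j \<in> multi_indices n l. \<forall>i \<in> multi_indices n k.
       (\<Oplus>\<^bsub>A\<^esub>i' \<in> multi_indices n k. T j i' \<odot>\<^bsub>A\<^esub> tensor_power_entry A u i' i) =
       (\<Oplus>\<^bsub>A\<^esub>j' \<in> multi_indices n l. T j' i \<odot>\<^bsub>A\<^esub> tensor_power_entry A u j j')}"

definition label :: "nat list \<Rightarrow> nat list \<Rightarrow> point \<Rightarrow> nat" where
  "label i j = case_sum (\<lambda>a. i ! a) (\<lambda>b. j ! b)"

definition \<delta> :: "partition \<Rightarrow> nat list \<Rightarrow> nat list \<Rightarrow> complex" where
  "\<delta> p i j = (if \<forall>b \<in> p. \<forall>x \<in> b. \<forall>y \<in> b. label i j x = label i j y then 1 else 0)"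

definition T_map :: "nat \<Rightarrow> nat \<Rightarrow> nat \<Rightarrow> partition \<Rightarrow> nat list \<Rightarrow> nat list \<Rightarrow> complex" where
  "T_map n k l p j i =
     (if j \<in> multi_indices n l \<and> i \<in> multi_indices n k then \<delta> p i j else 0)"

definition span_of_maps ::
  "(nat list \<Rightarrow> nat list \<Rightarrow> complex) set \<Rightarrow> (nat list \<Rightarrow> nat list \<Rightarrow> complex) set" where
  "span_of_maps S = {(\<lambda>j i. \<Sum>T \<in> F. c T * T j i) | F c. finite F \<and> F \<subseteq> S}"

definition easy_quantum_group :: "nat \<Rightarrow> 'a cstar_alg \<Rightarrow> (nat \<Rightarrow> nat \<Rightarrow> 'a) \<Rightarrow>
    ('a \<Rightarrow> (nat \<Rightarrow> ('a \<times> 'a) list set) set) \<Rightarrow> partition set \<Rightarrow> bool" where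
  "easy_quantum_group n A u \<Delta> C \<longleftrightarrow>
     compact_matrix_quantum_group n A u \<Delta> \<and>
     contains_Sn n A u \<and> contained_in_On_plus n A u \<and>
     category C \<and>
     (\<forall>k l. Hom n A u k l = span_of_maps (T_map n k l ` (C \<inter> P k l)))"

end

theory Submission
  imports Defs "HOL-Library.Sublist"
begin

text \<open>
  Only the closure properties of \<open>C\<close> matter. Rotating all points to the lower row turns a category
  into a set of words closed under renaming, concatenation, cyclic rotation, reversal and
  contraction of two adjacent points, and inclusion of categories becomes inclusion of word sets.
  So one has to derive each word of \<open>C\<close> from the generators.

  Without \<open>b\<^sub>4\<close>, all blocks have size at most 2, and \<open>C\<close> is determined by which of the words of
  \<open>\<up>\<close>, \<open>\<up> \<otimes> \<up>\<close>, \<open>g\<close>, \<open>c\<close>, \<open>h\<close> it contains: a pair enclosing an odd number of points yields \<open>c\<close> or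
  \<open>g\<close>, and otherwise a crossing yields \<open>h\<close>. If \<open>g \<in> C\<close> (in particular if \<open>b\<^sub>4\<close> and
  \<open>\<up> \<otimes> \<up>\<close> are in \<open>C\<close>), adding singletons reduces everything to the case \<open>\<up> \<in> C\<close>.

  If \<open>C\<close> is hyperoctahedral and \<open>r \<notin> C\<close>, then every word of \<open>C\<close> is a closed walk on a tree whose
  edges are its letters, since a shortest exception would yield \<open>r\<close>. Such a walk is built up
  inductively: one takes two visits of a leaf with the walk in between as short as possible,
  removes one of them, and regains it by moving the detour to the leaf along that walk. Each step
  is an instance of a \<open>\<pi>\<^sub>l\<close>, which can be obtained from the walk by cancelling backtrackings.
\<close>

section \<open>Categories of words\<close>

text \<open>General composition is not among the closure properties: inserting a word and
  contracting at the seam, pair by pair, replays it. A word \<open>rev s @ t\<close> thus acts as a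
  rewriting rule from \<open>s\<close> to \<open>t\<close>, and most derivations are rewritings of
  this kind.

  Trees enter because \<open>r\<close> is the rule from \<open>1 1 0\<close> to
  \<open>0 1 1\<close>, which carries a pair \<open>1 1\<close> past a point of another block.
  Without \<open>r\<close>, a pair \<open>e e\<close> travels as a detour
  \<open>q e e (rev q)\<close> along a path \<open>q\<close> to a base point, and prolonging or
  shortening the detour by one step takes a \<open>pi\<close> word whose index is given by the
  length of the path. This is where the sequence of generators comes from.

  The delicate point is that the \<open>pi\<close> words used must belong to the given category. The
  choice of a shortest loop between two visits of a leaf settles it: by minimality, the rest of the
  walk passes through each vertex of that loop, and cancelling backtrackings on both parts leaves
  the desired \<open>pi\<close> word.\<close>

locale word_category =
  fixes W :: "nat list set"
  assumes pair: "[0, 0] \<in> W"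
    and rename: "\<lbrakk>w \<in> W; inj_on f (set w)\<rbrakk> \<Longrightarrow> map f w \<in> W"
    and conc: "\<lbrakk>u \<in> W; v \<in> W; set u \<inter> set v = {}\<rbrakk> \<Longrightarrow> u @ v \<in> W"
    and rotate1: "a # w \<in> W \<Longrightarrow> w @ [a] \<in> W"
    and reverse: "w \<in> W \<Longrightarrow> rev w \<in> W"
    and contract2: "a # b # w \<in> W \<Longrightarrow> map (id(b := a)) w \<in> W"

lemma ex_fresh: "finite A \<Longrightarrow> \<exists>s :: nat. s \<notin> A"
  by (rule ex_new_if_finite) auto

lemma map_upd_idle: "b \<notin> set w \<Longrightarrow> map (id(b := a)) w = w"
  by (induction w) auto

context word_category
begin

lemma rotate: "u @ v \<in> W \<Longrightarrow> v @ u \<in> W"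
proof (induction u arbitrary: v)
  case (Cons a u)
  then show ?case using rotate1[of a "u @ v"] Cons.IH[of "v @ [a]"] by simp
qed simp

lemma pattern: "\<lbrakk>w \<in> W; map f w = v; inj_on f (set w)\<rbrakk> \<Longrightarrow> v \<in> W"
  using rename by blast

lemma pair_any: "[a, a] \<in> W"
  using rename[OF pair, of "\<lambda>_. a"] by simp

lemma nil: "[] \<in> W"
  using contract2[OF pair] by simp

lemma insert_word:
  assumes "u @ v \<in> W" "x \<in> W" "set x \<inter> (set u \<union> set v) = {}"
  shows "u @ x @ v \<in> W"
proof -
  have "x @ v @ u \<in> W"
    using conc[OF assms(2) rotate[OF assms(1)]] assms(3) by auto
  then show ?thesis
    using rotate[of "x @ v" u] by simp
qed

lemma insert_pair: "\<lbrakk>u @ v \<in> W; a \<notin> set u; a \<notin> set v\<rbrakk> \<Longrightarrow> u @ [a, a] @ v \<in> W"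
  using insert_word[of u v "[a, a]"] pair_any by auto

lemma contract:
  assumes "u @ [a, b] @ v \<in> W"
  shows "map (id(b := a)) (u @ v) \<in> W"
proof -
  have "a # b # v @ u \<in> W" using rotate[OF assms] by simp
  then have "map (id(b := a)) v @ map (id(b := a)) u \<in> W"
    using contract2[of a b "v @ u"] by simp
  from rotate[OF this] show ?thesis by simp
qed

lemma contract_equal: "u @ [a, a] @ v \<in> W \<Longrightarrow> u @ v \<in> W"
  using contract[of u a a v] by (simp add: fun_upd_idem)

lemma contract_fresh: "\<lbrakk>u @ [a, b] @ v \<in> W; b \<notin> set u; b \<notin> set v\<rbrakk> \<Longrightarrow> u @ v \<in> W"
  using contract[of u a b v] map_upd_idle[of b "u @ v" a] by simp

text \<open>The seam between \<open>map f s\<close> and its reversed copy is contracted from the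
  inside outwards. \<open>A\<close> holds the letters already identified: a letter of
  \<open>s\<close> that returns has the same name on both sides and is cancelled, a new one passes
  the name \<open>f a\<close> on to all its copies. \<open>S'\<close> keeps the names given by
  \<open>f\<close> apart from the temporary names \<open>k\<close>.\<close>

lemma glue:
  assumes "u @ map f s @ rev (map (\<lambda>x. if x \<in> A then f x else k x) s)
      @ map (\<lambda>x. if x \<in> A then f x else k x) t @ v \<in> W"
    and "inj_on k S" "set s \<subseteq> S" "set t \<subseteq> S"
    and "k ` S \<inter> (set u \<union> set v \<union> f ` S') = {}" "set s \<union> A \<subseteq> S'"
  shows "u @ map (\<lambda>x. if x \<in> A \<union> set s then f x else k x) t @ v \<in> W"
  using assms
proof (induction s arbitrary: A rule: rev_induct)
  case (snoc a s)
  let ?k = "\<lambda>A x. if x \<in> A then f x else k x"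
  have *: "(u @ map f s) @ [f a, ?k A a] @ (rev (map (?k A) s) @ map (?k A) t @ v) \<in> W"
    using snoc.prems(1) by simp
  have step: "(u @ map f s) @ rev (map (?k (insert a A)) s) @ map (?k (insert a A)) t @ v \<in> W"
  proof (cases "a \<in> A")
    case True
    then have "insert a A = A" by auto
    then show ?thesis using True contract_equal[of "u @ map f s" "f a"] * by simp
  next
    case False
    let ?m = "id(k a := f a)"
    have aS: "a \<in> S" using snoc.prems(3) by auto
    have fk: "f x \<noteq> k a" if "x \<in> S'" for x
      using snoc.prems(5) that aS by blast
    have u: "map ?m u = u" "map ?m v = v"
      using snoc.prems(5) aS by (auto intro!: map_upd_idle)
    have m: "?m (?k A x) = ?k (insert a A) x" if "x \<in> S" for x
    proof -
      have "k x = k a \<longleftrightarrow> x = a" using snoc.prems(2) that aS by (meson inj_onD)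
      then show ?thesis using fk snoc.prems(6) False by auto
    qed
    have "map ?m (map f s) = map f s"
      using fk snoc.prems(6) by auto
    moreover have mm: "map ?m (map (?k A) x) = map (?k (insert a A)) x" if "set x \<subseteq> S" for x
    proof -
      have "\<And>y. y \<in> set x \<Longrightarrow> ?m (?k A y) = ?k (insert a A) y" using m that by blast
      then show ?thesis unfolding map_map o_def by (rule map_cong[OF refl])
    qed
    moreover have "map ?m (rev (map (?k A) s)) = rev (map (?k (insert a A)) s)"
      unfolding rev_map[symmetric] using mm[of s] snoc.prems(3) by simp
    ultimately show ?thesis
      using contract[OF *] False u mm[OF snoc.prems(4)]
      by (simp only: map_append append_assoc if_False)
  qed
  have "u @ map (?k (insert a A \<union> set s)) t @ v \<in> W"
  proof (rule snoc.IH)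
    show "u @ map f s @ rev (map (?k (insert a A)) s) @ map (?k (insert a A)) t @ v \<in> W"
      using step by (simp only: append_assoc)
    show "set s \<subseteq> S" using snoc.prems(3) by simp
    show "set s \<union> insert a A \<subseteq> S'" using snoc.prems(6) by auto
  qed (fact snoc.prems)+
  then show ?case by simp
qed simp

text \<open>
  The word \<open>rev s @ t\<close>, read as a partition with upper points \<open>s\<close> and lower points \<open>t\<close>, is
  composed with a word containing an instance of \<open>s\<close>. Letters of \<open>t\<close> not in \<open>s\<close> are new blocks.
\<close>

lemma replace_fresh:
  assumes "u @ map f s @ v \<in> W" and "rev s @ t \<in> W"
    and inj: "inj_on g (set t - set s)"
    and fresh: "g ` (set t - set s) \<inter> (set u \<union> set v \<union> f ` set s) = {}"
  shows "u @ map (\<lambda>x. if x \<in> set s then f x else g x) t @ v \<in> W"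
proof -
  let ?S = "set s \<union> set t"
  let ?B = "set u \<union> set v \<union> f ` set s \<union> g ` (set t - set s)"
  define N where "N = Suc (Max (insert 0 ?B))"
  have N: "x < N" if "x \<in> ?B" for x
    using that Max_ge[of "insert 0 ?B" x] by (auto simp: N_def less_Suc_eq_le)
  \<comment> \<open>Letters of \<open>s\<close> are shifted above all letters in use, so that the
    inserted copy of \<open>rev s @ t\<close> shares no block with the rest; the new blocks of
    \<open>t\<close> get their final names \<open>g\<close> at once.\<close>
  define k where "k = (\<lambda>x. if x \<in> set s then N + x else g x)"
  have gN: "g y < N + x" if "y \<in> set t" "y \<notin> set s" for x y
    using N[of "g y"] that by auto
  have k: "inj_on k ?S"
  proof (rule inj_onI)
    fix x y assume "x \<in> ?S" "y \<in> ?S" "k x = k y"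
    then show "x = y"
      using gN[of x y] gN[of y x] inj by (auto simp: k_def inj_on_def split: if_splits)
  qed
  have kB: "k ` ?S \<inter> (set u \<union> set v \<union> f ` set s) = {}"
  proof -
    have "k x \<notin> set u \<union> set v \<union> f ` set s" if "x \<in> ?S" for x
    proof (cases "x \<in> set s")
      case True
      then show ?thesis using N[of "N + x"] by (auto simp: k_def)
    next
      case False
      then show ?thesis using that fresh by (auto simp: k_def)
    qed
    then show ?thesis by auto
  qed
  have "rev (map k s) @ map k t \<in> W"
    using rename[OF assms(2), of k] k by (auto simp: rev_map)
  then have "(u @ map f s) @ (rev (map k s) @ map k t) @ v \<in> W"
    by (rule insert_word[rotated]) (use assms(1) kB in auto)
  then have *: "u @ map f s @ rev (map k s) @ map k t @ v \<in> W" by simp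
  have "u @ map (\<lambda>x. if x \<in> {} \<union> set s then f x else k x) t @ v \<in> W"
    by (rule glue[where S = ?S and S' = "set s"]) (use * k kB in \<open>simp_all only: Un_upper1 Un_upper2 Un_empty_right empty_iff if_False subset_refl\<close>)
  moreover have "map (\<lambda>x. if x \<in> set s then f x else k x) t
      = map (\<lambda>x. if x \<in> set s then f x else g x) t"
    by (auto simp: k_def)
  ultimately show ?thesis by (simp only: Un_empty_left)
qed

lemma replace:
  assumes "u @ map f s @ v \<in> W" "rev s @ t \<in> W" "set t \<subseteq> set s"
  shows "u @ map f t @ v \<in> W"
proof -
  have "u @ map (\<lambda>x. if x \<in> set s then f x else f x) t @ v \<in> W"
    using assms Diff_eq_empty_iff[THEN iffD2, OF assms(3)]
    by (intro replace_fresh) (simp_all only: image_empty inj_on_empty Int_empty_left)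
  then show ?thesis by simp
qed

text \<open>This is the product of a partition with its reflection, \<open>u\<close> and
  \<open>x\<close> being its two rows: blocks of \<open>u\<close> that reach \<open>x\<close> are
  joined to their mirror images, blocks inside \<open>u\<close> obtain a disjoint copy, named by
  \<open>g\<close>.\<close>

lemma mirror:
  assumes "u @ x \<in> W" "inj_on g (set u - set x)" "g ` (set u - set x) \<inter> (set u \<union> set x) = {}"
  shows "u @ map (\<lambda>y. if y \<in> set x then y else g y) (rev u) \<in> W"
proof -
  have "u @ map (\<lambda>y. if y \<in> set x then y else g y) (rev u) @ [] \<in> W"
    by (rule replace_fresh[where f = "\<lambda>y. y"]) (use assms reverse[OF assms(1)] in auto)
  then show ?thesis by simp
qed

lemma mirror_fixed: "\<lbrakk>u @ x \<in> W; set u \<subseteq> set x\<rbrakk> \<Longrightarrow> u @ rev u \<in> W"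
  using replace[of u id x "[]" "rev u"] reverse[of "u @ x"] by auto

text \<open>Mirroring at the single point \<open>a\<close> yields two points that nothing
  connects.\<close>

lemma double_singleton_if_singleton:
  assumes "u @ [a] @ v \<in> W" "a \<notin> set u" "a \<notin> set v"
  shows "[0, 1] \<in> W"
proof -
  have *: "[a] @ (v @ u) \<in> W" using rotate[OF assms(1)] by simp
  obtain b where b: "b \<notin> insert a (set v \<union> set u)" using ex_fresh[of "insert a (set v \<union> set u)"] by auto
  have "[a] @ map (\<lambda>y. if y \<in> set (v @ u) then y else b) (rev [a]) \<in> W"
    by (rule mirror[OF *]) (use b in \<open>auto simp: inj_on_def\<close>)
  then have "[a, b] \<in> W" using assms(2,3) by simp
  moreover have "inj_on (\<lambda>x. if x = a then 0 else 1 :: nat) (set [a, b])" using b by simp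
  ultimately have "map (\<lambda>x. if x = a then 0 else 1) [a, b] \<in> W" by (rule rename)
  then show ?thesis using b by simp
qed

lemma singletons:
  assumes "[0, 1] \<in> W" "a \<noteq> b"
  shows "[a, b] \<in> W"
  using rename[OF assms(1), of "\<lambda>x. if x = 0 then a else b"] assms(2) by simp

lemma singleton_if_odd:
  assumes "w \<in> W" "odd (length w)"
  shows "[a] \<in> W"
  using assms
proof (induction "length w" arbitrary: w rule: less_induct)
  case less
  obtain b v where w: "w = b # v" using less.prems(2) by (cases w) auto
  show ?case
  proof (cases v)
    case Nil
    then show ?thesis using less.prems w rename[of "[b]" "\<lambda>_. a"] by simp
  next
    case (Cons c v')
    then show ?thesis
      using less.hyps[of "map (id(c := b)) v'"] contract2[of b c v'] less.prems w by simp
  qed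
qed

text \<open>Mirroring a stretch \<open>a x a\<close> whose block continues outside keeps its end
  points and their images in one block, with \<open>a a\<close> in the middle. Mirroring once more
  at this middle pair, whose block also occurs outside it, removes the letters of
  \<open>x\<close>.\<close>

lemma four_block_if_three:
  assumes "w \<in> W" "3 \<le> count_list w a"
  shows "[0, 0, 0, 0] \<in> W"
proof -
  have split: "\<exists>u v. w = u @ [a] @ v \<and> a \<notin> set u \<and> count_list v a = n"
    if "count_list w a = Suc n" for w n
  proof -
    have "a \<in> set w" using that by (cases "a \<in> set w") (auto simp: count_list_0_iff)
    then obtain u v where "w = u @ a # v" "a \<notin> set u" using split_list_first by fastforce
    moreover have "count_list u a = 0" using \<open>a \<notin> set u\<close> by (simp add: count_list_0_iff)
    ultimately show ?thesis using that by (intro exI[of _ u] exI[of _ v]) simp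
  qed
  define n where "n = count_list w a - 3"
  have n: "count_list w a = Suc (Suc (Suc n))" using assms(2) by (simp add: n_def)
  obtain u v where w: "w = u @ [a] @ v" "count_list v a = Suc (Suc n)" using split[OF n] by auto
  obtain x v' where v: "v = x @ [a] @ v'" "count_list v' a = Suc n" using split[OF w(2)] by auto
  have a: "a \<in> set v'" using v(2) by (cases "a \<in> set v'") (auto simp: count_list_0_iff)
  let ?y = "v' @ u"
  have *: "([a] @ x @ [a]) @ ?y \<in> W" using rotate[of u "[a] @ v"] assms(1) w v by simp
  define N where "N = Suc (Max (insert a (set x \<union> set ?y)))"
  have N: "z < N" if "z \<in> insert a (set x \<union> set ?y)" for z
    using that Max_ge[of "insert a (set x \<union> set ?y)" z] by (auto simp: N_def less_Suc_eq_le)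
  let ?f = "\<lambda>z. if z \<in> set ?y then z else N + z"
  have "([a] @ x @ [a]) @ map ?f (rev ([a] @ x @ [a])) \<in> W"
  proof (rule mirror[OF *])
    show "(\<lambda>z. N + z) ` (set ([a] @ x @ [a]) - set ?y) \<inter> (set ([a] @ x @ [a]) \<union> set ?y) = {}"
      using N by fastforce
  qed simp
  then have "([a] @ x) @ [a, a] @ (map ?f (rev x) @ [a]) \<in> W" using a by simp
  then have "[a, a] @ (map ?f (rev x) @ [a]) @ [a] @ x \<in> W"
    using rotate[of "[a] @ x" "[a, a] @ map ?f (rev x) @ [a]"] by simp
  then have "[a, a] @ rev [a, a] \<in> W" by (rule mirror_fixed) simp
  then show ?thesis using rename[of "[a, a, a, a]" "\<lambda>_. 0"] by simp
qed

text \<open>A four block inserted behind \<open>b\<close> and contracted with it triples that point;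
  contracting \<open>a\<close> with one of the copies leaves two points where \<open>a\<close> and
  \<open>b\<close> stood.\<close>

lemma join:
  assumes "[0, 0, 0, 0] \<in> W" "u @ [a, b] @ v \<in> W"
  shows "map (id(b := a)) (u @ [a, b] @ v) \<in> W"
proof -
  obtain c where c: "c \<notin> {a, b} \<union> set u \<union> set v" using ex_fresh[of "{a, b} \<union> set u \<union> set v"] by auto
  have "[c, c, c, c] \<in> W" using rename[OF assms(1), of "\<lambda>_. c"] by simp
  then have 1: "(u @ [a, b]) @ [c, c, c, c] @ v \<in> W"
    using insert_word[of "u @ [a, b]" v "[c, c, c, c]"] assms(2) c by auto
  have "map (id(c := b)) ((u @ [a]) @ [c, c, c] @ v) \<in> W"
    using contract[of "u @ [a]" b c "[c, c, c] @ v"] 1 by simp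
  moreover have "map (id(c := b)) u = u" "map (id(c := b)) v = v" "a \<noteq> c"
    using c by (auto intro!: map_upd_idle)
  ultimately have "u @ [a, b] @ [b, b] @ v \<in> W" by simp
  from contract[OF this] show ?thesis by (cases "a = b") (simp_all add: fun_upd_idem)
qed

lemma triple:
  assumes "[0, 0, 0, 0] \<in> W" "u @ [a] @ v \<in> W"
  shows "u @ [a, a, a] @ v \<in> W"
  using replace[of u "\<lambda>_. a" "[0]" v "[0, 0, 0]"] assms by simp

end

section \<open>Singletons and crossings\<close>

text \<open>Occurrences of \<open>a\<close> are counted with sign + at even and - at odd distance
  from the beginning. For a block of two points the sum vanishes iff the gap between them is even,
  which makes the parity condition compatible with concatenation.\<close>

fun alt :: "'a \<Rightarrow> 'a list \<Rightarrow> int" where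
  "alt a [] = 0"
| "alt a (x # w) = (if x = a then 1 else 0) - alt a w"

lemma alt_append: "alt a (u @ v) = alt a u + (if even (length u) then alt a v else - alt a v)"
  by (induction u) auto

lemma alt_notin: "a \<notin> set w \<Longrightarrow> alt a w = 0"
  by (induction w) auto

lemma ex_fresh_word: "\<exists>s. s \<notin> set (w :: nat list)"
  by (rule ex_fresh) simp

definition crossing_word :: "'a list \<Rightarrow> bool" where
  "crossing_word w \<longleftrightarrow> (\<exists>a b. a \<noteq> b \<and> subseq [a, b, a, b] w)"

lemma crossing_word_mono: "\<lbrakk>subseq v w; crossing_word v\<rbrakk> \<Longrightarrow> crossing_word w"
  unfolding crossing_word_def by (meson subseq_order.order_trans)

lemma crossing_wordI: "\<lbrakk>a \<noteq> b; b \<in> set x; b \<in> set y\<rbrakk> \<Longrightarrow> crossing_word (a # x @ a # y)"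
  unfolding crossing_word_def
  by (intro exI[of _ a] exI[of _ b] conjI)
    (auto simp: subseq_singleton_left intro!: subseq_Cons2 list_emb_append_mono[of _ "[b]" _ "[a, b]", simplified])

lemma noncrossing_split:
  assumes "\<not> crossing_word (a # x @ a # y)" "a \<notin> set x"
  shows "set x \<inter> set (a # y) = {}"
  using crossing_wordI[of a _ x y] assms by fastforce

lemma crossing_word_split:
  assumes "crossing_word w"
  obtains a b t x y z v where "a \<noteq> b" "w = t @ [a] @ x @ [b] @ y @ [a] @ z @ [b] @ v"
proof -
  obtain a b where ab: "a \<noteq> b" "subseq [a, b, a, b] w"
    using assms by (auto simp: crossing_word_def)
  then show ?thesis
    by (auto dest!: list_emb_ConsD intro: that)
qed

context word_category
begin

lemma swap:
  assumes "[0, 1, 0, 1] \<in> W" "u @ [a, b] @ v \<in> W"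
  shows "u @ [b, a] @ v \<in> W"
proof -
  have "[1, 0, 1, 0] \<in> W" using rotate1[of 0 "[1, 0, 1]"] assms(1) by simp
  then show ?thesis
    using replace[of u "\<lambda>x. if x = 0 then a else b" "[0, 1]" v "[1, 0]"] assms(2) by simp
qed

lemma move:
  assumes "[0, 1, 0, 1] \<in> W" "u @ [a] @ x @ v \<in> W"
  shows "u @ x @ [a] @ v \<in> W"
  using assms(2)
proof (induction x arbitrary: u)
  case (Cons b x)
  then show ?case using swap[OF assms(1), of u a b "x @ v"] Cons.IH[of "u @ [b]"] by simp
qed simp

lemma move_back:
  assumes "[0, 1, 0, 1] \<in> W" "u @ x @ [a] @ v \<in> W"
  shows "u @ [a] @ x @ v \<in> W"
  using assms(2)
proof (induction x arbitrary: v rule: rev_induct)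
  case (snoc b x)
  then show ?case using swap[OF assms(1), of "u @ x" b a v] snoc.IH[of "[b] @ v"] by simp
qed simp

text \<open>The crossing carries \<open>a\<close> next to an occurrence of \<open>b\<close>, the
  four block merges the two blocks there, and the crossing carries \<open>a\<close> back.\<close>

lemma merge:
  assumes "[0, 0, 0, 0] \<in> W" "[0, 1, 0, 1] \<in> W" "w \<in> W" "a \<in> set w"
  shows "map (id(b := a)) w \<in> W"
proof (cases "b \<in> set w \<and> a \<noteq> b")
  case True
  let ?m = "map (id(b := a))"
  obtain u v where w: "w = u @ a # v" using split_list[OF assms(4)] by blast
  have "a # v @ u \<in> W" using rotate[of u "a # v"] assms(3) w by simp
  moreover have "b \<in> set (v @ u)" using True w by auto
  then obtain x y where xy: "v @ u = x @ b # y" using split_list[of b "v @ u"] by blast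
  ultimately have "[] @ [a] @ x @ [b] @ y \<in> W" by simp
  then have "[] @ x @ [a] @ [b] @ y \<in> W" by (intro move[OF assms(2)])
  then have "?m (x @ [a, b] @ y) \<in> W" by (intro join[OF assms(1)]) simp
  then have "[] @ ?m x @ [a] @ ([a] @ ?m y) \<in> W" using True by simp
  then have "[] @ [a] @ ?m x @ ([a] @ ?m y) \<in> W" by (intro move_back[OF assms(2)])
  moreover have "?m ([a] @ v @ u) = [] @ [a] @ ?m x @ ([a] @ ?m y)" using True xy by simp
  ultimately have "?m ([a] @ v) @ ?m u \<in> W" by simp
  from rotate[OF this] show ?thesis using w by simp
next
  case False
  then show ?thesis
    using assms(3) by (cases "a = b") (auto simp: map_upd_idle fun_upd_idem)
qed

lemma map_any:
  assumes "[0, 0, 0, 0] \<in> W" "[0, 1, 0, 1] \<in> W" "w \<in> W"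
  shows "map f w \<in> W"
  using assms(3)
proof (induction "card (set w)" arbitrary: w rule: less_induct)
  case less
  show ?case
  proof (cases "inj_on f (set w)")
    case True
    then show ?thesis using rename less.prems by blast
  next
    case False
    then obtain a b where ab: "a \<in> set w" "b \<in> set w" "f a = f b" "a \<noteq> b"
      by (auto simp: inj_on_def)
    let ?w = "map (id(b := a)) w"
    have "set ?w \<subseteq> set w - {b}" using ab by auto
    then have "card (set ?w) < card (set w)"
      using ab(2) by (metis DiffD2 List.finite_set finite_Diff insertI1 psubset_card_mono psubsetI subsetD
          subset_trans Diff_subset)
    then have "map f ?w \<in> W" using less.hyps merge[OF assms(1,2) less.prems ab(1)] by blast
    moreover have "map f ?w = map f w" using ab(3) by auto
    ultimately show ?thesis by (simp only:)
  qed
qed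

lemma singleton_any: "[0] \<in> W \<Longrightarrow> [a] \<in> W"
  using rename[of "[0]" "\<lambda>_. a"] by simp

text \<open>A word of distinct singletons maps onto any word of the same length.\<close>

lemma all_words:
  assumes "[0] \<in> W" "[0, 0, 0, 0] \<in> W" "[0, 1, 0, 1] \<in> W"
  shows "w \<in> W"
proof -
  have "[0..<n] \<in> W" for n
  proof (induction n)
    case (Suc n)
    then show ?case using conc[OF Suc singleton_any[OF assms(1), of n]] by simp
  qed (simp add: nil)
  then have "map ((!) w) [0..<length w] \<in> W" by (rule map_any[OF assms(2,3)])
  then show ?thesis by (simp add: map_nth)
qed

lemma delete:
  assumes "[0] \<in> W" "u @ [a] @ v \<in> W"
  shows "u @ v \<in> W"
proof -
  obtain s where s: "s \<notin> set (u @ [a] @ v)" using ex_fresh_word by blast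
  have "(u @ [a]) @ [s] @ v \<in> W"
    using insert_word[of "u @ [a]" v "[s]"] singleton_any[OF assms(1)] assms(2) s by simp
  then show ?thesis using contract_fresh[of u a s v] s by simp
qed

lemma delete_subseq:
  assumes "[0] \<in> W" "w \<in> W" "subseq v w"
  shows "v \<in> W"
proof -
  have "u @ v \<in> W" if "u @ w \<in> W" for u
    using assms(3) that
  proof (induction arbitrary: u rule: list_emb.induct)
    case (list_emb_Nil ys)
    then show ?case
    proof (induction ys)
      case (Cons y ys)
      then show ?case using delete[OF assms(1), of u y ys] by simp
    qed simp
  next
    case (list_emb_Cons xs ys y)
    then show ?case using delete[OF assms(1), of u y ys] by simp
  next
    case (list_emb_Cons2 x y xs ys)
    then show ?case using list_emb_Cons2.IH[of "u @ [x]"] by simp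
  qed
  from this[of "[]"] show ?thesis using assms(2) by simp
qed

lemma crossing_if_singleton:
  assumes "[0] \<in> W" "w \<in> W" "crossing_word w"
  shows "[0, 1, 0, 1] \<in> W"
proof -
  obtain a b where ab: "a \<noteq> b" "subseq [a, b, a, b] w"
    using assms(3) by (auto simp: crossing_word_def)
  then have "[a, b, a, b] \<in> W" using delete_subseq assms by blast
  then show ?thesis
    by (rule pattern[where f = "\<lambda>x. if x = a then 0 else 1"]) (use ab(1) in auto)
qed

lemma small_block_words:
  assumes "[0, 1, 0, 1] \<in> W"
    and "\<forall>a \<in> set w. count_list w a = 2 \<or> (count_list w a = 1 \<and> [0] \<in> W)"
  shows "w \<in> W"
  using assms(2)
proof (induction "length w" arbitrary: w rule: less_induct)
  case less
  have count: "count_list w b = 2 \<or> (count_list w b = 1 \<and> [0] \<in> W)" if "b \<in> set w" for b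
    using less.prems that by (rule bspec)
  show ?case
  proof (cases w)
    case (Cons a w')
    show ?thesis
    proof (cases "a \<in> set w'")
      case False
      then have "count_list w a = 1" using Cons by simp
      then have "[0] \<in> W" using count[of a] Cons by simp
      moreover have "w' \<in> W"
      proof (rule less.hyps)
        show "\<forall>b \<in> set w'. count_list w' b = 2 \<or> (count_list w' b = 1 \<and> [0] \<in> W)"
        proof
          fix b assume "b \<in> set w'"
          then have "b \<in> set w" and eq: "count_list w b = count_list w' b"
            using Cons False by auto
          then show "count_list w' b = 2 \<or> (count_list w' b = 1 \<and> [0] \<in> W)"
            using count[of b] unfolding eq by blast
        qed
      qed (simp add: Cons)
      ultimately show ?thesis
        using conc[OF singleton_any[of a], of w'] False Cons by auto
    next
      case True
      then obtain x y where w': "w' = x @ a # y" by (auto dest: split_list)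
      have "count_list w a = 2" using count[of a] Cons w' by simp
      then have a: "a \<notin> set x" "a \<notin> set y" using Cons w' by (auto simp: count_list_0_iff)
      have "x @ y \<in> W"
      proof (rule less.hyps)
        show "\<forall>b \<in> set (x @ y). count_list (x @ y) b = 2 \<or> (count_list (x @ y) b = 1 \<and> [0] \<in> W)"
        proof
          fix b assume "b \<in> set (x @ y)"
          then have "b \<in> set w" and eq: "count_list w b = count_list (x @ y) b"
            using a Cons w' by auto
          then show "count_list (x @ y) b = 2 \<or> (count_list (x @ y) b = 1 \<and> [0] \<in> W)"
            using count[of b] unfolding eq by blast
        qed
      qed (simp add: Cons w')
      then have "[a] @ [a] @ x @ y \<in> W" using insert_pair[of "[]" "x @ y" a] a by simp
      then show ?thesis using move[OF assms(1), of "[a]" a x y] Cons w' by simp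
    qed
  qed (simp add: nil)
qed

text \<open>If the first letter \<open>a\<close> returns, the stretch up to its first return shares
  no letter with the rest and can be inserted afterwards. It remains to double the leading
  \<open>a\<close>: by \<open>triple\<close> and one deletion if a further \<open>a\<close> follows,
  by inserting a pair otherwise.\<close>

lemma noncrossing_words:
  assumes "[0] \<in> W" "\<not> crossing_word w"
    and "[0, 0, 0, 0] \<in> W \<or> (\<forall>a. count_list w a \<le> 2)"
  shows "w \<in> W"
  using assms(2,3)
proof (induction "length w" arbitrary: w rule: less_induct)
  case less
  have sub: "v \<in> W" if "subseq v w" "length v < length w" for v
  proof (rule less.hyps[OF that(2)])
    show "\<not> crossing_word v" using crossing_word_mono that less.prems by blast
    have "count_list v a \<le> count_list w a" for a
      using that(1) by (induction rule: list_emb.induct) auto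
    then show "[0, 0, 0, 0] \<in> W \<or> (\<forall>a. count_list v a \<le> 2)"
      using less.prems(2) order_trans by blast
  qed
  show ?case
  proof (cases w)
    case (Cons a w')
    show ?thesis
    proof (cases "a \<in> set w'")
      case False
      have "w' \<in> W" using sub Cons by auto
      then show ?thesis
        using conc[OF singleton_any[OF assms(1), of a], of w'] False Cons by auto
    next
      case True
      then obtain x y where w': "w' = x @ a # y" and ax: "a \<notin> set x"
        using split_list_first by fastforce
      have "subseq x w" unfolding Cons w' by (intro list_emb_Cons list_emb_prefix) simp
      then have x: "x \<in> W" using sub Cons w' by auto
      have disj: "set x \<inter> set (a # y) = {}"
        using noncrossing_split[of a x y] less.prems(1) Cons w' ax by simp
      have "[a, a] @ y \<in> W"
      proof (cases "a \<in> set y")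
        case True
        then obtain y1 y2 where "y = y1 @ a # y2" by (auto dest: split_list)
        then have "\<not> count_list w a \<le> 2" using Cons w' by simp
        then have "[0, 0, 0, 0] \<in> W" using less.prems(2) by blast
        moreover have "subseq (a # y) (x @ a # y)" by (rule list_emb_append2) simp
        then have "subseq (a # y) w" unfolding Cons w' by (rule list_emb_Cons)
        then have "[a] @ y \<in> W" using sub[of "[a] @ y"] Cons w' by simp
        ultimately have "[] @ [a] @ [a, a] @ y \<in> W" using triple[of "[]" a y] by simp
        from delete[OF assms(1) this] show ?thesis by simp
      next
        case False
        have "subseq y (a # y)" by auto
        then have "subseq y (x @ a # y)" by (rule list_emb_append2)
        then have "subseq y w" unfolding Cons w' by (rule list_emb_Cons)
        then have "y \<in> W" using sub Cons w' by auto
        then show ?thesis using insert_pair[of "[]" y a] False by simp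
      qed
      then show ?thesis
        using insert_word[of "[a]" "[a] @ y" x] x disj Cons w' by auto
    qed
  qed (simp add: nil)
qed

text \<open>A rotation of \<open>g\<close> is the word \<open>rev [0, 1] @ [1, 2]\<close>, a rule
  that exchanges a singleton with the point behind it. The singleton reappears as a new block
  \<open>s'\<close> and is renamed afterwards.\<close>

lemma move_singleton:
  assumes "[0, 1, 2, 1] \<in> W" "u @ [s] @ x @ v \<in> W" "s \<notin> set (u @ x @ v)"
  shows "u @ x @ [s] @ v \<in> W"
  using assms(2,3)
proof (induction x arbitrary: u)
  case (Cons b x)
  let ?v = "x @ v"
  have "[1, 0, 1, 2] \<in> W"
    by (rule pattern[of "[1, 2, 1] @ [0]" "\<lambda>x. 2 - x", OF rotate1])
      (use assms(1) in \<open>auto simp: inj_on_def\<close>)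
  obtain s' where s': "s' \<notin> set (u @ [s, b] @ ?v)" using ex_fresh_word by blast
  have "u @ map (\<lambda>y :: nat. if y \<in> set [0, 1] then (if y = 0 then s else b) else s') [1, 2] @ ?v \<in> W"
  proof (rule replace_fresh)
    show "u @ map (\<lambda>y :: nat. if y = 0 then s else b) [0, 1] @ ?v \<in> W" using Cons.prems by simp
  qed (use s' \<open>[1, 0, 1, 2] \<in> W\<close> in auto)
  then have "u @ [b, s'] @ ?v \<in> W" by simp
  moreover have "inj_on (id(s' := s)) (set (u @ [b, s'] @ ?v))"
    using s' Cons.prems(2) by (auto simp: inj_on_def)
  ultimately have "map (id(s' := s)) (u @ [b, s'] @ ?v) \<in> W" by (rule rename)
  moreover have "map (id(s' := s)) u = u" "map (id(s' := s)) ?v = ?v" "b \<noteq> s'"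
    using s' by (auto intro!: map_upd_idle)
  ultimately have "(u @ [b]) @ [s] @ x @ v \<in> W" by simp
  from Cons.IH[OF this] Cons.prems(2) show ?case by simp
qed simp

lemma rename_head:
  assumes "s # w \<in> W" "s \<notin> set w" "t \<notin> set w"
  shows "t # w \<in> W"
proof -
  have "inj_on (id(s := t)) (set (s # w))" using assms(2,3) by (auto simp: inj_on_def)
  from rename[OF assms(1) this] show ?thesis using map_upd_idle[OF assms(2)] by simp
qed

end

text \<open>
  If \<open>g \<in> W\<close>, then \<open>W\<close> is the even part of a word category containing the singleton, which
  reduces the case of \<open>g\<close> to that of the singleton.
\<close>

definition singleton_extension :: "nat list set \<Rightarrow> nat list set" where
  "singleton_extension W = {w. w \<in> W \<or> (\<exists>s. s \<notin> set w \<and> s # w \<in> W)}"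

lemma (in word_category) singleton_extensionE:
  assumes "w \<in> singleton_extension W"
  obtains "w \<in> W" | s where "s \<notin> set w" "s \<notin> set v" "s # w \<in> W"
proof (cases "w \<in> W")
  case False
  then obtain s where s: "s \<notin> set w" "s # w \<in> W"
    using assms by (auto simp: singleton_extension_def)
  obtain t where "t \<notin> set (w @ v)" using ex_fresh_word by blast
  then show ?thesis using rename_head[OF s(2,1), of t] that(2)[of t] by simp
qed

text \<open>It is rotation that takes \<open>g\<close>: the extra singleton in front must be moved
  past the rotated letter. If both factors of a concatenation carry an extra singleton, a rotation
  brings the two together and a contraction removes them.\<close>

lemma (in word_category) word_category_singleton_extension:
  assumes "[0, 1, 2, 1] \<in> W"
  shows "word_category (singleton_extension W)"
proof
  show "[0, 0] \<in> singleton_extension W" using pair by (simp add: singleton_extension_def)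
next
  fix w :: "nat list" and f :: "nat \<Rightarrow> nat"
  assume w: "w \<in> singleton_extension W" and f: "inj_on f (set w)"
  from w show "map f w \<in> singleton_extension W"
  proof (cases rule: singleton_extensionE[where v = "[]"])
    case 1
    then show ?thesis using rename f by (simp add: singleton_extension_def)
  next
    case (2 s)
    obtain t where t: "t \<notin> set (map f w)" using ex_fresh_word by blast
    have "map (f(s := t)) (s # w) \<in> W"
      by (rule rename[OF 2(3)]) (use f t 2(1) in \<open>auto simp: inj_on_def\<close>)
    moreover have "map (f(s := t)) w = map f w" using 2(1) by auto
    ultimately have "t # map f w \<in> W" by simp
    then show ?thesis using t by (auto simp: singleton_extension_def)
  qed
next
  fix u v :: "nat list"
  assume u: "u \<in> singleton_extension W" and v: "v \<in> singleton_extension W"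
    and disj: "set u \<inter> set v = {}"
  from u show "u @ v \<in> singleton_extension W"
  proof (cases rule: singleton_extensionE[where v = v])
    case 1
    from v show ?thesis
    proof (cases rule: singleton_extensionE[where v = u])
      case 1
      then show ?thesis using \<open>u \<in> W\<close> conc disj by (simp add: singleton_extension_def)
    next
      case (2 s)
      have "u @ v @ [s] \<in> W" using conc[OF \<open>u \<in> W\<close> rotate1[OF 2(3)]] disj 2(2) by auto
      then have "s # u @ v \<in> W" using rotate[of "u @ v" "[s]"] by simp
      then show ?thesis using 2 by (auto simp: singleton_extension_def)
    qed
  next
    case (2 s)
    from v show ?thesis
    proof (cases rule: singleton_extensionE[where v = "s # u"])
      case 1
      then have "s # u @ v \<in> W" using conc[OF \<open>s # u \<in> W\<close>, of v] disj 2(2) by auto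
      then show ?thesis using 2 by (auto simp: singleton_extension_def)
    next
      case (2 t)
      have "(s # u) @ v @ [t] \<in> W"
        using conc[OF \<open>s # u \<in> W\<close> rotate1[OF 2(3)]] disj 2(2) \<open>s \<notin> set v\<close> by auto
      then have "[] @ [t, s] @ (u @ v) \<in> W" using rotate[of "s # u @ v" "[t]"] by simp
      then have "u @ v \<in> W"
        using contract_fresh[of "[]" t s "u @ v"] \<open>s \<notin> set u\<close> \<open>s \<notin> set v\<close> by simp
      then show ?thesis by (simp add: singleton_extension_def)
    qed
  qed
next
  fix a w
  assume w: "a # w \<in> singleton_extension W"
  from w show "w @ [a] \<in> singleton_extension W"
  proof (cases rule: singleton_extensionE[where v = "[]"])
    case 1
    then show ?thesis using rotate1 by (simp add: singleton_extension_def)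
  next
    case (2 s)
    have "[] @ [s] @ [a] @ w \<in> W" using 2 by simp
    then have "[] @ [a] @ [s] @ w \<in> W" by (rule move_singleton[OF assms]) (use 2 in simp)
    then have "s # w @ [a] \<in> W" using rotate1[of a "s # w"] by simp
    then show ?thesis using 2 by (auto simp: singleton_extension_def)
  qed
next
  fix w
  assume w: "w \<in> singleton_extension W"
  from w show "rev w \<in> singleton_extension W"
  proof (cases rule: singleton_extensionE[where v = "[]"])
    case 1
    then show ?thesis using reverse by (simp add: singleton_extension_def)
  next
    case (2 s)
    then have "s # rev w \<in> W" using rotate[of "rev w" "[s]"] reverse[OF 2(3)] by simp
    then show ?thesis using 2 by (auto simp: singleton_extension_def)
  qed
next
  fix a b w
  assume w: "a # b # w \<in> singleton_extension W"
  from w show "map (id(b := a)) w \<in> singleton_extension W"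
  proof (cases rule: singleton_extensionE[where v = "[]"])
    case 1
    then show ?thesis using contract2 by (simp add: singleton_extension_def)
  next
    case (2 s)
    then have "s # map (id(b := a)) w \<in> W" using contract[of "[s]" a b w] by simp
    then show ?thesis using 2(1) by (auto simp: singleton_extension_def)
  qed
qed

lemma (in word_category) singleton_extension_even:
  assumes "w \<in> singleton_extension W" "even (length w)"
  shows "w \<in> W"
  using assms(1)
proof (cases rule: singleton_extensionE[where v = "[]"])
  case (2 s)
  have "[0] \<in> W" by (rule singleton_if_odd[OF 2(3)]) (simp add: assms)
  then show ?thesis using delete[of "[]" s w] 2 by simp
qed

section \<open>Comparison of two categories that contain \<open>g\<close>\<close>

lemma subset_if_singleton:
  assumes "word_category W" "word_category D" "[0] \<in> W" "[0] \<in> D"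
    and "[0, 0, 0, 0] \<in> W \<Longrightarrow> [0, 0, 0, 0] \<in> D"
    and "[0, 1, 0, 1] \<in> W \<Longrightarrow> [0, 1, 0, 1] \<in> D"
  shows "W \<subseteq> D"
proof
  interpret W: word_category W by fact
  interpret D: word_category D by fact
  fix w assume w: "w \<in> W"
  have count: "count_list w a \<le> 2" if "[0, 0, 0, 0] \<notin> D" for a
  proof -
    have "\<not> 3 \<le> count_list w a" using W.four_block_if_three[OF w] assms(5) that by blast
    then show ?thesis by simp
  qed
  show "w \<in> D"
  proof (cases "crossing_word w")
    case False
    then show ?thesis using D.noncrossing_words assms(4) count by blast
  next
    case True
    then have c: "[0, 1, 0, 1] \<in> D" using W.crossing_if_singleton assms(3,6) w by blast
    show ?thesis
    proof (cases "[0, 0, 0, 0] \<in> D")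
      case False
      have "count_list w a = 2 \<or> count_list w a = 1" if "a \<in> set w" for a
      proof -
        have "count_list w a \<noteq> 0" using that by (simp add: count_list_0_iff)
        then show ?thesis using count[OF False, of a] by linarith
      qed
      then show ?thesis using D.small_block_words[OF c, of w] assms(4) by blast
    qed (use D.all_words assms(4) c in blast)
  qed
qed

text \<open>The comparison is made between the singleton extensions, and nothing is lost: a word of
  even length in an extension already belongs to the original category. The four block and the
  crossing have even length, and so have all words of \<open>W\<close> if
  \<open>[0] \<notin> W\<close>.\<close>

lemma subset_if_g:
  assumes "word_category W" "word_category D" "[0, 1, 2, 1] \<in> W" "[0, 1, 2, 1] \<in> D"
    and "[0] \<in> W \<Longrightarrow> [0] \<in> D"
    and "[0, 0, 0, 0] \<in> W \<Longrightarrow> [0, 0, 0, 0] \<in> D"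
    and "[0, 1, 0, 1] \<in> W \<Longrightarrow> [0, 1, 0, 1] \<in> D"
  shows "W \<subseteq> D"
proof (cases "[0] \<in> W")
  case True
  then show ?thesis using subset_if_singleton assms by blast
next
  case False
  interpret W: word_category W by fact
  interpret D: word_category D by fact
  have single: "[0] \<in> singleton_extension V" if "word_category V" "[0, 1, 2, 1] \<in> V" for V
  proof -
    interpret V: word_category V by fact
    have "[1, 2, 1, 0] \<in> V" using V.rotate1[of 0 "[1, 2, 1]"] that(2) by simp
    then have "[1, 0] \<in> V"
      using V.contract[of "[1]" 2 1 "[0]"] V.rename[of "[2, 0]" "\<lambda>x. x - 1"] by simp
    then show ?thesis by (auto simp: singleton_extension_def)
  qed
  have "singleton_extension W \<subseteq> singleton_extension D"
  proof (rule subset_if_singleton)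
    show "[0, 0, 0, 0] \<in> singleton_extension D" if "[0, 0, 0, 0] \<in> singleton_extension W"
      using W.singleton_extension_even[OF that] assms(6) by (simp add: singleton_extension_def)
    show "[0, 1, 0, 1] \<in> singleton_extension D" if "[0, 1, 0, 1] \<in> singleton_extension W"
      using W.singleton_extension_even[OF that] assms(7) by (simp add: singleton_extension_def)
  qed (use single assms W.word_category_singleton_extension D.word_category_singleton_extension
      in blast)+
  moreover have "even (length w)" if "w \<in> W" for w
    using W.singleton_if_odd[OF that] False by blast
  moreover have "W \<subseteq> singleton_extension W" by (auto simp: singleton_extension_def)
  ultimately show ?thesis using D.singleton_extension_even by blast
qed

section \<open>Pair partitions with even gaps\<close>

text \<open>\<open>S\<close> stands for the availability of the double singleton, and hence of
  blocks of size one. The vanishing of \<open>alt\<close> is the even gap of a pair.\<close>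

definition even_blocks :: "bool \<Rightarrow> 'a list \<Rightarrow> bool" where
  "even_blocks S w \<longleftrightarrow> even (length w) \<and>
     (\<forall>a \<in> set w. (count_list w a = 2 \<and> alt a w = 0) \<or> (count_list w a = 1 \<and> S))"

lemma count_two_split:
  assumes "count_list w a = 2"
  obtains u x v where "w = u @ [a] @ x @ [a] @ v" "a \<notin> set u" "a \<notin> set x" "a \<notin> set v"
proof -
  have "a \<in> set w" using assms by (cases "a \<in> set w") (auto simp: count_list_0_iff)
  then obtain u y where w: "w = u @ a # y" "a \<notin> set u" using split_list_first by fastforce
  then have y: "count_list y a = 1" using assms by (simp add: count_list_0_iff)
  then have "a \<in> set y" by (cases "a \<in> set y") (auto simp: count_list_0_iff)
  then obtain x v where x: "y = x @ a # v" "a \<notin> set x" using split_list_first by fastforce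
  have "a \<notin> set v" using y x by (simp add: count_list_0_iff)
  then show ?thesis using that w x by simp
qed

lemma alt_pair:
  assumes "a \<notin> set u" "a \<notin> set x" "a \<notin> set v"
  shows "alt a (u @ [a] @ x @ [a] @ v) = 0 \<longleftrightarrow> even (length x)"
  using assms by (auto simp: alt_append alt_notin)

lemma even_blocks_subword:
  assumes "even_blocks S (u @ x @ v)" "set x \<inter> (set u \<union> set v) = {}" "even (length x)"
  shows "even_blocks S x"
  unfolding even_blocks_def
proof (intro conjI ballI assms(3))
  fix a assume a: "a \<in> set x"
  then have "a \<notin> set u" "a \<notin> set v" using assms(2) by auto
  then have "count_list (u @ x @ v) a = count_list x a"
    "alt a (u @ x @ v) = 0 \<longleftrightarrow> alt a x = 0"
    by (auto simp: alt_append alt_notin count_list_0_iff)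
  moreover have "a \<in> set (u @ x @ v)" using a by simp
  ultimately show "(count_list x a = 2 \<and> alt a x = 0) \<or> (count_list x a = 1 \<and> S)"
    using assms(1) unfolding even_blocks_def by metis
qed

lemma even_blocks_remove:
  assumes "even_blocks S (u @ x @ v)" "set x \<inter> (set u \<union> set v) = {}" "even (length x)"
  shows "even_blocks S (u @ v)"
  unfolding even_blocks_def
proof (intro conjI ballI)
  show "even (length (u @ v))" using assms(1,3) by (auto simp: even_blocks_def)
  fix a assume a: "a \<in> set (u @ v)"
  then have "a \<notin> set x" using assms(2) by auto
  then have "count_list (u @ x @ v) a = count_list (u @ v) a"
    "alt a (u @ x @ v) = alt a (u @ v)"
    using assms(3) by (auto simp: alt_append alt_notin count_list_0_iff)
  moreover have "a \<in> set (u @ x @ v)" using a by auto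
  ultimately show "(count_list (u @ v) a = 2 \<and> alt a (u @ v) = 0) \<or> (count_list (u @ v) a = 1 \<and> S)"
    using assms(1) unfolding even_blocks_def by metis
qed

lemma map_avoids: "\<lbrakk>\<forall>b. b \<notin> A \<longrightarrow> f b \<notin> A; set y \<inter> A = {}\<rbrakk> \<Longrightarrow> set (map f y) \<inter> A = {}"
  by auto

context word_category
begin

lemma g_if_singleton:
  assumes "[0] \<in> W"
  shows "[0, 1, 2, 1] \<in> W"
proof -
  have "[1] @ [2] @ [1] \<in> W"
    using insert_word[of "[1]" "[1]" "[2]"] pair_any singleton_any[OF assms] by simp
  then show ?thesis using conc[OF assms, of "[1, 2, 1]"] by simp
qed

lemma g_if_crossing:
  assumes "[0, 1, 0, 1] \<in> W" "[0, 1] \<in> W"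
  shows "[0, 1, 2, 1] \<in> W"
proof -
  have "[0, 2] @ [1, 1] \<in> W" using conc[OF singletons[OF assms(2), of 0 2] pair_any[of 1]] by simp
  then show ?thesis using swap[OF assms(1), of "[0]" 2 1 "[1]"] by simp
qed

text \<open>With \<open>t s\<close> inserted behind \<open>a\<close>, contracting \<open>a\<close>
  with the isolated \<open>t\<close> deletes both points and leaves the singleton \<open>s\<close>
  in the place of \<open>a\<close>.\<close>

lemma disconnect:
  assumes "[0, 1] \<in> W" "u @ [a] @ v \<in> W" "s \<notin> set (u @ [a] @ v)"
  shows "u @ [s] @ v \<in> W"
proof -
  obtain t where t: "t \<notin> set (u @ [a, s] @ v)" using ex_fresh_word by blast
  have "(u @ [a]) @ [t, s] @ v \<in> W"
    using insert_word[of "u @ [a]" v "[t, s]"] singletons[OF assms(1), of t s] assms(2,3) t by auto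
  then show ?thesis using contract_fresh[of u a t "s # v"] t by simp
qed

lemma g_if_four_block:
  assumes "[0, 0, 0, 0] \<in> W" "[0, 1] \<in> W"
  shows "[0, 1, 2, 1] \<in> W"
proof -
  have "[1, 1, 1, 1] \<in> W" using pattern[OF assms(1), of "\<lambda>_. 1"] by simp
  then have "[] @ [0] @ [1, 1, 1] \<in> W" using disconnect[OF assms(2), of "[]" 1 "[1, 1, 1]" 0] by simp
  then have "[0, 1] @ [2] @ [1] \<in> W" using disconnect[OF assms(2), of "[0, 1]" 1 "[1]" 2] by simp
  then show ?thesis by simp
qed

text \<open>Contracting inside \<open>x\<close> may merge blocks all over the word, also in
  \<open>u\<close> and \<open>v\<close>. The map \<open>f\<close> records these mergers; since
  \<open>x\<close> avoids \<open>A\<close>, they neither change a letter of \<open>A\<close> nor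
  turn another letter into one of \<open>A\<close>.\<close>

lemma shrink:
  assumes "u @ x @ v \<in> W" "set x \<inter> A = {}"
  obtains f x' where "map f u @ x' @ map f v \<in> W" "length x' = length x mod 2" "set x' \<inter> A = {}"
    "\<forall>a \<in> A. f a = a" "\<forall>b. b \<notin> A \<longrightarrow> f b \<notin> A"
proof -
  have "\<exists>f x'. map f u @ x' @ map f v \<in> W \<and> length x' = length x mod 2 \<and> set x' \<inter> A = {} \<and>
    (\<forall>a \<in> A. f a = a) \<and> (\<forall>b. b \<notin> A \<longrightarrow> f b \<notin> A)"
    using assms
  proof (induction "length x" arbitrary: u x v rule: less_induct)
    case less
    show ?case
    proof (cases "length x < 2")
      case True
      then show ?thesis using less.prems by (intro exI[of _ "\<lambda>x. x"] exI[of _ x]) auto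
    next
      case False
      then obtain b c y where x: "x = b # c # y"
        by (metis One_nat_def Suc_1 length_Cons lessI list.size(3) neq_Nil_conv zero_less_Suc not_less_eq)
      let ?g = "id(c := b)"
      have bc: "b \<notin> A" "c \<notin> A" "set y \<inter> A = {}" using less.prems(2) x by auto
      have "map ?g u @ map ?g y @ map ?g v \<in> W" using contract[of u b c "y @ v"] less.prems(1) x by simp
      moreover have "set (map ?g y) \<inter> A = {}" using bc by auto
      ultimately obtain f x' where f: "map f (map ?g u) @ x' @ map f (map ?g v) \<in> W"
        "length x' = length (map ?g y) mod 2" "set x' \<inter> A = {}"
        "\<forall>a \<in> A. f a = a" "\<forall>b. b \<notin> A \<longrightarrow> f b \<notin> A"
        using less.hyps[of "map ?g y" "map ?g u" "map ?g v"] x by auto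
      show ?thesis
        by (intro exI[of _ "f \<circ> ?g"] exI[of _ x']) (use f bc x in auto)
    qed
  qed
  then show ?thesis using that by blast
qed

lemma shrink_even:
  assumes "u @ x @ v \<in> W" "set x \<inter> A = {}" "even (length x)"
  obtains f where "map f u @ map f v \<in> W" "\<forall>a \<in> A. f a = a" "\<forall>b. b \<notin> A \<longrightarrow> f b \<notin> A"
  using shrink[OF assms(1,2)] assms(3) by (metis append_Nil even_iff_mod_2_eq_zero length_0_conv)

lemma shrink_odd:
  assumes "u @ x @ v \<in> W" "set x \<inter> A = {}" "odd (length x)"
  obtains f z where "map f u @ [z] @ map f v \<in> W" "z \<notin> A"
    "\<forall>a \<in> A. f a = a" "\<forall>b. b \<notin> A \<longrightarrow> f b \<notin> A"
proof -
  obtain f x' where f: "map f u @ x' @ map f v \<in> W" "length x' = length x mod 2" "set x' \<inter> A = {}"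
    "\<forall>a \<in> A. f a = a" "\<forall>b. b \<notin> A \<longrightarrow> f b \<notin> A"
    using shrink[OF assms(1,2)] by blast
  have "length x' = 1" using f(2) assms(3) by (simp add: odd_iff_mod_2_eq_one)
  then obtain z where "x' = [z]" by (auto simp: length_Suc_conv)
  then show ?thesis using that f by auto
qed

text \<open>In a word of even length both gaps of the pair \<open>a\<close> are odd and shrink to
  one point each. These two points are either connected, which gives the crossing, or not, which
  gives a rotation of \<open>g\<close>.\<close>

lemma odd_gap:
  assumes "[a] @ x @ [a] @ y \<in> W" "a \<notin> set x" "a \<notin> set y" "odd (length x)"
  shows "[0, 1, 0, 1] \<in> W \<or> [0, 1, 2, 1] \<in> W"
proof (cases "[0] \<in> W")
  case False
  have "even (length ([a] @ x @ [a] @ y))" using singleton_if_odd[OF assms(1)] False by blast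
  then have y: "odd (length y)" using assms(4) by simp
  obtain f z where f: "map f [a] @ [z] @ map f ([a] @ y) \<in> W" "z \<notin> {a}"
    "\<forall>b \<in> {a}. f b = b" "\<forall>b. b \<notin> {a} \<longrightarrow> f b \<notin> {a}"
    using shrink_odd[OF assms(1), of "{a}"] assms by auto
  have 1: "[a, z, a] @ map f y @ [] \<in> W" using f by simp
  have 2: "set (map f y) \<inter> {a} = {}" using map_avoids[OF f(4)] assms(3) by simp
  obtain g t where g: "map g [a, z, a] @ [t] @ map g [] \<in> W" "t \<notin> {a}"
    "\<forall>b \<in> {a}. g b = b" "\<forall>b. b \<notin> {a} \<longrightarrow> g b \<notin> {a}"
    using shrink_odd[OF 1 2] y by auto
  let ?p = "g z"
  have w: "[a, ?p, a, t] \<in> W" "?p \<noteq> a" "t \<noteq> a" using g f(2) by auto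
  show ?thesis
  proof (cases "?p = t")
    case True
    have "[0, 1, 0, 1] \<in> W"
      by (rule pattern[OF w(1), of "\<lambda>x. if x = a then 0 else 1"]) (use w True in auto)
    then show ?thesis ..
  next
    case False
    have "[?p, a, t] @ [a] \<in> W" using rotate1[OF w(1)] by simp
    then have "[0, 1, 2, 1] \<in> W"
      by (rule pattern[where f = "\<lambda>x. if x = a then 1 else if x = ?p then 0 else 2"])
        (use w False in \<open>auto simp: inj_on_def\<close>)
    then show ?thesis ..
  qed
qed (use g_if_singleton in blast)

text \<open>Suitably rotated, the given word reverses three adjacent points one of which is a
  singleton: \<open>r1\<close>, \<open>r2\<close>, \<open>r3\<close> serve a singleton at the right,
  in the middle and at the left. With \<open>3 4\<close> inserted into the lower half
  \<open>0 1 2\<close> of a nested word, the three reversals lead from \<open>0 1 3 4 2\<close> over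
  \<open>5 1 0 4 2\<close> and \<open>5 1 2 6 0\<close> to \<open>2 1 7 6 0\<close>; contracting the
  two singletons leaves \<open>0 1 2\<close> reversed.\<close>

lemma half_liberating_if_disconnected:
  assumes "[0, 1, 2, 0, 1, 3] \<in> W"
  shows "[0, 1, 2, 0, 1, 2] \<in> W"
proof -
  have S: "[0, 1] \<in> W"
    using double_singleton_if_singleton[of "[0, 1, 2, 0, 1]" 3 "[]"] assms by simp
  have r1: "rev [1, 0, 2] @ [3, 0, 1] \<in> W" using rotate[of "[0, 1]" "[2, 0, 1, 3]"] assms by simp
  have r2: "rev [0, 2, 1] @ [1, 3, 0] \<in> W" using rotate[of "[0]" "[1, 2, 0, 1, 3]"] assms by simp
  have r3: "rev [2, 1, 0] @ [0, 1, 3] \<in> W" using assms by simp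
  have "[1] @ [0, 0] @ [1] \<in> W" using insert_word[of "[1]" "[1]" "[0, 0]"] pair_any by simp
  then have "[2] @ [1, 0, 0, 1] @ [2] \<in> W"
    using insert_word[of "[2]" "[2]" "[1, 0, 0, 1]"] pair_any by simp
  then have "[2, 1, 0, 0, 1] @ [3, 4] @ [2] \<in> W"
    using insert_word[of "[2, 1, 0, 0, 1]" "[2]" "[3, 4]"] singletons[OF S, of 3 4] by simp
  then have "[2, 1, 0] @ map (\<lambda>x :: nat. if x = 1 then 0 else if x = 0 then 1 else 3) [1, 0, 2] @ [4, 2] \<in> W"
    by simp
  from replace_fresh[OF this r1, of "\<lambda>_. 5"]
  have "[2, 1, 0, 5, 1] @ map (\<lambda>x :: nat. if x = 0 then 0 else if x = 2 then 4 else 2) [0, 2, 1] @ [] \<in> W"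
    by (simp add: insert_Diff_if)
  from replace_fresh[OF this r2, of "\<lambda>_. 6"]
  have "[2, 1, 0] @ map (\<lambda>x :: nat. if x = 2 then 5 else if x = 1 then 1 else 2) [2, 1, 0] @ [6, 0] \<in> W"
    by (simp add: insert_Diff_if)
  from replace_fresh[OF this r3, of "\<lambda>_. 7"]
  have "[2, 1, 0, 2, 1] @ [7, 6] @ [0] \<in> W" by (simp add: insert_Diff_if)
  from contract_fresh[OF this] have "[2, 1, 0, 2, 1, 0] \<in> W" by simp
  then show ?thesis by (rule pattern[where f = "\<lambda>x. 2 - x"]) (auto simp: inj_on_def)
qed

text \<open>Since only \<open>y\<close> and \<open>v\<close> are odd, shrinking the four gaps leaves
  \<open>a b p a b q\<close>. If \<open>p\<close> and \<open>q\<close> are connected, this is the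
  word of \<open>h\<close>, otherwise that of \<open>h\<close> with one string cut.\<close>

lemma half_liberating_if_crossing:
  assumes "[a] @ x @ [b] @ y @ [a] @ z @ [b] @ v \<in> W" "a \<noteq> b"
    and "set x \<inter> {a, b} = {}" "set y \<inter> {a, b} = {}" "set z \<inter> {a, b} = {}" "set v \<inter> {a, b} = {}"
    and "even (length x)" "odd (length y)" "even (length z)" "odd (length v)"
  shows "[0, 1, 2, 0, 1, 2] \<in> W"
proof -
  obtain f where f: "map f [a] @ map f ([b] @ y @ [a] @ z @ [b] @ v) \<in> W"
    "\<forall>c \<in> {a, b}. f c = c" "\<forall>c. c \<notin> {a, b} \<longrightarrow> f c \<notin> {a, b}"
    using shrink_even[OF assms(1,3,7)] .
  let ?y = "map f y" and ?z = "map f z" and ?v = "map f v"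
  have 1: "[a, b] @ ?y @ ([a] @ ?z @ [b] @ ?v) \<in> W" using f by simp
  have 2: "set ?y \<inter> {a, b} = {}" "set ?z \<inter> {a, b} = {}" "set ?v \<inter> {a, b} = {}"
    using map_avoids[OF f(3)] assms(4-6) by (simp_all only:)
  obtain g p where g: "map g [a, b] @ [p] @ map g ([a] @ ?z @ [b] @ ?v) \<in> W" "p \<notin> {a, b}"
    "\<forall>c \<in> {a, b}. g c = c" "\<forall>c. c \<notin> {a, b} \<longrightarrow> g c \<notin> {a, b}"
    using shrink_odd[OF 1 2(1)] assms(8) by auto
  let ?z' = "map g ?z" and ?v' = "map g ?v"
  have 3: "[a, b, p, a] @ ?z' @ ([b] @ ?v') \<in> W" using g by simp
  have 4: "set ?z' \<inter> {a, b} = {}" "set ?v' \<inter> {a, b} = {}" using map_avoids[OF g(4)] 2 by (simp_all only:)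
  obtain h where h: "map h [a, b, p, a] @ map h ([b] @ ?v') \<in> W"
    "\<forall>c \<in> {a, b}. h c = c" "\<forall>c. c \<notin> {a, b} \<longrightarrow> h c \<notin> {a, b}"
    using shrink_even[OF 3 4(1)] assms(9) by auto
  have 5: "[a, b, h p, a, b] @ map h ?v' @ [] \<in> W" using h by simp
  have 6: "set (map h ?v') \<inter> {a, b} = {}" using map_avoids[OF h(3)] 4 by (simp_all only:)
  obtain k q where k: "map k [a, b, h p, a, b] @ [q] @ map k [] \<in> W" "q \<notin> {a, b}"
    "\<forall>c \<in> {a, b}. k c = c" "\<forall>c. c \<notin> {a, b} \<longrightarrow> k c \<notin> {a, b}"
    using shrink_odd[OF 5 6] assms(10) by auto
  let ?p = "k (h p)"
  have w: "[a, b, ?p, a, b, q] \<in> W" using k by simp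
  have p: "?p \<notin> {a, b}" using k(4) h(3) g(2) by blast
  show ?thesis
  proof (cases "?p = q")
    case True
    show ?thesis
      by (rule pattern[OF w, of "\<lambda>x. if x = a then 0 else if x = b then 1 else 2"])
        (use p True assms(2) in \<open>auto simp: inj_on_def\<close>)
  next
    case False
    have "[0, 1, 2, 0, 1, 3] \<in> W"
      by (rule pattern[OF w, of "\<lambda>x. if x = a then 0 else if x = b then 1 else if x = q then 3 else 2"])
        (use p k(2) False assms(2) in \<open>auto simp: inj_on_def\<close>)
    then show ?thesis by (rule half_liberating_if_disconnected)
  qed
qed

lemma even_blocks_words:
  assumes "[0, 0, 0, 0] \<notin> W" "[0, 1, 0, 1] \<notin> W" "[0, 1, 2, 1] \<notin> W" "w \<in> W"
  shows "even_blocks ([0, 1] \<in> W) w"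
  unfolding even_blocks_def
proof (intro conjI ballI)
  show "even (length w)" using singleton_if_odd[OF assms(4)] g_if_singleton assms(3) by blast
  fix a assume a: "a \<in> set w"
  have "\<not> 3 \<le> count_list w a" using four_block_if_three[OF assms(4)] assms(1) by blast
  moreover have "count_list w a \<noteq> 0" using a by (simp add: count_list_0_iff)
  ultimately consider "count_list w a = 1" | "count_list w a = 2" by linarith
  then show "(count_list w a = 2 \<and> alt a w = 0) \<or> (count_list w a = 1 \<and> [0, 1] \<in> W)"
  proof cases
    case 1
    obtain u v where w: "w = u @ a # v" using split_list[OF a] by blast
    then have "a \<notin> set u" "a \<notin> set v" using 1 by (auto simp: count_list_0_iff)
    then show ?thesis using double_singleton_if_singleton[of u a v] assms(4) w 1 by simp
  next
    case 2
    then obtain u x v where w: "w = u @ [a] @ x @ [a] @ v" and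
      a: "a \<notin> set u" "a \<notin> set x" "a \<notin> set v" by (rule count_two_split)
    have "[a] @ x @ [a] @ (v @ u) \<in> W" using rotate[of u "[a] @ x @ [a] @ v"] assms(4) w by simp
    from odd_gap[OF this] have "even (length x)" using a assms(2,3) by auto
    then show ?thesis using alt_pair[OF a] 2 w by simp
  qed
qed

text \<open>The even gaps of \<open>a\<close> and \<open>b\<close> force \<open>x\<close> and
  \<open>z\<close> to have the same parity and \<open>y\<close> the opposite one; the even total
  length makes the outer stretch agree with \<open>y\<close>. Starting the word at \<open>a\<close>
  or at \<open>b\<close> therefore yields the parities needed for \<open>h\<close>.\<close>

lemma half_liberating_if_crossing_word:
  assumes "[0, 0, 0, 0] \<notin> W" "[0, 1, 0, 1] \<notin> W" "[0, 1, 2, 1] \<notin> W" "w \<in> W" "crossing_word w"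
  shows "[0, 1, 2, 0, 1, 2] \<in> W"
proof -
  obtain a b t x y z v where ab: "a \<noteq> b" and w: "w = t @ [a] @ x @ [b] @ y @ [a] @ z @ [b] @ v"
    using crossing_word_split[OF assms(5)] .
  have even: "even_blocks ([0, 1] \<in> W) w" by (rule even_blocks_words[OF assms(1-4)])
  have "count_list w a = 2" "alt a w = 0" "count_list w b = 2" "alt b w = 0"
    using even w ab unfolding even_blocks_def by auto
  then have avoid: "set x \<inter> {a, b} = {}" "set y \<inter> {a, b} = {}" "set z \<inter> {a, b} = {}"
    "set (v @ t) \<inter> {a, b} = {}"
    using w ab by (auto simp: count_list_0_iff)
  have gaps: "even (length (x @ [b] @ y))" "even (length (y @ [a] @ z))"
    using alt_pair[of a t "x @ [b] @ y" "z @ [b] @ v"]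
      alt_pair[of b "t @ [a] @ x" "y @ [a] @ z" v] avoid ab w \<open>alt a w = 0\<close> \<open>alt b w = 0\<close>
    by simp_all
  have total: "even (length w)" using even by (simp add: even_blocks_def)
  have rot: "[a] @ x @ [b] @ y @ [a] @ z @ [b] @ (v @ t) \<in> W"
    using rotate[of t "[a] @ x @ [b] @ y @ [a] @ z @ [b] @ v"] assms(4) w by simp
  show ?thesis
  proof (cases "even (length x)")
    case True
    show ?thesis
      by (rule half_liberating_if_crossing[OF rot ab avoid]) (use True gaps total w in auto)
  next
    case False
    have "[b] @ y @ [a] @ z @ [b] @ (v @ t) @ [a] @ x \<in> W"
      using rotate[of "[a] @ x" "[b] @ y @ [a] @ z @ [b] @ (v @ t)"] rot by simp
    then show ?thesis
      by (rule half_liberating_if_crossing) (use ab avoid False gaps total w in auto)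
  qed
qed

text \<open>The rule of \<open>h\<close> reverses three adjacent points. It moves the left point of
  a pair across two points at a time, until an even gap has vanished and the pair can be removed. If
  only singletons are left, they are removed two at a time.\<close>

lemma half_liberated_words:
  assumes "[0, 1, 2, 0, 1, 2] \<in> W" "even_blocks ([0, 1] \<in> W) w"
  shows "w \<in> W"
  using assms(2)
proof (induction "length w" arbitrary: w rule: less_induct)
  case less
  show ?case
  proof (cases "\<exists>a. count_list w a = 2")
    case True
    then obtain a u x v where w: "w = u @ [a] @ x @ [a] @ v" "a \<notin> set u" "a \<notin> set x" "a \<notin> set v"
      by (metis count_two_split)
    have "even_blocks ([0, 1] \<in> W) (u @ [a] @ x @ [a] @ v) \<Longrightarrow>
        length (u @ [a] @ x @ [a] @ v) = length w \<Longrightarrow> a \<notin> set u \<Longrightarrow> a \<notin> set x \<Longrightarrow>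
        u @ [a] @ x @ [a] @ v \<in> W" for u x
    proof (induction "length x" arbitrary: u x rule: less_induct)
      case inner: less
      have "count_list (u @ [a] @ x @ [a] @ v) a = 2"
        using inner.prems(3,4) w(4) by (simp add: count_list_0_iff)
      then have "alt a (u @ [a] @ x @ [a] @ v) = 0"
        using inner.prems(1) unfolding even_blocks_def by auto
      then have x: "even (length x)" using alt_pair[OF inner.prems(3,4) w(4)] by simp
      show ?case
      proof (cases x)
        case Nil
        have "even_blocks ([0, 1] \<in> W) (u @ v)"
          by (rule even_blocks_remove[of _ u "[a, a]"]) (use inner.prems Nil w(4) in auto)
        then have "u @ v \<in> W" using less.hyps[of "u @ v"] inner.prems(2) by auto
        then show ?thesis using insert_pair[of u v a] inner.prems(3) w(4) Nil by simp
      next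
        case (Cons x1 y)
        then obtain x2 x' where y: "y = x2 # x'" using x by (cases y) auto
        let ?w = "u @ [a] @ x @ [a] @ v" and ?w' = "(u @ [x2, x1]) @ [a] @ x' @ [a] @ v"
        have "set ?w' = set ?w" using Cons y by auto
        moreover have "count_list ?w' b = count_list ?w b" "alt b ?w' = alt b ?w" for b
          using Cons y by (auto simp: alt_append)
        ultimately have "even_blocks ([0, 1] \<in> W) ?w'"
          using inner.prems(1) Cons y unfolding even_blocks_def by simp
        then have "?w' \<in> W"
          using inner.hyps[of x' "u @ [x2, x1]"] inner.prems(2-4) Cons y by simp
        then have 1: "u @ map (\<lambda>i. [x2, x1, a] ! i) [0, 1, 2] @ (x' @ [a] @ v) \<in> W" by simp
        have "rev [0, 1, 2] @ [2, 1, 0] \<in> W" using reverse[OF assms(1)] by simp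
        from replace[OF 1 this] show ?thesis using Cons y by simp
      qed
    qed
    from this[of u x] show ?thesis using w less.prems by simp
  next
    case False
    then have single: "count_list w b = 1 \<and> [0, 1] \<in> W" if "b \<in> set w" for b
      using less.prems that unfolding even_blocks_def by blast
    show ?thesis
    proof (cases w)
      case (Cons b y)
      then obtain c w' where y: "y = c # w'"
        using less.prems by (cases y) (auto simp: even_blocks_def)
      have bc: "b \<noteq> c" "b \<notin> set w'" "c \<notin> set w'"
        using single[of b] single[of c] Cons y by (auto simp: count_list_0_iff split: if_splits)
      have "even_blocks ([0, 1] \<in> W) ([] @ w')"
        by (rule even_blocks_remove[of _ "[]" "[b, c]"]) (use less.prems Cons y bc in auto)
      then have "w' \<in> W" using less.hyps[of w'] Cons y by simp
      moreover have "[0, 1] \<in> W" using single[of b] Cons by simp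
      ultimately show ?thesis using conc[OF singletons[of b c], of w'] bc Cons y by simp
    qed (simp add: nil)
  qed
qed

lemma noncrossing_even_words:
  assumes "\<not> crossing_word w" "even_blocks ([0, 1] \<in> W) w"
  shows "w \<in> W"
  using assms
proof (induction "length w" arbitrary: w rule: less_induct)
  case less
  note hyps = less.hyps
  have sub: "\<not> crossing_word v" if "subseq v w" for v
    using crossing_word_mono that less.prems by blast
  \<comment> \<open>The prefix \<open>s\<close> serves words that start with a singleton: it cannot
    be removed alone, as the length has to stay even, so a pair behind it is removed
    instead.\<close>
  have pair_case: "w \<in> W"
    if w: "w = s @ [a] @ x @ [a] @ y" and a: "a \<notin> set s" "a \<notin> set x" "a \<notin> set y"
      and s: "set s \<inter> set x = {}" for a s x y
  proof -
    have "subseq (a # x @ a # y) w" unfolding w by (rule list_emb_append2) simp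
    then have disj: "set x \<inter> set (a # y) = {}"
      using noncrossing_split[of a x y] sub a by simp
    have "count_list w a = 2" using w a by (simp add: count_list_0_iff)
    then have "alt a w = 0" using less.prems(2) unfolding even_blocks_def by auto
    then have x: "even (length x)" using alt_pair[OF a] w by simp
    have ex: "even_blocks ([0, 1] \<in> W) x"
      by (rule even_blocks_subword[of _ "s @ [a]" x "[a] @ y"])
        (use less.prems w disj a s x in auto)
    have "even_blocks ([0, 1] \<in> W) (s @ y)"
      by (rule even_blocks_remove[of _ s "[a] @ x @ [a]" y])
        (use less.prems w disj a s x in auto)
    moreover have "subseq x w" unfolding w by (intro list_emb_append2 list_emb_prefix) simp
    moreover have "subseq (s @ y) w" unfolding w
      by (intro list_emb_append_mono list_emb_append2) auto
    ultimately have "x \<in> W" "s @ y \<in> W" using hyps[of x] hyps[of "s @ y"] ex sub w by auto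
    then show ?thesis
      using insert_word[of "s @ [a]" "[a] @ y" x] insert_pair[of s y a] w a disj s by auto
  qed
  show ?case
  proof (cases w)
    case (Cons a w')
    show ?thesis
    proof (cases "count_list w a = 2")
      case True
      then obtain s x y where w: "w = s @ [a] @ x @ [a] @ y" "a \<notin> set s" "a \<notin> set x" "a \<notin> set y"
        by (rule count_two_split)
      then have "s = []" using Cons by (cases s) auto
      then show ?thesis using pair_case[of s a x y] w by simp
    next
      case False
      then have a: "count_list w a = 1" "[0, 1] \<in> W"
        using less.prems Cons unfolding even_blocks_def by auto
      then have aw: "a \<notin> set w'" using Cons by (simp add: count_list_0_iff)
      obtain b v where w': "w' = b # v"
        using less.prems Cons by (cases w') (auto simp: even_blocks_def)
      show ?thesis
      proof (cases "count_list w b = 2")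
        case True
        then have "count_list w' b = 2" using Cons aw w' by auto
        then obtain s x y where w: "w' = s @ [b] @ x @ [b] @ y" "b \<notin> set s" "b \<notin> set x" "b \<notin> set y"
          by (rule count_two_split)
        then have "s = []" using w' by (cases s) auto
        then show ?thesis using pair_case[of "[a]" b x y] w Cons aw by auto
      next
        case False
        then have "count_list w b = 1"
          using less.prems Cons w' unfolding even_blocks_def by auto
        then have b: "b \<notin> set v" "a \<noteq> b" "a \<notin> set v"
          using Cons w' aw by (auto simp: count_list_0_iff)
        have "even_blocks ([0, 1] \<in> W) ([] @ v)"
          by (rule even_blocks_remove[of _ "[]" "[a, b]"]) (use less.prems Cons w' b in auto)
        moreover have "subseq v w" unfolding Cons w' by auto
        ultimately have "v \<in> W" using hyps[of v] sub Cons w' by simp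
        then show ?thesis using conc[OF singletons[OF a(2) b(2)], of v] b Cons w' by simp
      qed
    qed
  qed (simp add: nil)
qed

end

section \<open>Comparison of categories with blocks of size at most two\<close>

lemma subset_if_even_blocks:
  assumes "word_category W" "word_category D"
    and "[0, 0, 0, 0] \<notin> W" "[0, 1, 0, 1] \<notin> W" "[0, 1, 2, 1] \<notin> W"
    and "[0, 1] \<in> W \<Longrightarrow> [0, 1] \<in> D" "[0, 1, 2, 0, 1, 2] \<in> W \<Longrightarrow> [0, 1, 2, 0, 1, 2] \<in> D"
  shows "W \<subseteq> D"
proof
  interpret W: word_category W by fact
  interpret D: word_category D by fact
  fix w assume w: "w \<in> W"
  have "even_blocks ([0, 1] \<in> W) w" using W.even_blocks_words assms(3-5) w by blast
  then have even: "even_blocks ([0, 1] \<in> D) w" using assms(6) unfolding even_blocks_def by blast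
  show "w \<in> D"
  proof (cases "crossing_word w")
    case True
    then show ?thesis
      using D.half_liberated_words[OF assms(7) even] W.half_liberating_if_crossing_word assms(3-5) w
      by blast
  qed (use D.noncrossing_even_words even in blast)
qed

lemma subset_if_crossing_pairs:
  assumes "word_category W" "word_category D" "[0, 0, 0, 0] \<notin> W" "[0, 1] \<notin> W"
    and "[0, 1, 0, 1] \<in> D"
  shows "W \<subseteq> D"
proof
  interpret W: word_category W by fact
  interpret D: word_category D by fact
  fix w assume w: "w \<in> W"
  have "count_list w a = 2" if a: "a \<in> set w" for a
  proof -
    have "\<not> 3 \<le> count_list w a" using W.four_block_if_three[OF w] assms(3) by blast
    moreover have "count_list w a \<noteq> 0" using a by (simp add: count_list_0_iff)
    moreover have "count_list w a \<noteq> 1"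
    proof
      assume 1: "count_list w a = 1"
      obtain u v where uv: "w = u @ a # v" using split_list[OF a] by blast
      then have "a \<notin> set u" "a \<notin> set v" using 1 by (auto simp: count_list_0_iff)
      then show False using W.double_singleton_if_singleton[of u a v] assms(4) w uv by simp
    qed
    ultimately show ?thesis by linarith
  qed
  then show "w \<in> D" using D.small_block_words[OF assms(5)] by blast
qed

section \<open>Walks on trees\<close>

text \<open>Left multiplication of a reduced word by the generator \<open>a\<close> of order two in
  a free product of copies of Z/2.\<close>

fun push :: "'a \<Rightarrow> 'a list \<Rightarrow> 'a list" where
  "push a [] = [a]"
| "push a (b # w) = (if a = b then w else a # b # w)"

definition reduce :: "'a list \<Rightarrow> 'a list" where
  "reduce w = foldr push w []"

lemma reduce_simps [simp]: "reduce [] = []" "reduce (a # w) = push a (reduce w)"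
  by (simp_all add: reduce_def)

lemma distinct_adj_push: "distinct_adj w \<Longrightarrow> distinct_adj (push a w)"
  by (cases w; cases "tl w") auto

lemma distinct_adj_reduce: "distinct_adj (reduce w)"
  by (induction w) (simp_all add: distinct_adj_push)

lemma push_push: "distinct_adj w \<Longrightarrow> push a (push a w) = w"
  by (cases w; cases "tl w") auto

lemma push_push_reduce [simp]: "push a (push a (reduce w)) = reduce w"
  by (simp add: push_push distinct_adj_reduce)

lemma push_distinct_adj: "distinct_adj (a # w) \<Longrightarrow> push a w = a # w"
  by (cases w) auto

lemma reduce_id: "distinct_adj w \<Longrightarrow> reduce w = w"
proof (induction w)
  case (Cons a w)
  then have "distinct_adj w" by (cases w) auto
  then show ?case using Cons by (simp add: push_distinct_adj)
qed simp

lemma reduce_append: "reduce (u @ v) = foldr push u (reduce v)"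
  by (simp add: reduce_def)

lemma reduce_reduce [simp]: "reduce (reduce w) = reduce w"
  by (simp add: reduce_id distinct_adj_reduce)

lemma reduce_append_right [simp]: "reduce (u @ reduce v) = reduce (u @ v)"
  by (simp add: reduce_append)

lemma reduce_push_append: "reduce (push a w @ v) = push a (reduce (w @ v))"
  by (cases w) auto

lemma reduce_append_left [simp]: "reduce (reduce u @ v) = reduce (u @ v)"
  by (induction u) (simp_all add: reduce_push_append)

lemma reduce_cancel: "reduce (u @ [a, a] @ v) = reduce (u @ v)"
  by (simp add: reduce_append)

lemma rev_push_reduce: "reduce (rev (push a w)) = reduce (rev w @ [a])"
proof (cases w)
  case (Cons b t)
  then show ?thesis using reduce_cancel[of "rev t" b "[]"] by simp
qed simp

lemma reduce_rev: "reduce (rev w) = rev (reduce w)"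
proof -
  have "reduce (rev (reduce w)) = reduce (rev w)"
  proof (induction w)
    case (Cons a w)
    have "reduce (rev (reduce w) @ [a]) = reduce (rev w @ [a])"
      using reduce_append_left[of "rev (reduce w)"] reduce_append_left[of "rev w"] Cons by metis
    then show ?case by (simp add: rev_push_reduce)
  qed simp
  moreover have "reduce (rev (reduce w)) = rev (reduce w)"
    by (simp add: reduce_id distinct_adj_reduce)
  ultimately show ?thesis by simp
qed

lemma reduce_append_rev: "reduce (v @ rev v) = []"
  by (induction v rule: rev_induct) (auto simp: reduce_cancel[of _ _ "rev _", simplified])

lemma reduce_append_eq_NilD:
  assumes "reduce (u @ v) = []"
  shows "reduce u = rev (reduce v)"
proof -
  have "reduce u = reduce (u @ reduce (v @ rev v))" by (simp add: reduce_append_rev)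
  also have "\<dots> = reduce (reduce (u @ v) @ rev v)" by simp
  finally show ?thesis using assms by (simp add: reduce_rev)
qed

lemma reduce_append_eq_NilD': "reduce (u @ v) = [] \<Longrightarrow> reduce v = rev (reduce u)"
  using reduce_append_eq_NilD by fastforce

lemma set_reduce_subset: "set (reduce w) \<subseteq> set w"
proof (induction w)
  case (Cons a w)
  have "set (push a v) \<subseteq> insert a (set v)" for v by (cases v) auto
  then show ?case using Cons by fastforce
qed simp

lemma length_reduce_le: "length (reduce w) \<le> length w"
proof (induction w)
  case (Cons a w)
  have "length (push a v) \<le> Suc (length v)" for v by (cases v) auto
  then show ?case using Cons le_trans by fastforce
qed simp

text \<open>Read from the right, \<open>s\<close> is a walk in a tree from the base point
  \<open>[]\<close> to \<open>p @ q\<close>, and it must pass through \<open>q\<close>, which lies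
  on the path between them. The prefix \<open>p\<close> varies in the induction because an earlier
  position may be farther out.\<close>

lemma reduce_suffix_tail:
  "reduce s = p @ q \<Longrightarrow> \<exists>s' t. s = t @ s' \<and> reduce s' = q"
proof (induction s arbitrary: p)
  case (Cons d s)
  show ?case
  proof (cases p)
    case Nil
    then show ?thesis using Cons.prems by (intro exI[of _ "d # s"] exI[of _ "[]"]) simp
  next
    case (Cons c p')
    have "\<exists>p. reduce s = p @ q"
    proof (cases "reduce s")
      case Nil
      then show ?thesis using Cons.prems Cons by simp
    next
      case (Cons e r)
      show ?thesis
      proof (cases "d = e")
        case True
        then have "reduce s = (d # p) @ q" using Cons Cons.prems by simp
        then show ?thesis by blast
      next
        case False
        then have "reduce s = p' @ q" using Cons Cons.prems \<open>p = c # p'\<close> by simp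
        then show ?thesis by blast
      qed
    qed
    then obtain s' t where "s = t @ s'" "reduce s' = q" using Cons.IH by blast
    then show ?thesis by (intro exI[of _ s'] exI[of _ "d # t"]) simp
  qed
qed simp

text \<open>
  A word over \<open>a, b, \<dots>\<close> is read as a walk in the Cayley graph of the free product of copies of
  \<open>\<int>/2\<close>, which is a tree; the reduced form of a suffix is the vertex reached at that time. The
  word is a tree walk if the walk is closed and each letter labels a single edge of it.
\<close>

definition tree_walk :: "'a list \<Rightarrow> bool" where
  "tree_walk w \<longleftrightarrow> reduce w = [] \<and>
     (\<forall>s a x t. w = s @ [a] @ x @ [a] @ t \<longrightarrow> reduce x = [] \<or> reduce x = [a])"

lemma tree_walk_gap:
  "\<lbrakk>tree_walk (s @ [a] @ x @ [a] @ t)\<rbrakk> \<Longrightarrow> reduce x = [] \<or> reduce x = [a]"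
  by (auto simp: tree_walk_def)

lemma tree_walk_loop:
  "\<lbrakk>tree_walk (s @ [a] @ x @ [a] @ t); a \<notin> set x\<rbrakk> \<Longrightarrow> reduce x = []"
  using tree_walk_gap[of s a x t] set_reduce_subset[of x] by auto

text \<open>Two occurrences of \<open>a\<close> split a cyclic word into two arcs. As the walk is
  closed, one arc determines the other: \<open>reduce x\<close> is the reverse of
  \<open>reduce ([a] @ s @ [a])\<close>, which is again empty or \<open>[a]\<close>.\<close>

lemma tree_walk_rotate1:
  assumes "tree_walk (a # w)"
  shows "tree_walk (w @ [a])"
  unfolding tree_walk_def
proof (intro conjI allI impI)
  have closed: "reduce ([a] @ w) = []" using assms by (simp add: tree_walk_def)
  from reduce_append_eq_NilD'[OF this] have w: "reduce w = [a]" by simp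
  then have "reduce (reduce w @ [a]) = []" by simp
  then show "reduce (w @ [a]) = []" by (simp only: reduce_append_left)
  fix s b x t assume eq: "w @ [a] = s @ [b] @ x @ [b] @ t"
  show "reduce x = [] \<or> reduce x = [b]"
  proof (cases t rule: rev_exhaust)
    case Nil
    then have *: "a = b" "w = s @ [b] @ x" using eq by (auto simp: append_eq_append_conv2)
    then have "tree_walk ([] @ [a] @ s @ [a] @ x)" using assms by simp
    from tree_walk_gap[OF this] have "reduce s = [] \<or> reduce s = [a]" .
    moreover have "reduce (([a] @ s @ [a]) @ x) = []" using closed * by simp
    from reduce_append_eq_NilD'[OF this]
    have "reduce x = rev (reduce ([a] @ s @ [a]))" .
    moreover have "reduce ([a] @ s @ [a]) = push a (reduce (reduce s @ [a]))" by simp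
    ultimately show ?thesis using * by (auto simp del: reduce_append_left)
  next
    case (snoc t' c)
    then have "a # w = (a # s) @ [b] @ x @ [b] @ t'" using eq by simp
    then show ?thesis using assms tree_walk_gap[of "a # s"] by metis
  qed
qed

lemma tree_walk_rotate: "tree_walk (u @ v) \<Longrightarrow> tree_walk (v @ u)"
proof (induction u arbitrary: v)
  case (Cons a u)
  then show ?case using tree_walk_rotate1[of a "u @ v"] Cons.IH[of "v @ [a]"] by simp
qed simp

text \<open>Having no backtracking, \<open>q\<close> is a path in the tree, and such a path does not
  use the edge of a letter twice.\<close>

lemma tree_walk_path_distinct:
  assumes "tree_walk (u @ q @ v)" "distinct_adj q"
  shows "distinct q"
proof (rule ccontr)
  assume "\<not> distinct q"
  then obtain s x t a where q: "q = s @ [a] @ x @ [a] @ t" using not_distinct_decomp by blast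
  have "tree_walk ((u @ s) @ [a] @ x @ [a] @ (t @ v))" using assms(1) q by simp
  then have "reduce x = [] \<or> reduce x = [a]" by (rule tree_walk_gap)
  moreover have adj: "distinct_adj y" if "q = s @ y @ t" for s y t
    using assms(2) that by (auto simp: distinct_adj_append_iff)
  then have "distinct_adj x" "distinct_adj ([a] @ x @ [a])"
    using adj[of "s @ [a]" x "[a] @ t"] adj[of s "[a] @ x @ [a]" t] q by simp_all
  ultimately show False using reduce_id[of x] by auto
qed

lemma tree_walk_edge:
  assumes "tree_walk w" "w = s @ [a] @ t" "w = s' @ [a] @ t'"
  shows "{reduce t, reduce (a # t)} = {reduce t', reduce (a # t')}"
proof -
  have *: "{reduce t, reduce (a # t)} = {reduce t', reduce (a # t')}"
    if "w = s @ [a] @ x @ [a] @ t'" "t = x @ [a] @ t'" for s t x t'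
  proof -
    have "reduce x = [] \<or> reduce x = [a]" using tree_walk_gap[of s a x t'] assms(1) that(1) by simp
    moreover have "reduce t = reduce (reduce x @ [a] @ t')" using that(2) by simp
    ultimately show ?thesis by (auto simp del: reduce_append_left)
  qed
  consider "t = t'" | x where "t = x @ [a] @ t'" | x where "t' = x @ [a] @ t"
  proof -
    from assms(2,3) have "s @ [a] @ t = s' @ [a] @ t'" by simp
    then show ?thesis
      using that by (auto simp: append_eq_append_conv2 append_eq_Cons_conv Cons_eq_append_conv)
  qed
  then show ?thesis
  proof cases
    case 2
    then show ?thesis using *[of s x t' t] assms(2) by simp
  next
    case 3
    then show ?thesis using *[of s' x t t'] assms(3) by auto
  qed simp
qed

section \<open>Vertices and leaves of tree walks\<close>

definition vertices :: "'a list \<Rightarrow> 'a list set" where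
  "vertices w = {reduce t | s t. w = s @ t}"

lemma verticesI: "w = s @ t \<Longrightarrow> reduce t \<in> vertices w"
  by (auto simp: vertices_def)

lemma Nil_in_vertices: "[] \<in> vertices w"
  using verticesI[of w w "[]"] by simp

lemma vertices_tail: "c # q \<in> vertices w \<Longrightarrow> q \<in> vertices w"
  unfolding vertices_def using reduce_suffix_tail[of _ "[c]" q] by fastforce

lemma finite_vertices: "finite (vertices w)"
proof -
  have "vertices w \<subseteq> (\<lambda>n. reduce (drop n w)) ` {..length w}"
  proof
    fix q assume "q \<in> vertices w"
    then obtain s t where st: "w = s @ t" "q = reduce t" by (auto simp: vertices_def)
    then have "q = reduce (drop (length s) w)" "length s \<le> length w" by auto
    then show "q \<in> (\<lambda>n. reduce (drop n w)) ` {..length w}" by blast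
  qed
  then show ?thesis by (rule finite_subset) simp
qed

text \<open>
  Take a vertex of \<open>u\<close> not on \<open>v\<close> at maximal distance from the base point. It is a leaf, so that
  each visit to it is a backtracking \<open>e e\<close>.
\<close>

lemma tree_walk_leaf:
  assumes tree: "tree_walk (v @ u)" and u: "reduce u = []" and q: "q \<in> vertices u - vertices v"
  obtains (once) e x y where "u = x @ [e, e] @ y" "e \<notin> set x" "e \<notin> set y" "e \<notin> set v"
  | (twice) e x z y where "u = x @ [e, e] @ z @ [e, e] @ y" "e \<notin> set z"
proof -
  let ?N = "vertices u - vertices v"
  have "finite (length ` ?N)" "length ` ?N \<noteq> {}" using finite_vertices q by auto
  then have "Max (length ` ?N) \<in> length ` ?N" by (rule Max_in)
  then obtain p where p: "p \<in> ?N" "length p = Max (length ` ?N)" by auto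
  have max: "length r \<le> length p" if "r \<in> ?N" for r
    unfolding p(2) using finite_vertices that by (intro Max_ge) auto
  obtain e p1 where e: "p = e # p1" using p(1) Nil_in_vertices[of v] by (cases p) auto
  \<comment> \<open>Words are walked from the right, so \<open>t\<close> is what follows the visit
    reached by \<open>s\<close>. A next letter \<open>c\<close> other than \<open>e\<close> would
    lead to \<open>c # p\<close>, which is farther away and not on \<open>v\<close> either, as a
    walk reaching it passes through \<open>p\<close>.\<close>
  have leaf: "\<exists>t'. t = t' @ [e]" if "u = t @ s" "reduce s = p" for t s
  proof (cases t rule: rev_exhaust)
    case Nil
    then show ?thesis using that u e by simp
  next
    case (snoc t' c)
    have "c = e"
    proof (rule ccontr)
      assume "c \<noteq> e"
      then have r: "reduce (c # s) = c # p" using that(2) e by simp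
      have "c # p \<in> vertices u" using verticesI[of u t' "c # s"] that(1) snoc r by simp
      moreover have "c # p \<notin> vertices v" using vertices_tail[of c p v] p(1) by blast
      ultimately show False using max[of "c # p"] by simp
    qed
    then show ?thesis using snoc by simp
  qed
  obtain t s where ts: "u = t @ s" "reduce s = p" using p(1) by (auto simp: vertices_def)
  then obtain t' where t: "t = t' @ [e]" using leaf by blast
  have edge: "{reduce r, reduce (e # r)} = {p, p1}" if "v @ u = r' @ [e] @ r" for r' r
    using tree_walk_edge[OF tree that, of "v @ t'" s] ts t e by auto
  \<comment> \<open>An \<open>e\<close> in \<open>v\<close> would walk along the edge between
    \<open>p1\<close> and \<open>p\<close>. As \<open>u\<close> is closed, the suffixes of
    \<open>v\<close> reach the same vertices with or without \<open>u\<close> behind them, so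
    \<open>v\<close> would visit \<open>p\<close>.\<close>
  have ev: "e \<notin> set v"
  proof
    assume "e \<in> set v"
    then obtain v1 v2 where v: "v = v1 @ [e] @ v2" by (metis append_Cons append_Nil split_list)
    have "reduce (v2 @ u) = reduce v2" using reduce_append_right[of v2 u] u by simp
    then have "{reduce v2, reduce (e # v2)} = {p, p1}" using edge[of v1 "v2 @ u"] v by simp
    then have "p = reduce v2 \<or> p = reduce (e # v2)" by blast
    then show False using verticesI[of v "v1 @ [e]" v2] verticesI[of v v1 "e # v2"] v p(1) by auto
  qed
  have "e \<in> set u" using ts t by simp
  then obtain x y where xy: "u = x @ e # y" "e \<notin> set y" using split_list_last by fastforce
  have "{reduce y, reduce (e # y)} = {p, p1}" using edge[of "v @ x" y] xy by simp
  moreover have "reduce y \<noteq> p" using set_reduce_subset[of y] xy(2) e by auto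
  ultimately have y: "reduce y = p1" "reduce (e # y) = p" by (auto simp: doubleton_eq_iff)
  then obtain x' where x: "x = x' @ [e]" using leaf[of x "e # y"] xy by auto
  show ?thesis
  proof (cases "e \<in> set x'")
    case False
    then show ?thesis using once[of x' e y] xy x ev by simp
  next
    case True
    then obtain x2 z where x': "x' = x2 @ e # z" "e \<notin> set z" using split_list_last by fastforce
    \<comment> \<open>The loop \<open>z\<close> returns to \<open>p1\<close>, so the
      \<open>e\<close> in front of it also walks from \<open>p1\<close> to the leaf and has another
      \<open>e\<close> next to it.\<close>
    have "tree_walk ((v @ x2) @ [e] @ z @ [e] @ (e # y))" using tree xy x x' by simp
    then have "reduce z = []" using x'(2) by (rule tree_walk_loop)
    then have "reduce (reduce z @ [e, e] @ y) = p1"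
      using y push_push_reduce[of e y] by (simp del: reduce_append_left push_push_reduce)
    then have "reduce (z @ [e, e] @ y) = p1" by simp
    then have "reduce (e # z @ [e, e] @ y) = p" using y by simp
    then obtain x3 where "x2 = x3 @ [e]" using leaf[of x2 "e # z @ [e, e] @ y"] xy x x' by auto
    then show ?thesis using twice[of x3 e z y] xy x x' by simp
  qed
qed

section \<open>The pair positioner as the obstruction to tree walks\<close>

context word_category
begin

lemma reduce_factor: "u @ s @ v \<in> W \<Longrightarrow> u @ reduce s @ v \<in> W"
proof (induction s arbitrary: u)
  case (Cons a s)
  have *: "u @ [a] @ reduce s @ v \<in> W" using Cons.IH[of "u @ [a]"] Cons.prems by simp
  show ?case
  proof (cases "reduce s")
    case (Cons b r)
    then show ?thesis using * contract_equal[of u a "r @ v"] by auto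
  qed (use * in simp)
qed simp

text \<open>Contracting the last letter of \<open>q\<close> with the \<open>a\<close> behind it
  shortens \<open>q\<close> by one and makes that letter the new \<open>a\<close>. For a single
  letter \<open>q\<close>, the word is a rotation of that of \<open>r\<close>.\<close>

lemma pair_positioner_if_square_conjugate:
  assumes "[a, a] @ q @ [a, a] @ rev q \<in> W" "distinct (q @ [a])" "q \<noteq> []"
  shows "[0, 1, 1, 0, 1, 1] \<in> W"
  using assms
proof (induction q arbitrary: a rule: rev_induct)
  case (snoc d q)
  show ?case
  proof (cases "q = []")
    case True
    then have "([a, a, d, a, a]) @ [d] \<in> W" using snoc.prems by simp
    then have "[d] @ [a, a, d, a, a] \<in> W" by (rule rotate)
    then show ?thesis
      by (rule pattern[where f = "\<lambda>x. if x = d then 0 else 1"]) (use snoc.prems in auto)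
  next
    case False
    have "([a, a] @ q) @ [d, a] @ ([a, d] @ rev q) \<in> W" using snoc.prems by simp
    from contract[OF this] have "[d, d] @ q @ [d, d] @ rev q \<in> W"
      using snoc.prems(2) map_upd_idle[of a q d] map_upd_idle[of a "rev q" d] by simp
    then show ?thesis using snoc.IH[of d] snoc.prems(2) False by simp
  qed
qed simp

text \<open>Only gaps between the leading square and a later \<open>a\<close> are at issue.
  Cancelling backtrackings around a bad gap produces \<open>[a, a] @ q @ [a, a] @ rev q\<close>.
  Without its first square this word is short enough to be a tree walk, so \<open>q @ [a]\<close>
  has distinct letters, and \<open>r\<close> would follow.\<close>

lemma tree_walk_square:
  assumes no_r: "[0, 1, 1, 0, 1, 1] \<notin> W" and w: "[a, a] @ w \<in> W"
    and shorter: "\<And>v. \<lbrakk>v \<in> W; length v \<le> length w\<rbrakk> \<Longrightarrow> tree_walk v"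
  shows "tree_walk ([a, a] @ w)"
proof -
  have wW: "w \<in> W" using contract_equal[of "[]" a w] w by simp
  then have tree: "tree_walk w" using shorter by simp
  have key: "reduce x = [] \<or> reduce x = [a]" if x: "w = x @ [a] @ t" for x t
  proof (rule ccontr)
    assume no: "\<not> ?thesis"
    \<comment> \<open>A final \<open>a\<close> of the reduced gap is counted to the second square,
      so that both cases end in the same shape.\<close>
    define q where "q = (if last (reduce x) = a then butlast (reduce x) else reduce x)"
    have closed: "reduce (x @ [a] @ t) = []" using tree x by (simp add: tree_walk_def)
    then have "reduce ([a] @ t) = rev (reduce x)" by (rule reduce_append_eq_NilD')
    then have "reduce t = push a (rev (reduce x))" using push_push_reduce[of a t] by simp
    have "x \<noteq> []" "reduce x \<noteq> []" using no by auto
    have q: "q \<noteq> []" "distinct_adj (q @ [a])" "[a, a] @ q @ [a, a] @ rev q \<in> W"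
      "2 * length q + 2 \<le> length w"
    proof -
      obtain p d where p: "reduce x = p @ [d]" using \<open>reduce x \<noteq> []\<close> by (cases "reduce x" rule: rev_exhaust) auto
      have lx: "length (reduce x) \<le> length x" "length (reduce t) \<le> length t"
        by (rule length_reduce_le)+
      have adj: "distinct_adj (reduce x)" by (rule distinct_adj_reduce)
      have 1: "[a, a] @ reduce x @ [a] @ t \<in> W"
        using reduce_factor[of "[a, a]" x "[a] @ t"] w x by simp
      have 2: "[a, a] @ reduce x @ [a] @ reduce t \<in> W"
        using reduce_factor[of "[a, a] @ reduce x @ [a]" t "[]"] 1 by simp
      show "q \<noteq> []" using no p by (auto simp: q_def)
      show "distinct_adj (q @ [a])"
        using adj p by (auto simp: q_def distinct_adj_append_iff)
      show "[a, a] @ q @ [a, a] @ rev q \<in> W"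
      proof (cases "d = a")
        case True
        then show ?thesis using 2 p \<open>reduce t = _\<close> by (simp add: q_def)
      next
        case False
        then show ?thesis using 2 p \<open>reduce t = _\<close> by (simp add: q_def)
      qed
      show "2 * length q + 2 \<le> length w"
        using p lx \<open>reduce t = _\<close> x by (cases "d = a") (auto simp: q_def)
    qed
    have "[] @ (q @ [a]) @ ([a] @ rev q) \<in> W"
      using contract_equal[of "[]" a "q @ [a, a] @ rev q"] q(3) by simp
    then have "tree_walk ([] @ (q @ [a]) @ ([a] @ rev q))" using shorter q(4) by simp
    then have "distinct (q @ [a])" using q(2) by (rule tree_walk_path_distinct)
    then show False using pair_positioner_if_square_conjugate q(1,3) no_r by blast
  qed
  show ?thesis
    unfolding tree_walk_def
  proof (intro conjI allI impI)
    show "reduce ([a, a] @ w) = []" using tree by (simp add: tree_walk_def)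
    fix s b x t assume eq: "[a, a] @ w = s @ [b] @ x @ [b] @ t"
    consider "s = []" | "s = [a]" | s' where "s = [a, a] @ s'" "w = s' @ [b] @ x @ [b] @ t"
      using eq by (auto simp: Cons_eq_append_conv)
    then show "reduce x = [] \<or> reduce x = [b]"
    proof cases
      case 1
      then have b: "b = a" "[a] @ w = x @ [b] @ t" using eq by auto
      show ?thesis
      proof (cases x)
        case (Cons c x')
        then have "c = a" "w = x' @ [a] @ t" using b by auto
        then show ?thesis using key[of x' t] Cons b by auto
      qed simp
    next
      case 2
      then show ?thesis using key[of x t] eq by auto
    next
      case 3
      then show ?thesis using tree tree_walk_gap by metis
    qed
  qed
qed

text \<open>The reverse of the word is itself a rule, from \<open>a # x\<close> to
  \<open>b a\<close>. Tripling the second \<open>a\<close> leaves \<open>a b a a\<close> in front of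
  a copy of \<open>a # x\<close>; the rule turns this into \<open>a b a a b a\<close>, a rotation of
  the word of \<open>r\<close>.\<close>

lemma pair_positioner_if_two_letters:
  assumes b4: "[0, 0, 0, 0] \<in> W" and w: "[a, b, a] @ x \<in> W" "a \<noteq> b"
    and x: "set x \<subseteq> {a, b}" "b \<in> set x"
  shows "[0, 1, 1, 0, 1, 1] \<in> W"
proof -
  have "[a, b] @ [a, a, a] @ x \<in> W" using triple[OF b4, of "[a, b]" a x] w(1) by simp
  then have 1: "[a, b, a, a] @ map (\<lambda>x. x) (a # x) @ [] \<in> W" by simp
  have "rev (a # x) @ [b, a] \<in> W" using reverse[OF w(1)] by simp
  from replace[OF 1 this] have "[a] @ [b, a, a, b, a] \<in> W" using x by auto
  then have "[b, a, a, b, a] @ [a] \<in> W" by (rule rotate)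
  then show ?thesis by (rule pattern[where f = "\<lambda>x. if x = b then 0 else 1"]) (use w in auto)
qed

text \<open>Equal neighbours, also cyclic ones, are covered by \<open>tree_walk_square\<close>. In
  any other word, joining the first two letters creates a square followed by a closed walk whose
  farthest backtrackings are all \<open>a a\<close>; this walk then uses no letter but
  \<open>a\<close>, so that the word has only the letters \<open>a\<close> and \<open>b\<close>, and
  \<open>r\<close> would follow.\<close>

theorem tree_walk_if_no_pair_positioner:
  assumes b4: "[0, 0, 0, 0] \<in> W" and S: "[0, 1] \<notin> W" and no_r: "[0, 1, 1, 0, 1, 1] \<notin> W"
    and "w \<in> W"
  shows "tree_walk w"
  using \<open>w \<in> W\<close>
proof (induction "length w" arbitrary: w rule: less_induct)
  case less
  have square: "tree_walk ([a, a] @ v)" if "[a, a] @ v \<in> W" "length v + 2 = length w" for a v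
    using that less.hyps by (intro tree_walk_square[OF no_r]) auto
  show ?case
  proof (cases "\<exists>u a v. w = u @ [a, a] @ v")
    case True
    then obtain u a v where uv: "w = u @ [a, a] @ v" by blast
    then have "[a, a] @ (v @ u) \<in> W" using rotate[of u "[a, a] @ v"] less.prems by simp
    then have "tree_walk (([a, a] @ v) @ u)" using square[of a "v @ u"] uv by simp
    then show ?thesis using tree_walk_rotate[of "[a, a] @ v" u] uv by simp
  next
    case False
    note adj = this
    show ?thesis
    proof (cases w)
      case Nil
      then show ?thesis by (simp add: tree_walk_def)
    next
      case (Cons a w')
      have "w' \<noteq> []"
      proof
        assume "w' = []"
        then show False using double_singleton_if_singleton[of "[]" a "[]"] less.prems S Cons by simp
      qed
      then obtain b x where w': "w' = b # x" by (cases w') auto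
      have ab: "a \<noteq> b" using adj Cons w' by (metis append_Cons append_Nil)
      have w: "[] @ [a, b] @ x \<in> W" using less.prems Cons w' by simp
      show ?thesis
      proof (cases "x \<noteq> [] \<and> last x = a")
        case True
        then obtain y where x: "x = y @ [a]" by (metis append_butlast_last_id)
        have "[a, a] @ (b # y) \<in> W" using rotate[of "[a, b] @ y" "[a]"] w x by simp
        then have "tree_walk ([a] @ ([a, b] @ y))" using square[of a "b # y"] Cons w' x by simp
        then show ?thesis using tree_walk_rotate[of "[a]" "[a, b] @ y"] Cons w' x by simp
      next
        case False
        let ?m = "map (id(b := a))"
        have mx: "?m x \<in> W" using contract[OF w] by simp
        have "[a, a] @ ?m x \<in> W" using join[OF b4 w] ab by simp
        then have tree: "tree_walk ([a, a] @ ?m x)" using square[of a "?m x"] Cons w' by simp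
        have "a \<in> set x \<or> b \<in> set x"
        proof (rule ccontr)
          assume "\<not> ?thesis"
          then show False
            using double_singleton_if_singleton[of "[]" a "b # x"] w ab S by simp
        qed
        then have "x \<noteq> []" by auto
        have closed: "reduce (?m x) = []" using tree by (simp add: tree_walk_def)
        \<comment> \<open>The part \<open>u\<close> is a gap to the leading square; as the walk is
          closed, the part \<open>v\<close> is constrained in the same way.\<close>
        have gap: "reduce v = [] \<or> reduce v = [a]" if "?m x = u @ [a] @ v" for u v
        proof -
          have "tree_walk ([a] @ [a] @ u @ [a] @ v)" using tree that by simp
          from tree_walk_gap[OF this] have u: "reduce u = [] \<or> reduce u = [a]" .
          have "reduce ((u @ [a]) @ v) = []" using closed that by simp
          from reduce_append_eq_NilD'[OF this]
          have "reduce v = rev (reduce (reduce u @ [a]))" by simp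
          then show ?thesis using u by (auto simp del: reduce_append_left)
        qed
        text \<open>A vertex at maximal distance is reached through a backtracking, which can only be
          \<open>a a\<close>, because \<open>w\<close> has no two equal adjacent letters.\<close>
        define M where "M = Max (length ` vertices (?m x))"
        have M: "length r \<le> M" if "r \<in> vertices (?m x)" for r
          unfolding M_def using that finite_vertices by (intro Max_ge) auto
        have M_pos: "0 < M"
        proof -
          obtain y c where "?m x = y @ [c]" using \<open>x \<noteq> []\<close> by (cases "?m x" rule: rev_exhaust) auto
          then have "[c] \<in> vertices (?m x)" using verticesI[of "?m x" y "[c]"] by simp
          then show ?thesis using M by fastforce
        qed
        have far: "reduce v = [a]" if uv: "?m x = u @ v" and len: "length (reduce v) = M" for u v
        proof -
          obtain e q where e: "reduce v = e # q" using len M_pos by (cases "reduce v") auto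
          obtain u' c where u: "u = u' @ [c]" using closed uv e by (cases u rule: rev_exhaust) auto
          have c: "c = e"
          proof (rule ccontr)
            assume "c \<noteq> e"
            then have "reduce (c # v) = c # e # q" using e by simp
            then show False using M[OF verticesI[of "?m x" u' "c # v"]] uv u len e by simp
          qed
          obtain d v' where v: "v = d # v'" using e by (cases v) auto
          have d: "d = e"
          proof (cases "reduce v'")
            case Nil
            then show ?thesis using v e by simp
          next
            case (Cons f r)
            show ?thesis
            proof (cases "d = f")
              case True
              then have "length (reduce v') > M" using v Cons len by simp
              then show ?thesis using M[OF verticesI[of "?m x" "u @ [d]" v']] uv v by simp
            qed (use v e Cons in simp)
          qed
          have "?m x = u' @ [e] @ [e] @ v'" using uv u v c d by simp
          then obtain y1 c1 c2 y2 where y: "x = y1 @ [c1, c2] @ y2" "(id(b := a)) c1 = e" "(id(b := a)) c2 = e"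
            by (auto simp: map_eq_append_conv map_eq_Cons_conv)
          have "c1 \<noteq> c2" using adj Cons w' y(1) by (metis append_Cons)
          then have "e = a" using y(2,3) by (auto split: if_splits)
          then have "?m x = (u' @ [a]) @ [a] @ v'" using uv u v c d by simp
          from gap[OF this] have "reduce v' = [] \<or> reduce v' = [a]" .
          then show ?thesis using v d \<open>e = a\<close> e by auto
        qed
        have "M \<in> length ` vertices (?m x)"
          unfolding M_def using finite_vertices Nil_in_vertices by (intro Max_in) auto
        then obtain r where "r \<in> vertices (?m x)" "length r = M" by auto
        then have "M = 1" using far by (fastforce simp: vertices_def)
        have short: "reduce v = [] \<or> reduce v = [a]" if "?m x = u @ v" for u v
        proof (cases "reduce v")
          case (Cons c r)
          have "length (reduce v) \<le> 1" using M[OF verticesI[OF that]] \<open>M = 1\<close> by simp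
          then show ?thesis using far[OF that] Cons \<open>M = 1\<close> by simp
        qed simp
        \<comment> \<open>Every letter joins two of the vertices \<open>[]\<close> and
          \<open>[a]\<close>, so it can only be \<open>a\<close>.\<close>
        have "c = a" if c: "c \<in> set (?m x)" for c
        proof -
          obtain u v where uv: "?m x = u @ [c] @ v"
            using split_list[OF c] by auto
          have "reduce v = [] \<or> reduce v = [a]" "reduce (c # v) = [] \<or> reduce (c # v) = [a]"
            using short[of "u @ [c]" v] short[of u "c # v"] uv by auto
          then show ?thesis by (auto split: if_splits)
        qed
        then have set_x: "set x \<subseteq> {a, b}" by (fastforce split: if_splits)
        obtain c x' where x: "x = c # x'" using \<open>x \<noteq> []\<close> by (cases x) auto
        have "c \<noteq> b" using adj Cons w' x by (metis append_Cons append_Nil)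
        then have "c = a" using set_x x by auto
        have "last x = b" using False \<open>x \<noteq> []\<close> set_x last_in_set by blast
        then have "x' \<noteq> []" "b \<in> set x'" using x \<open>c = a\<close> ab by (auto split: if_splits)
        then show ?thesis
          using pair_positioner_if_two_letters[OF b4, of a b x'] w x \<open>c = a\<close> ab set_x no_r by simp
      qed
    qed
  qed
qed

end

section \<open>Generation of tree walks by \<open>pi\<close> words\<close>

definition pi_word :: "'a list \<Rightarrow> 'a list" where
  "pi_word p = p @ rev p @ p @ rev p"

lemma map_pi_word: "map f (pi_word p) = pi_word (map f p)"
  by (simp add: pi_word_def rev_map)

lemma set_pi_word [simp]: "set (pi_word p) = set p"
  by (auto simp: pi_word_def)

context word_category
begin

lemma pi_word_iff:
  assumes "distinct p"
  shows "pi_word p \<in> W \<longleftrightarrow> pi_word [0..<length p] \<in> W"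
proof
  assume *: "pi_word [0..<length p] \<in> W"
  have "inj_on ((!) p) (set (pi_word [0..<length p]))"
    using assms by (auto simp: inj_on_def nth_eq_iff_index_eq)
  from rename[OF * this] show "pi_word p \<in> W" by (simp add: map_pi_word map_nth)
next
  assume *: "pi_word p \<in> W"
  define f where "f = the_inv_into {..<length p} ((!) p)"
  have inj: "inj_on ((!) p) {..<length p}" using assms by (auto simp: inj_on_def nth_eq_iff_index_eq)
  have "inj_on f ((!) p ` {..<length p})" unfolding f_def by (rule inj_on_the_inv_into[OF inj])
  moreover have "(!) p ` {..<length p} = set (pi_word p)" by (auto simp: in_set_conv_nth)
  ultimately have "map f (pi_word p) \<in> W" using rename[OF *] by simp
  moreover have "map f p = [0..<length p]"
    by (rule nth_equalityI) (use inj in \<open>auto simp: f_def the_inv_into_f_f\<close>)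
  ultimately show "pi_word [0..<length p] \<in> W" by (simp add: map_pi_word)
qed

end

lemma subset_if_tree_walks:
  assumes "word_category W" "word_category D" and tree: "\<And>w. w \<in> W \<Longrightarrow> tree_walk w"
    and b4: "[0, 0, 0, 0] \<in> D"
    and pi: "\<And>l. \<lbrakk>1 \<le> l; pi_word [0..<l] \<in> W\<rbrakk> \<Longrightarrow> pi_word [0..<l] \<in> D"
  shows "W \<subseteq> D"
proof
  interpret W: word_category W by fact
  interpret D: word_category D by fact
  fix w assume "w \<in> W"
  then show "w \<in> D"
  proof (induction "length w" arbitrary: w rule: less_induct)
    case less
    show ?case
    proof (rule ccontr)
      assume wD: "w \<notin> D"
      \<comment> \<open>All failing words of this length are considered at once, because the choice
        of a shortest loop ranges over all of them.\<close>
      define R where "R = {w' \<in> W. length w' = length w \<and> w' \<notin> D}"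
      have wR: "w \<in> R" using less.prems wD by (simp add: R_def)
      have R_rotate: "v @ u \<in> R" if "u @ v \<in> R" for u v
        using that W.rotate D.rotate by (auto simp: R_def)
      have no_leaf: False if "x @ [e, e] @ y \<in> R" "e \<notin> set x" "e \<notin> set y" for x e y
      proof -
        have "x @ y \<in> W" using W.contract_equal that(1) by (auto simp: R_def)
        moreover have "length (x @ y) < length w" using that(1) by (auto simp: R_def)
        ultimately have "x @ y \<in> D" using less.hyps by blast
        then show False using D.insert_pair[of x y e] that by (auto simp: R_def)
      qed
      define Q where "Q n \<longleftrightarrow> (\<exists>e z y. length z = n \<and> e \<notin> set z \<and> [e, e] @ z @ [e, e] @ y \<in> R)" for n
      have leaf: "\<exists>n \<le> length u - 4. Q n" if R: "v @ u \<in> R" and u: "reduce u = []" and q: "q \<in> vertices u - vertices v" for u v q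
      proof -
        have "tree_walk (v @ u)" using R tree by (simp add: R_def)
        from this u q show ?thesis
        proof (cases rule: tree_walk_leaf)
          case (once e x y)
          then show ?thesis using no_leaf[of "v @ x" e y] R by simp
        next
          case (twice e x z y)
          have "[e, e] @ z @ [e, e] @ (y @ v @ x) \<in> R"
            using R_rotate[of "v @ x" "[e, e] @ z @ [e, e] @ y"] R twice by simp
          then have "Q (length z)" using twice by (auto simp: Q_def)
          moreover have "length z \<le> length u - 4" using twice by simp
          ultimately show ?thesis by blast
        qed
      qed
      have "\<exists>n. Q n"
      proof -
        have "w \<noteq> []" using wD D.nil by auto
        then obtain s a where w: "w = s @ [a]" by (cases w rule: rev_exhaust) auto
        then have "[a] \<in> vertices w" using verticesI[of w s "[a]"] by simp
        moreover have "[a] \<notin> vertices []" by (auto simp: vertices_def)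
        moreover have "reduce w = []" using tree[OF less.prems] by (simp add: tree_walk_def)
        ultimately show ?thesis using leaf[of "[]" w "[a]"] wR by auto
      qed
      then obtain n where n: "Q n" "\<And>m. m < n \<Longrightarrow> \<not> Q m" using exists_least_iff[of Q] by blast
      then obtain e z y where z: "length z = n" "e \<notin> set z" and R: "[e, e] @ z @ [e, e] @ y \<in> R"
        by (auto simp: Q_def)
      have W: "[e, e] @ z @ [e, e] @ y \<in> W" using R by (simp add: R_def)
      have walk: "tree_walk ([e, e] @ z @ [e, e] @ y)" by (rule tree[OF W])
      then have "tree_walk ([e] @ [e] @ z @ [e] @ ([e] @ y))" by simp
      then have redz: "reduce z = []" using z(2) by (rule tree_walk_loop)
      have redy: "reduce y = []"
      proof -
        have "reduce (([e, e] @ z @ [e, e]) @ y) = []" using walk by (simp add: tree_walk_def)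
        moreover have "reduce ([e, e] @ z @ [e, e]) = []"
          using reduce_append_left[of z "[e, e]"] redz by simp
        ultimately show ?thesis using reduce_append_left[of "[e, e] @ z @ [e, e]" y] by simp
      qed
      let ?v = "[e, e] @ y @ [e, e]"
      \<comment> \<open>Otherwise \<open>z\<close> has a leaf of its own that is visited twice
        within \<open>z\<close>; the four letters of these visits make the loop between them shorter
        than \<open>z\<close>.\<close>
      have visited: "vertices z \<subseteq> vertices ?v"
      proof (rule ccontr)
        assume "\<not> ?thesis"
        then obtain q where q: "q \<in> vertices z - vertices ?v" by blast
        have R': "?v @ z \<in> R" using R_rotate[of "[e, e] @ z" "[e, e] @ y"] R by simp
        have "z \<noteq> []" using q Nil_in_vertices[of ?v] by (auto simp: vertices_def)
        obtain m where "m \<le> length z - 4" "Q m" using leaf[OF R' redz q] by blast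
        moreover have "length z - 4 < n" using \<open>z \<noteq> []\<close> z(1) by (cases z) auto
        ultimately show False using n(2)[of m] by simp
      qed
      have path: "distinct q \<and> e \<notin> set q" if q: "q \<in> vertices z" for q
      proof -
        obtain z1 z2 where z12: "z = z1 @ z2" "reduce z2 = q" using q by (auto simp: vertices_def)
        have "([e, e] @ z1) @ z2 @ ([e, e] @ y) \<in> W" using W z12 by simp
        from tree[OF W.reduce_factor[OF this]] have "distinct (reduce z2)"
          by (rule tree_walk_path_distinct) (rule distinct_adj_reduce)
        then show ?thesis using set_reduce_subset[of z2] z12 z(2) by auto
      qed
      \<comment> \<open>Both \<open>z\<close> and \<open>y\<close> are closed and pass through
        \<open>q\<close>, so cancelling turns each into \<open>rev q @ q\<close>. Together with the
        two squares this is a rotation of \<open>pi_word (e # rev q)\<close>.\<close>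
      have pi_D: "pi_word p \<in> D"
        if p: "distinct p" "length p = Suc (length q)" and q: "q \<in> vertices z" "q \<noteq> []" for p q
      proof -
        obtain z1 z2 where z12: "z = z1 @ z2" "reduce z2 = q" using q(1) by (auto simp: vertices_def)
        have "q \<in> vertices ?v" using visited q(1) by blast
        then obtain s t where st: "?v = s @ t" "reduce t = q" unfolding vertices_def by blast
        have "reduce (y @ [e, e]) = []" using reduce_append_left[of y "[e, e]"] redy by simp
        \<comment> \<open>The squares \<open>e e\<close> visit only the base point and
          \<open>[e]\<close>, so \<open>q\<close> must be reached within \<open>y\<close>.\<close>
        then have "t \<notin> {[], [e], [e] @ y @ [e, e], [e, e] @ y @ [e, e]}"
          using st(2) q(2) path[OF q(1)] by auto
        then obtain y1 y2 where y12: "y = y1 @ y2" "t = y2 @ [e, e]"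
          using st(1) by (auto simp: Cons_eq_append_conv append_eq_append_conv2)
        have y2: "reduce y2 = q" using st(2) y12 reduce_cancel[of y2 e "[]"] by simp
        have "reduce z1 = rev q" using reduce_append_eq_NilD[of z1 z2] redz z12 by simp
        moreover have "reduce y1 = rev q" using reduce_append_eq_NilD[of y1 y2] redy y12 y2 by simp
        moreover have "[e, e] @ reduce z1 @ reduce z2 @ [e, e] @ reduce y1 @ reduce y2 \<in> W"
        proof -
          have "[e, e] @ z1 @ (z2 @ [e, e] @ y1 @ y2) \<in> W" using W z12 y12 by simp
          from W.reduce_factor[OF this]
          have "([e, e] @ reduce z1) @ z2 @ ([e, e] @ y1 @ y2) \<in> W" by simp
          from W.reduce_factor[OF this]
          have "([e, e] @ reduce z1 @ reduce z2 @ [e, e]) @ y1 @ y2 \<in> W" by simp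
          from W.reduce_factor[OF this]
          have "([e, e] @ reduce z1 @ reduce z2 @ [e, e] @ reduce y1) @ y2 @ [] \<in> W" by simp
          from W.reduce_factor[OF this] show ?thesis by simp
        qed
        ultimately have "[e] @ ([e] @ rev q @ q @ [e, e] @ rev q @ q) \<in> W" using z12 y2 by simp
        from W.rotate[OF this] have "pi_word (e # rev q) \<in> W" by (simp add: pi_word_def)
        then have "pi_word [0..<Suc (length q)] \<in> W"
          using W.pi_word_iff[of "e # rev q"] path[OF q(1)] by simp
        then have "pi_word [0..<Suc (length q)] \<in> D" using pi[of "Suc (length q)"] by simp
        then show ?thesis using D.pi_word_iff[OF p(1)] p(2) by simp
      qed
      text \<open>The pair \<open>e e\<close> is carried through \<open>z\<close>, as a detour from the current vertex \<open>reduce t\<close>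
        to the base point and back.\<close>
      have "[e, e] @ s @ reduce t @ [e, e] @ rev (reduce t) @ t @ y \<in> D" if "z = s @ t" for s t
        using that
      proof (induction s arbitrary: t rule: rev_induct)
        case Nil
        \<comment> \<open>At \<open>t = z\<close> the detour is empty and the carried pair adjoins
          the first square, so tripling one point of a shorter word suffices.\<close>
        have "[e, e] @ z @ y \<in> W" using W.contract_equal[of "[e, e] @ z" e y] W by simp
        moreover have "length ([e, e] @ z @ y) < length w" using R by (auto simp: R_def)
        ultimately have "[] @ [e] @ (e # z @ y) \<in> D" using less.hyps by auto
        from D.triple[OF b4 this] show ?case using Nil redz by simp
      next
        case (snoc f s)
        let ?u = "[e, e] @ s" and ?v = "t @ y" and ?q = "reduce t"
        have IH: "?u @ push f ?q @ [e, e] @ rev (push f ?q) @ [f] @ ?v \<in> D"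
          using snoc.IH[of "f # t"] snoc.prems by simp
        have vert: "?q \<in> vertices z" "push f ?q \<in> vertices z"
          using verticesI[of z "s @ [f]" t] verticesI[of z s "f # t"] snoc.prems by auto
        show ?case
        \<comment> \<open>Passing \<open>f\<close> prolongs the detour in the first case and
          shortens it in the second. The \<open>pi\<close> word belongs to the endpoint of the edge
          \<open>f\<close> farther from the base point; cutting it at different places gives the two
          rules.\<close>
        proof (cases "\<exists>q. ?q = f # q")
          case True
          then obtain q where q: "?q = f # q" by blast
          have 1: "?u @ map (\<lambda>x. x) (q @ [e, e] @ rev q @ [f]) @ ?v \<in> D" using IH q by simp
          have "pi_word (f # q @ [e]) \<in> D"
            by (rule pi_D[OF _ _ vert(1)]) (use path[OF vert(1)] q in auto)
          then have 2: "rev (q @ [e, e] @ rev q @ [f]) @ ([f, f] @ q @ [e, e] @ rev q @ [f]) \<in> D"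
            by (simp add: pi_word_def)
          have "?u @ map (\<lambda>x. x) ([f, f] @ q @ [e, e] @ rev q @ [f]) @ ?v \<in> D"
            by (rule D.replace[OF 1 2]) auto
          then show ?thesis using q by simp
        next
          case False
          then have q: "push f ?q = f # ?q" by (cases ?q) auto
          have 1: "?u @ map (\<lambda>x. x) ([f] @ ?q @ [e, e] @ rev ?q @ [f, f]) @ ?v \<in> D"
            using IH q by simp
          have "pi_word (f # ?q @ [e]) \<in> D"
            by (rule pi_D[OF _ _ vert(2)]) (use path[OF vert(2)] q in auto)
          then have "([f] @ ?q @ [e, e] @ rev ?q @ [f, f] @ ?q @ [e, e] @ rev ?q) @ [f] \<in> D"
            by (simp add: pi_word_def)
          from D.rotate[OF this]
          have 2: "rev ([f] @ ?q @ [e, e] @ rev ?q @ [f, f]) @ ([f] @ ?q @ [e, e] @ rev ?q) \<in> D"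
            by simp
          have "?u @ map (\<lambda>x. x) ([f] @ ?q @ [e, e] @ rev ?q) @ ?v \<in> D"
            by (rule D.replace[OF 1 2]) auto
          then show ?thesis by simp
        qed
      qed
      from this[of z "[]"] show False using R by (simp add: R_def)
    qed
  qed
qed

section \<open>From partitions to words\<close>

text \<open>Partitions are represented as kernels of labellings, so that lying in one block becomes
  equality of labels.\<close>

definition fibres :: "'a set \<Rightarrow> ('a \<Rightarrow> 'b) \<Rightarrow> 'a set set" where
  "fibres A f = (\<lambda>y. {x \<in> A. f x = f y}) ` A"

lemma fibres_cong:
  "(\<And>x y. \<lbrakk>x \<in> A; y \<in> A\<rbrakk> \<Longrightarrow> f x = f y \<longleftrightarrow> f' x = f' y) \<Longrightarrow> fibres A f = fibres A f'"
  unfolding fibres_def by (rule image_cong) auto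

lemma fibres_relabel:
  assumes "g ` A = B" "\<And>x. x \<in> A \<Longrightarrow> f' (g x) = f x"
  shows "relabel g (fibres A f) = fibres B f'"
proof -
  have "g ` {x \<in> A. f x = f y} = {x \<in> g ` A. f' x = f' (g y)}" if "y \<in> A" for y
    using assms(2) that by auto
  then show ?thesis
    unfolding relabel_def fibres_def assms(1)[symmetric] image_image by (rule image_cong[OF refl])
qed

lemma partition_on_fibres: "partition_on A (fibres A f)"
  by (rule partition_onI) (auto simp: fibres_def disjnt_def)

definition partition_of :: "nat list \<Rightarrow> nat list \<Rightarrow> partition" where
  "partition_of u v = fibres (points (length u) (length v)) (label u v)"

lemma partition_of_in_P: "partition_of u v \<in> P (length u) (length v)"
  by (simp add: P_def partition_of_def partition_on_fibres)

lemma label_simps [simp]: "label u v (Inl i) = u ! i" "label u v (Inr j) = v ! j"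
  by (simp_all add: label_def)

lemma Inl_in_points [simp]: "Inl i \<in> points k l \<longleftrightarrow> i < k"
  and Inr_in_points [simp]: "Inr j \<in> points k l \<longleftrightarrow> j < l"
  by (auto simp: points_def)

lemma finite_points: "finite (points k l)"
  by (simp add: points_def)

lemma of_word_eq: "of_word w = partition_of [] w"
proof -
  have "{Inr j |j. j < length w \<and> w ! j = w ! i} =
      {x \<in> points 0 (length w). label [] w x = label [] w (Inr i)}" for i
    by (auto simp: points_def)
  moreover have "set w = (!) w ` {..<length w}" by (auto simp: in_set_conv_nth)
  moreover have "points 0 (length w) = Inr ` {..<length w}" by (auto simp: points_def)
  ultimately show ?thesis by (simp add: of_word_def partition_of_def fibres_def image_image)
qed

lemma partition_of_exhaust:
  assumes "p \<in> P k l"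
  obtains u v where "length u = k" "length v = l" "p = partition_of u v"
proof -
  have p: "partition_on (points k l) p" using assms by (simp add: P_def)
  have "finite p" using finite_elements[OF finite_points p] .
  then obtain f :: "point set \<Rightarrow> nat" where f: "inj_on f p"
    using finite_imp_inj_to_nat_seg by blast
  define c where "c x = (SOME b. b \<in> p \<and> x \<in> b)" for x
  have c: "c x \<in> p" "x \<in> c x" if "x \<in> points k l" for x
  proof -
    have "\<exists>b. b \<in> p \<and> x \<in> b" using that partition_onD1[OF p] by auto
    from someI_ex[OF this] show "c x \<in> p" "x \<in> c x" by (simp_all add: c_def)
  qed
  have c_eq: "c x = b" if "b \<in> p" "x \<in> b" for x b
  proof -
    have "x \<in> points k l" using that partition_onD1[OF p] by auto
    then show ?thesis using c[of x] that disjointD[OF partition_onD2[OF p], of "c x" b] by blast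
  qed
  let ?u = "map (\<lambda>i. f (c (Inl i))) [0..<k]" and ?v = "map (\<lambda>j. f (c (Inr j))) [0..<l]"
  have label: "label ?u ?v x = f (c x)" if "x \<in> points k l" for x
    using that by (cases x) auto
  have "p = fibres (points k l) c"
  proof
    show "p \<subseteq> fibres (points k l) c"
    proof
      fix b assume b: "b \<in> p"
      then have "b \<noteq> {}" "b \<subseteq> points k l" using p by (auto simp: partition_on_def)
      then obtain x where x: "x \<in> b" "x \<in> points k l" by auto
      then have "b = {y \<in> points k l. c y = c x}"
        using c c_eq[OF b] b \<open>b \<subseteq> points k l\<close> by blast
      then show "b \<in> fibres (points k l) c" using x by (auto simp: fibres_def)
    qed
    show "fibres (points k l) c \<subseteq> p"
    proof
      fix b assume "b \<in> fibres (points k l) c"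
      then obtain x where x: "x \<in> points k l" "b = {y \<in> points k l. c y = c x}"
        by (auto simp: fibres_def)
      have "c x \<subseteq> points k l" using c(1)[OF x(1)] p by (auto simp: partition_on_def)
      then have "b = c x" using x c c_eq[OF c(1)[OF x(1)]] by blast
      then show "b \<in> p" using c x by simp
    qed
  qed
  also have "\<dots> = fibres (points k l) (label ?u ?v)"
    by (rule fibres_cong) (use f c label in \<open>auto simp: inj_on_eq_iff\<close>)
  finally show ?thesis using that[of ?u ?v] by (simp add: partition_of_def)
qed

lemma identity_partition_eq: "identity_partition = partition_of [0] [0]"
proof -
  have "points 1 1 = {Inl 0, Inr 0}" by (auto simp: points_def)
  moreover have "{x. (x = Inl 0 \<or> x = Inr (0::nat)) \<and> label [0] [0] x = 0} = {Inl 0, Inr 0}" by auto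
  ultimately show ?thesis by (simp add: identity_partition_def partition_of_def fibres_def)
qed

lemma relabel_rot_left_down: "relabel rot_left_down (partition_of (a # u) v) = partition_of u (a # v)"
  unfolding partition_of_def
proof (rule fibres_relabel)
  have "x \<in> rot_left_down ` points (length (a # u)) (length v)"
    if "x \<in> points (length u) (length (a # v))" for x
  proof (cases x)
    case (Inl i)
    then show ?thesis using that by (intro image_eqI[of _ _ "Inl (Suc i)"]) auto
  next
    case (Inr j)
    then show ?thesis
      using that by (cases j) (auto intro: image_eqI[of _ _ "Inl 0"] image_eqI[of _ _ "Inr (j - 1)"])
  qed
  moreover have "rot_left_down x \<in> points (length u) (length (a # v))"
    if "x \<in> points (length (a # u)) (length v)" for x
    using that by (cases x rule: rot_left_down.cases) auto
  ultimately show "rot_left_down ` points (length (a # u)) (length v) = points (length u) (length (a # v))"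
    by blast
  show "label u (a # v) (rot_left_down x) = label (a # u) v x" for x
    by (cases x rule: rot_left_down.cases) auto
qed

lemma relabel_rot_left_up: "relabel rot_left_up (partition_of u (a # v)) = partition_of (a # u) v"
  unfolding partition_of_def
proof (rule fibres_relabel)
  have "x \<in> rot_left_up ` points (length u) (length (a # v))"
    if "x \<in> points (length (a # u)) (length v)" for x
  proof (cases x)
    case (Inr j)
    then show ?thesis using that by (intro image_eqI[of _ _ "Inr (Suc j)"]) auto
  next
    case (Inl i)
    then show ?thesis
      using that by (cases i) (auto intro: image_eqI[of _ _ "Inr 0"] image_eqI[of _ _ "Inl (i - 1)"])
  qed
  moreover have "rot_left_up x \<in> points (length (a # u)) (length v)"
    if "x \<in> points (length u) (length (a # v))" for x
    using that by (cases x rule: rot_left_up.cases) auto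
  ultimately show "rot_left_up ` points (length u) (length (a # v)) = points (length (a # u)) (length v)"
    by blast
  show "label (a # u) v (rot_left_up x) = label u (a # v) x" for x
    by (cases x rule: rot_left_up.cases) auto
qed

lemma relabel_rot_right_down:
  "relabel (rot_right_down 0 (length v)) (partition_of [a] v) = partition_of [] (v @ [a])"
  unfolding partition_of_def
proof (rule fibres_relabel)
  have "x \<in> rot_right_down 0 (length v) ` points (length [a]) (length v)"
    if "x \<in> points (length []) (length (v @ [a]))" for x
  proof (cases "x = Inr (length v)")
    case True
    then show ?thesis by (intro image_eqI[of _ _ "Inl 0"]) (auto simp: rot_right_down_def)
  next
    case False
    then show ?thesis
      using that by (cases x) (auto simp: rot_right_down_def intro!: image_eqI[of x _ x])
  qed
  moreover have "rot_right_down 0 (length v) x \<in> points (length []) (length (v @ [a]))"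
    if "x \<in> points (length [a]) (length v)" for x
    using that by (cases x) (auto simp: rot_right_down_def)
  ultimately show "rot_right_down 0 (length v) ` points (length [a]) (length v) =
      points (length []) (length (v @ [a]))"
    by blast
  show "label [] (v @ [a]) (rot_right_down 0 (length v) x) = label [a] v x"
    if "x \<in> points (length [a]) (length v)" for x
    using that by (cases x) (auto simp: rot_right_down_def nth_append)
qed

lemma involution_partition_of: "involution (partition_of u v) = partition_of v u"
  unfolding involution_def partition_of_def
proof (rule fibres_relabel)
  show "case_sum Inr Inl ` points (length u) (length v) = points (length v) (length u)"
    by (simp add: points_def Plus_def image_Un image_image Un_commute)
  show "label v u (case_sum Inr Inl x) = label u v x" for x by (cases x) auto
qed

lemma tensor_partition_of:
  assumes "set u \<inter> set v = {}"
  shows "tensor 0 (length u) (partition_of [] u) (partition_of [] v) = partition_of [] (u @ v)"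
proof -
  let ?A = "points 0 (length u)" and ?B = "Inr ` (\<lambda>j. length u + j) ` {..<length v} :: point set"
  let ?f = "label [] (u @ v)"
  have AB: "points 0 (length (u @ v)) = ?A \<union> ?B"
  proof -
    have "{..<length u + length v} = {..<length u} \<union> (\<lambda>j. length u + j) ` {..<length v}"
    proof (intro equalityI subsetI)
      fix x assume "x \<in> {..<length u + length v}"
      then show "x \<in> {..<length u} \<union> (\<lambda>j. length u + j) ` {..<length v}"
        by (cases "x < length u") (auto intro!: image_eqI[of _ _ "x - length u"])
    qed auto
    then show ?thesis by (simp add: points_def Plus_def image_Un)
  qed
  have 1: "relabel (map_sum (\<lambda>i. 0 + i) (\<lambda>j. length u + j)) (partition_of [] v) = fibres ?B ?f"
    unfolding partition_of_def
    by (rule fibres_relabel) (auto simp: points_def Plus_def image_Un image_image)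
  have 2: "partition_of [] u = fibres ?A ?f"
    unfolding partition_of_def list.size
    by (rule fibres_cong) (auto simp: points_def nth_append)
  have ne: "?f x \<noteq> ?f y" if "x \<in> ?A" "y \<in> ?B" for x y
  proof -
    have "?f x \<in> set u" using that(1) by (auto simp: points_def nth_append)
    moreover have "?f y \<in> set v" using that(2) by auto
    ultimately show ?thesis using assms by auto
  qed
  have "fibres ?A ?f \<union> fibres ?B ?f = fibres (?A \<union> ?B) ?f"
  proof -
    have "{x \<in> ?A \<union> ?B. ?f x = ?f y} = {x \<in> ?A. ?f x = ?f y}" if "y \<in> ?A" for y
      using ne[OF that] by fastforce
    moreover have "{x \<in> ?A \<union> ?B. ?f x = ?f y} = {x \<in> ?B. ?f x = ?f y}" if "y \<in> ?B" for y
      using ne[OF _ that] by fastforce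
    ultimately show ?thesis
      unfolding fibres_def image_Un by (intro arg_cong2[where f = "(\<union>)"] image_cong) simp_all
  qed
  then show ?thesis
    unfolding tensor_def 1 unfolding 2 AB[symmetric] by (simp only: partition_of_def list.size)
qed

text \<open>The pair placed on top closes off the first two points, which is the contraction of
  \<open>a # b # w\<close>. The upper row is \<open>[b, a]\<close> because rotating these points
  upwards reverses their order.\<close>

lemma composition_partition_of:
  "composition 0 (length w) (partition_of [b, a] w) (partition_of [] [0, 0]) =
     partition_of [] (map (id(b := a)) w)"
proof -
  let ?m = "id(b := a)"
  let ?p = "partition_of [] [0, 0]" and ?q = "partition_of [b, a] w"
  let ?E = "\<Union>c \<in> relabel (map_sum id Inl) ?p \<union> relabel Inr ?q. c \<times> c"
  have p: "?p = fibres (points 0 2) (label [] [0, 0])"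
    and q: "?q = fibres (points 2 (length w)) (label [b, a] w)"
    by (simp_all add: partition_of_def numeral_2_eq_2)
  \<comment> \<open>Once \<open>b\<close> is renamed to \<open>a\<close>, labels are constant on the
    blocks of both factors and hence on connected components. Conversely, the two middle points link
    the blocks of \<open>a\<close> and \<open>b\<close>.\<close>
  define F :: "nat + nat + nat \<Rightarrow> nat" where "F = case_sum (\<lambda>_. a) (\<lambda>x. ?m (label [b, a] w x))"
  have p_edge: "(Inr (Inl i), Inr (Inl j)) \<in> ?E" if "i < 2" "j < 2" for i j
  proof -
    have "{Inr 0, Inr 1} \<in> ?p"
    proof -
      have "{Inr 0, Inr 1} = {x \<in> points 0 2. label [] [0, 0] x = label [] [0, 0] (Inr 0)}"
        by (auto simp: points_def less_2_cases_iff)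
      then show ?thesis unfolding p fibres_def by (rule image_eqI) simp
    qed
    then have "map_sum id Inl ` {Inr 0, Inr 1} \<in> relabel (map_sum id Inl) ?p"
      unfolding relabel_def by (rule imageI)
    moreover have "Inr (Inl i) \<in> map_sum id Inl ` {Inr 0, Inr 1 :: point}"
      "Inr (Inl j) \<in> map_sum id Inl ` {Inr 0, Inr 1 :: point}"
      using that by (auto simp: less_2_cases_iff)
    ultimately show ?thesis by blast
  qed
  have q_edge: "(Inr x, Inr y) \<in> ?E"
    if "x \<in> points 2 (length w)" "y \<in> points 2 (length w)" "label [b, a] w x = label [b, a] w y" for x y
  proof -
    have "{z \<in> points 2 (length w). label [b, a] w z = label [b, a] w x} \<in> ?q"
      using that unfolding q fibres_def by auto
    then have "Inr ` {z \<in> points 2 (length w). label [b, a] w z = label [b, a] w x} \<in> relabel Inr ?q"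
      unfolding relabel_def by (rule imageI)
    then show ?thesis using that by fastforce
  qed
  have edge: "F x = F y" if xy: "(x, y) \<in> ?E" for x y
  proof -
    from xy obtain c where c: "c \<in> relabel (map_sum id Inl) ?p \<union> relabel Inr ?q" "x \<in> c" "y \<in> c"
      by blast
    from c(1) show ?thesis
    proof
      assume "c \<in> relabel (map_sum id Inl) ?p"
      then obtain d where d: "c = map_sum id Inl ` d" "d \<in> ?p" by (auto simp: relabel_def)
      then have "d \<subseteq> points 0 2" unfolding p fibres_def by auto
      then have "z \<in> {Inr (Inl 0), Inr (Inl 1)}" if "z \<in> c" for z
        using that d(1) by (force simp: points_def less_2_cases_iff)
      from this[OF c(2)] this[OF c(3)] show ?thesis by (auto simp: F_def)
    next
      assume "c \<in> relabel Inr ?q"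
      then obtain d where d: "c = Inr ` d" "d \<in> ?q" by (auto simp: relabel_def)
      then obtain z where "d = {x \<in> points 2 (length w). label [b, a] w x = label [b, a] w z}"
        unfolding q fibres_def by auto
      then show ?thesis using c(2,3) d(1) by (auto simp: F_def)
    qed
  qed
  have inv: "F x = F y" if "(x, y) \<in> ?E\<^sup>*" for x y
    using that
  proof (induction rule: rtrancl_induct)
    case (step y z)
    then show ?case using edge[of y z] by simp
  qed simp
  have conn: "(Inr (Inr i), Inr (Inr j)) \<in> connections ?p ?q \<longleftrightarrow> ?m (w ! i) = ?m (w ! j)"
    if ij: "i < length w" "j < length w" for i j
  proof
    assume "(Inr (Inr i), Inr (Inr j)) \<in> connections ?p ?q"
    then have "F (Inr (Inr i)) = F (Inr (Inr j))" unfolding connections_def by (rule inv)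
    then show "?m (w ! i) = ?m (w ! j)" by (auto simp: F_def split: if_splits)
  next
    assume eq: "?m (w ! i) = ?m (w ! j)"
    have step: "(Inr (Inr i), Inr (Inr j)) \<in> ?E\<^sup>*"
      if "i < length w" "j < length w" "w ! i = b" "w ! j = a" for i j
    proof -
      have e: "(Inr (Inr i), Inr (Inl 0)) \<in> ?E" "(Inr (Inl 1), Inr (Inr j)) \<in> ?E"
        by (rule q_edge; use that in simp)+
      have "(Inr (Inl 0), Inr (Inl 1)) \<in> ?E" by (rule p_edge) auto
      from rtrancl_into_rtrancl[OF rtrancl_into_rtrancl[OF r_into_rtrancl[OF e(1)] this] e(2)]
      show ?thesis .
    qed
    have step2: "(Inr (Inr i), Inr (Inr j)) \<in> ?E\<^sup>*"
      if "i < length w" "j < length w" "w ! i = a" "w ! j = b" for i j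
    proof -
      have e: "(Inr (Inr i), Inr (Inl 1)) \<in> ?E" "(Inr (Inl 0), Inr (Inr j)) \<in> ?E"
        by (rule q_edge; use that in simp)+
      have "(Inr (Inl 1), Inr (Inl 0)) \<in> ?E" by (rule p_edge) auto
      from rtrancl_into_rtrancl[OF rtrancl_into_rtrancl[OF r_into_rtrancl[OF e(1)] this] e(2)]
      show ?thesis .
    qed
    consider "w ! i = w ! j" | "w ! i = b" "w ! j = a" | "w ! i = a" "w ! j = b"
      using eq by (auto split: if_splits)
    then show "(Inr (Inr i), Inr (Inr j)) \<in> connections ?p ?q"
    proof cases
      case 1
      then have "(Inr (Inr i), Inr (Inr j)) \<in> ?E" by (intro q_edge) (use ij in simp_all)
      then show ?thesis unfolding connections_def by (rule r_into_rtrancl)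
    qed (use step step2 ij in \<open>simp_all add: connections_def\<close>)
  qed
  have "{(x, y). x \<in> points 0 (length w) \<and> y \<in> points 0 (length w) \<and>
      (map_sum id Inr x, map_sum id Inr y) \<in> connections ?p ?q} `` {x} =
    {y \<in> points 0 (length w). label [] (map ?m w) y = label [] (map ?m w) x}"
    if "x \<in> points 0 (length w)" for x
    using that conn by (auto simp: points_def)
  then show ?thesis
    unfolding composition_def quotient_def partition_of_def fibres_def by auto
qed


lemma categoryD:
  assumes "category C"
  shows "C \<subseteq> all_partitions" "identity_partition \<in> C"
    and "\<lbrakk>p \<in> C; p \<in> P k l; q \<in> C; q \<in> P k' l'\<rbrakk> \<Longrightarrow> tensor k l p q \<in> C"
    and "\<lbrakk>p \<in> C; p \<in> P k l; q \<in> C; q \<in> P l m\<rbrakk> \<Longrightarrow> composition k m q p \<in> C"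
    and "p \<in> C \<Longrightarrow> involution p \<in> C"
    and "\<lbrakk>p \<in> C; p \<in> P (Suc k) l\<rbrakk> \<Longrightarrow> relabel rot_left_down p \<in> C"
    and "\<lbrakk>p \<in> C; p \<in> P k (Suc l)\<rbrakk> \<Longrightarrow> relabel rot_left_up p \<in> C"
    and "\<lbrakk>p \<in> C; p \<in> P (Suc k) l\<rbrakk> \<Longrightarrow> relabel (rot_right_down k l) p \<in> C"
  using assms by (auto simp: category_def)

definition words :: "partition set \<Rightarrow> nat list set" where
  "words C = {w. partition_of [] w \<in> C}"

lemma rotate_down_iff:
  assumes "category C"
  shows "partition_of (a # u) v \<in> C \<longleftrightarrow> partition_of u (a # v) \<in> C"
  using categoryD(6)[OF assms, of "partition_of (a # u) v" "length u" "length v"]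
    categoryD(7)[OF assms, of "partition_of u (a # v)" "length u" "length v"]
    partition_of_in_P[of "a # u" v] partition_of_in_P[of u "a # v"]
  by (auto simp: relabel_rot_left_down relabel_rot_left_up)

text \<open>Moving the upper points down on the left, one at a time, reverses their order.\<close>

lemma partition_of_iff:
  assumes "category C"
  shows "partition_of u v \<in> C \<longleftrightarrow> rev u @ v \<in> words C"
proof (induction u arbitrary: v)
  case (Cons a u)
  then show ?case using rotate_down_iff[OF assms, of a u v] by simp
qed (simp add: words_def)

lemma word_category_words:
  assumes "category C"
  shows "word_category (words C)"
proof
  show pair: "[0, 0] \<in> words C"
    using partition_of_iff[OF assms, of "[0]" "[0]"] categoryD(2)[OF assms]
    by (simp add: identity_partition_eq)
  {
    fix w and f :: "nat \<Rightarrow> nat"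
    assume w: "w \<in> words C" and f: "inj_on f (set w)"
    have "partition_of [] (map f w) = partition_of [] w"
      unfolding partition_of_def list.size length_map
      by (rule fibres_cong) (auto simp: points_def inj_on_eq_iff[OF f])
    then show "map f w \<in> words C" using w by (simp add: words_def)
  next
    fix u v
    assume u: "u \<in> words C" and v: "v \<in> words C" and "set u \<inter> set v = {}"
    then show "u @ v \<in> words C"
      using categoryD(3)[OF assms, of "partition_of [] u" 0 "length u" "partition_of [] v" 0 "length v"]
        partition_of_in_P[of "[]" u] partition_of_in_P[of "[]" v] tensor_partition_of[of u v]
      by (simp add: words_def)
  next
    fix a w
    assume w: "a # w \<in> words C"
    then have "partition_of [a] w \<in> C" using partition_of_iff[OF assms, of "[a]" w] by simp
    then show "w @ [a] \<in> words C"
      using categoryD(8)[OF assms, of "partition_of [a] w" 0 "length w"]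
        partition_of_in_P[of "[a]" w] by (simp add: words_def relabel_rot_right_down)
  next
    fix w
    assume w: "w \<in> words C"
    then have "partition_of w [] \<in> C"
      using categoryD(5)[OF assms, of "partition_of [] w"]
      by (simp add: words_def involution_partition_of)
    then show "rev w \<in> words C" using partition_of_iff[OF assms, of w "[]"] by simp
  next
    fix a b w
    assume w: "a # b # w \<in> words C"
    then have "partition_of [b, a] w \<in> C" using partition_of_iff[OF assms, of "[b, a]" w] by simp
    then show "map (id(b := a)) w \<in> words C"
      using categoryD(4)[OF assms, of "partition_of [] [0, 0]" 0 2 "partition_of [b, a] w" "length w"]
        partition_of_in_P[of "[]" "[0, 0]"] partition_of_in_P[of "[b, a]" w] pair
      by (simp add: words_def composition_partition_of numeral_2_eq_2)
  }
qed

lemma category_subset: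
  assumes "category C" "category D" "words C \<subseteq> words D"
  shows "C \<subseteq> D"
proof
  fix p assume p: "p \<in> C"
  then obtain k l where "p \<in> P k l" using categoryD(1)[OF assms(1)] by (auto simp: all_partitions_def)
  then obtain u v where "p = partition_of u v" by (rule partition_of_exhaust)
  then show "p \<in> D" using p partition_of_iff[OF assms(1)] partition_of_iff[OF assms(2)] assms(3) by blast
qed

lemma generated_eqI:
  assumes "category C" "S \<subseteq> C"
    and "\<And>D. \<lbrakk>category D; S \<subseteq> D; word_category (words D)\<rbrakk> \<Longrightarrow> words C \<subseteq> words D"
  shows "C = generated S"
proof
  show "C \<subseteq> generated S"
    unfolding generated_def
  proof (rule Inter_greatest)
    fix D assume "D \<in> {C. category C \<and> S \<subseteq> C}"
    then have D: "category D" "S \<subseteq> D" by auto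
    show "C \<subseteq> D"
      by (rule category_subset[OF assms(1) D(1) assms(3)[OF D word_category_words[OF D(1)]]])
  qed
  show "generated S \<subseteq> C" unfolding generated_def by (rule Inter_lower) (simp add: assms)
qed

section \<open>Special partitions and the classification\<close>

lemma of_word_iff: "of_word w \<in> C \<longleftrightarrow> w \<in> words C"
  by (simp add: words_def of_word_eq)

lemma double_singleton_eq: "double_singleton = of_word [0, 1]"
proof -
  have "of_word [0] = of_word [1]"
    unfolding of_word_eq partition_of_def list.size
    by (rule fibres_cong) (auto simp: points_def)
  then have "double_singleton = tensor 0 (length [0 :: nat]) (partition_of [] [0]) (partition_of [] [1])"
    by (simp add: double_singleton_def singleton_partition_def of_word_eq)
  also have "\<dots> = partition_of [] ([0] @ [1])" by (rule tensor_partition_of) simp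
  finally show ?thesis by (simp add: of_word_eq)
qed

lemma points_insert:
  "points (Suc k) l = insert (Inl k) (points k l)" "points k (Suc l) = insert (Inr l) (points k l)"
  "points 0 0 = {}"
  by (auto simp: points_def less_Suc_eq)

lemma partition_of_Int:
  "partition_of u v = (\<lambda>y. points (length u) (length v) \<inter> label u v -` {label u v y}) `
     points (length u) (length v)"
  by (simp add: partition_of_def fibres_def vimage_def Int_def)

text \<open>The labels are chosen so that the upper row read backwards, followed by the lower row,
  is numbered in order of appearance: here \<open>0 1 0 1\<close>, and \<open>0 1 2 0 1 2\<close>
  and \<open>0 1 1 0 1 1\<close> for the next two.\<close>

lemma crossing_eq: "crossing = partition_of [1, 0] [0, 1]"
  unfolding crossing_def partition_of_Int
  by (simp add: points_insert insert_commute)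

lemma half_liberating_eq: "half_liberating = partition_of [2, 1, 0] [0, 1, 2]"
  unfolding half_liberating_def partition_of_Int
  by (simp add: points_insert insert_commute numeral_2_eq_2)

lemma pair_positioner_eq: "pair_positioner = partition_of [1, 1, 0] [0, 1, 1]"
  unfolding pair_positioner_def partition_of_Int
  by (simp add: points_insert insert_commute numeral_2_eq_2)

lemma g_partition_eq: "g_partition = partition_of [] [0, 1, 2, 1]"
  unfolding g_partition_def partition_of_Int
  by (simp add: points_insert insert_commute eval_nat_numeral)

lemma generators_iff:
  assumes "category C"
  shows "singleton_partition \<in> C \<longleftrightarrow> [0] \<in> words C"
    and "double_singleton \<in> C \<longleftrightarrow> [0, 1] \<in> words C"
    and "four_block \<in> C \<longleftrightarrow> [0, 0, 0, 0] \<in> words C"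
    and "g_partition \<in> C \<longleftrightarrow> [0, 1, 2, 1] \<in> words C"
    and "crossing \<in> C \<longleftrightarrow> [0, 1, 0, 1] \<in> words C"
    and "half_liberating \<in> C \<longleftrightarrow> [0, 1, 2, 0, 1, 2] \<in> words C"
    and "pair_positioner \<in> C \<longleftrightarrow> [0, 1, 1, 0, 1, 1] \<in> words C"
    and "pi_partition l \<in> C \<longleftrightarrow> pi_word [0..<l] \<in> words C"
    and "empty_partition \<in> C"
proof -
  interpret word_category "words C" by (rule word_category_words[OF assms])
  show "empty_partition \<in> C" using nil of_word_iff[of "[]"] by (simp add: empty_partition_def of_word_def)
  show "pi_partition l \<in> C \<longleftrightarrow> pi_word [0..<l] \<in> words C"
    by (simp add: pi_partition_def pi_word_def of_word_iff)
qed (simp_all add: singleton_partition_def double_singleton_eq four_block_def of_word_iff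
    g_partition_eq crossing_eq half_liberating_eq pair_positioner_eq partition_of_iff[OF assms])

text \<open>If \<open>g\<close> belongs to \<open>C\<close>, then \<open>C\<close> is determined by
  which of singleton, four block and crossing it contains: 8 categories. Otherwise it contains
  neither singleton nor four block, as the latter would bring along the double singleton and then
  \<open>g\<close>. A crossing now excludes the double singleton, which leaves one category; in its
  absence, \<open>h\<close> and the double singleton distinguish the other 4.\<close>

theorem non_hyperoctahedral_cases:
  assumes C: "category C" and "\<not> hyperoctahedral C"
  shows "C \<in> {generated {empty_partition},
               generated {singleton_partition},
               generated {g_partition},
               generated {double_singleton},
               generated {crossing},
               generated {crossing, singleton_partition},
               generated {crossing, double_singleton},
               generated {half_liberating},
               generated {half_liberating, double_singleton},
               generated {singleton_partition, four_block},
               generated {double_singleton, four_block},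
               generated {crossing, singleton_partition, four_block},
               generated {crossing, double_singleton, four_block}}"
proof -
  interpret W: word_category "words C" by (rule word_category_words[OF C])
  note WC = W.word_category_axioms and C_iff = generators_iff[OF C]
  let ?S = "singleton_partition \<in> C" and ?c = "crossing \<in> C" and ?b = "four_block \<in> C"
    and ?g = "g_partition \<in> C" and ?SS = "double_singleton \<in> C" and ?h = "half_liberating \<in> C"
  have hyp: "?b \<Longrightarrow> ?SS" using assms(2) by (simp add: hyperoctahedral_def)
  have b_g: "?b \<Longrightarrow> ?g" using W.g_if_four_block hyp C_iff by simp
  have S_g: "?S \<Longrightarrow> ?g" using W.g_if_singleton C_iff by simp
  have g_SS: "?g \<Longrightarrow> ?SS"
    using W.double_singleton_if_singleton[of "[]" 0 "[1, 2, 1]"] C_iff by simp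
  have c_g: "?c \<Longrightarrow> ?SS \<Longrightarrow> ?g" using W.g_if_crossing C_iff by simp
  have eq_g: "C = generated S"
    if "?g" "S \<subseteq> C" "\<And>D. \<lbrakk>category D; S \<subseteq> D; word_category (words D)\<rbrakk> \<Longrightarrow> g_partition \<in> D"
      "?S \<Longrightarrow> singleton_partition \<in> S" "?b \<Longrightarrow> four_block \<in> S" "?c \<Longrightarrow> crossing \<in> S" for S
  proof (rule generated_eqI[OF C that(2)])
    fix D assume D: "category D" "S \<subseteq> D" "word_category (words D)"
    show "words C \<subseteq> words D"
      by (rule subset_if_g[OF WC D(3)])
        (use that(1) that(3)[OF D] that(4-6) D(2) C_iff generators_iff[OF D(1)] in blast)+
  qed
  have eq_even: "C = generated S"
    if "\<not> ?g" "\<not> ?c" "S \<subseteq> C" "?SS \<Longrightarrow> double_singleton \<in> S" "?h \<Longrightarrow> half_liberating \<in> S" for S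
  proof (rule generated_eqI[OF C that(3)])
    fix D assume D: "category D" "S \<subseteq> D" "word_category (words D)"
    show "words C \<subseteq> words D"
      by (rule subset_if_even_blocks[OF WC D(3)])
        (use that b_g D(2) C_iff generators_iff[OF D(1)] in blast)+
  qed
  \<comment> \<open>Some of the lists name neither \<open>g\<close> nor the singleton; there
    \<open>g\<close> is recovered from the double singleton and the four block or the
    crossing.\<close>
  have gD: "g_partition \<in> D"
    if D: "category D" "word_category (words D)"
      and S: "singleton_partition \<in> D \<or> double_singleton \<in> D \<and> (four_block \<in> D \<or> crossing \<in> D)" for D
  proof -
    interpret D: word_category "words D" by fact
    show ?thesis
      using S D.g_if_singleton D.g_if_four_block D.g_if_crossing generators_iff[OF D(1)] by blast
  qed
  show ?thesis
  proof (cases "?g")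
    case g: True
    note eq = eq_g[OF g]
    show ?thesis
    proof (cases "?S")
      case S: True
      consider "\<not> ?b" "\<not> ?c" | "\<not> ?b" "?c" | "?b" "\<not> ?c" | "?b" "?c" by blast
      then show ?thesis
      proof cases
        case 1
        from this gD S have "C = generated {singleton_partition}" by (intro eq) auto
        then show ?thesis by (simp only: insert_iff simp_thms)
      next
        case 2
        from this gD S have "C = generated {crossing, singleton_partition}" by (intro eq) auto
        then show ?thesis by (simp only: insert_iff simp_thms)
      next
        case 3
        from this gD S have "C = generated {singleton_partition, four_block}" by (intro eq) auto
        then show ?thesis by (simp only: insert_iff simp_thms)
      next
        case 4
        from this gD S have "C = generated {crossing, singleton_partition, four_block}" by (intro eq) auto
        then show ?thesis by (simp only: insert_iff simp_thms)
      qed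
    next
      case S: False
      note SS = g_SS[OF g]
      consider "\<not> ?b" "\<not> ?c" | "\<not> ?b" "?c" | "?b" "\<not> ?c" | "?b" "?c" by blast
      then show ?thesis
      proof cases
        case 1
        with g S have "C = generated {g_partition}" by (intro eq) auto
        then show ?thesis by (simp only: insert_iff simp_thms)
      next
        case 2
        with gD S SS have "C = generated {crossing, double_singleton}" by (intro eq) auto
        then show ?thesis by (simp only: insert_iff simp_thms)
      next
        case 3
        with gD S SS have "C = generated {double_singleton, four_block}" by (intro eq) auto
        then show ?thesis by (simp only: insert_iff simp_thms)
      next
        case 4
        with gD S SS have "C = generated {crossing, double_singleton, four_block}" by (intro eq) auto
        then show ?thesis by (simp only: insert_iff simp_thms)
      qed
    qed
  next
    case g: False
    show ?thesis
    proof (cases "?c")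
      case c: True
      have "C = generated {crossing}"
      proof (rule generated_eqI[OF C])
        fix D assume D: "category D" "{crossing} \<subseteq> D" "word_category (words D)"
        show "words C \<subseteq> words D"
        proof (rule subset_if_crossing_pairs[OF WC D(3)])
          show "[0, 0, 0, 0] \<notin> words C" "[0, 1] \<notin> words C" using g c b_g c_g C_iff by auto
          show "[0, 1, 0, 1] \<in> words D" using D(2) generators_iff[OF D(1)] by auto
        qed
      qed (use c in simp)
      then show ?thesis by (simp only: insert_iff simp_thms)
    next
      case c: False
      note eq = eq_even[OF g c]
      consider "?h" "?SS" | "?h" "\<not> ?SS" | "\<not> ?h" "?SS" | "\<not> ?h" "\<not> ?SS" by blast
      then show ?thesis
      proof cases
        case 1
        with C_iff(9) have "C = generated {half_liberating, double_singleton}" by (intro eq) auto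
        then show ?thesis by (simp only: insert_iff simp_thms)
      next
        case 2
        with C_iff(9) have "C = generated {half_liberating}" by (intro eq) auto
        then show ?thesis by (simp only: insert_iff simp_thms)
      next
        case 3
        with C_iff(9) have "C = generated {double_singleton}" by (intro eq) auto
        then show ?thesis by (simp only: insert_iff simp_thms)
      next
        case 4
        with C_iff(9) have "C = generated {empty_partition}" by (intro eq) auto
        then show ?thesis by (simp only: insert_iff simp_thms)
      qed
    qed
  qed
qed

lemma downward_closed_enat:
  assumes "1 \<in> K" "\<And>l. Suc l \<in> K \<Longrightarrow> 1 \<le> l \<Longrightarrow> l \<in> K" "\<And>l. l \<in> K \<Longrightarrow> 1 \<le> l"
  obtains k :: enat where "1 \<le> k" "K = {l. 1 \<le> l \<and> enat l \<le> k}"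
proof -
  have down: "m \<in> K" if "l \<in> K" "m \<le> l" "1 \<le> m" for l m
    using that(2,1,3) by (induction rule: dec_induct) (use assms(2) in auto)
  show ?thesis
  proof (cases "finite K")
    case True
    have "Max K \<in> K" by (rule Max_in) (use True assms(1) in auto)
    then have "l \<in> K \<longleftrightarrow> 1 \<le> l \<and> enat l \<le> enat (Max K)" for l
      using down[of "Max K" l] assms(3)[of l] Max_ge[OF True, of l] by auto
    then have "K = {l. 1 \<le> l \<and> enat l \<le> enat (Max K)}" by blast
    moreover have "1 \<le> enat (Max K)" using assms(3)[OF \<open>Max K \<in> K\<close>] by (simp add: one_enat_def)
    ultimately show ?thesis using that by blast
  next
    case False
    have "l \<in> K" if "1 \<le> l" for l
    proof -
      obtain m where "m \<in> K" "l \<le> m" using False by (meson finite_nat_set_iff_bounded_le nat_le_linear)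
      then show ?thesis using down that by blast
    qed
    then have "K = {l. 1 \<le> l \<and> enat l \<le> \<infinity>}" using assms(3) by auto
    then show ?thesis using that[of \<infinity>] by simp
  qed
qed

theorem hyperoctahedral_not_group_theoretical:
  assumes C: "category C" "hyperoctahedral C" "pair_positioner \<notin> C"
  shows "\<exists>k :: enat. k \<ge> 1 \<and> C = generated {pi_partition l | l. l \<ge> 1 \<and> enat l \<le> k}"
proof -
  interpret W: word_category "words C" by (rule word_category_words[OF C(1)])
  note C_iff = generators_iff[OF C(1)]
  have pi_1: "pi_word [0..<1] = [0, 0, 0, 0]" by (simp add: pi_word_def)
  have b4: "[0, 0, 0, 0] \<in> words C" using C(2) C_iff by (simp add: hyperoctahedral_def)
  have tree: "tree_walk w" if "w \<in> words C" for w
    using W.tree_walk_if_no_pair_positioner[OF b4 _ _ that] C(2,3) C_iff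
    by (simp add: hyperoctahedral_def)
  define K where "K = {l. 1 \<le> l \<and> pi_partition l \<in> C}"
  \<comment> \<open>The two pairs \<open>l l\<close> in the word cancel. Hence \<open>K\<close> is
    an initial segment of the positive integers, starting with the index 1 of the four block and
    ending at \<open>k\<close>, which is infinite if \<open>K\<close> is.\<close>
  have down: "pi_word [0..<l] \<in> words C" if "pi_word [0..<Suc l] \<in> words C" for l
  proof -
    let ?p = "[0..<l]"
    have "?p @ [l, l] @ (rev ?p @ ?p @ [l, l] @ rev ?p) \<in> words C"
      using that by (simp add: pi_word_def)
    from W.contract_equal[OF this]
    have "(?p @ rev ?p @ ?p) @ [l, l] @ rev ?p \<in> words C" by simp
    from W.contract_equal[OF this] show ?thesis by (simp add: pi_word_def)
  qed
  obtain k where k: "1 \<le> k" "K = {l. 1 \<le> l \<and> enat l \<le> k}"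
  proof (rule downward_closed_enat[of K])
    show "1 \<in> K" using b4 pi_1 C_iff(8)[of 1] by (simp add: K_def)
  qed (use down C_iff(8) in \<open>auto simp: K_def\<close>)
  have "C = generated {pi_partition l | l. l \<in> K}"
  proof (rule generated_eqI[OF C(1)])
    show "{pi_partition l | l. l \<in> K} \<subseteq> C" by (auto simp: K_def)
    fix D assume D: "category D" "{pi_partition l | l. l \<in> K} \<subseteq> D" "word_category (words D)"
    have pi: "pi_word [0..<l] \<in> words D" if "1 \<le> l" "pi_word [0..<l] \<in> words C" for l
      using that D(2) C_iff(8) generators_iff(8)[OF D(1)] by (auto simp: K_def)
    show "words C \<subseteq> words D"
      by (rule subset_if_tree_walks[OF W.word_category_axioms D(3) tree])
        (use pi[of 1] pi pi_1 b4 in auto)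
  qed
  then show ?thesis using k by auto
qed

theorem theorem2:
  fixes n :: nat
    and A :: "'a cstar_alg"
    and u :: "nat \<Rightarrow> nat \<Rightarrow> 'a"
    and \<Delta> :: "'a \<Rightarrow> (nat \<Rightarrow> ('a \<times> 'a) list set) set"
    and C :: "partition set"
  assumes "n \<ge> 1"
    and "easy_quantum_group n A u \<Delta> C"
  shows "(\<not> hyperoctahedral C \<and>
          C \<in> {generated {empty_partition},
               generated {singleton_partition},
               generated {g_partition},
               generated {double_singleton},
               generated {crossing},
               generated {crossing, singleton_partition},
               generated {crossing, double_singleton},
               generated {half_liberating},
               generated {half_liberating, double_singleton},
               generated {singleton_partition, four_block},
               generated {double_singleton, four_block},
               generated {crossing, singleton_partition, four_block},
               generated {crossing, double_singleton, four_block}})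
       \<or> (hyperoctahedral C \<and> pair_positioner \<in> C)
       \<or> (\<exists>k :: enat. k \<ge> 1 \<and> C = generated {pi_partition l | l. l \<ge> 1 \<and> enat l \<le> k})"
proof -
  have C: "category C" using assms(2) by (simp add: easy_quantum_group_def)
  show ?thesis
    using non_hyperoctahedral_cases[OF C] hyperoctahedral_not_group_theoretical[OF C]
    by (cases "hyperoctahedral C"; cases "pair_positioner \<in> C") (simp_all only: simp_thms)
qed

end
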